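(* Let $(M,g_0)$ be a complete non-compact Riemannian manifold of dimension $n\geq 3$ with non-negative scalar curvature $R_0=R(g_0)\ge 0$, and assume that $(M,g_0)$ satisfies property (M), i.e. there is a smooth positive function $v>0$ on $M$ with $$-\frac{4(n-1)}{n-2}\Delta_{g_0}v+R_0v=R_0\quad\text{in } M,\qquad v(x)\to 0\ \text{ as } x\to\infty.$$ Then there is a complete Yamabe metric $g$, conformal to $g_0$, with zero scalar curvature; that is, there is a function $w\in C^2(M)$, $w>0$, such that $g=w^{\frac{4}{n-2}}g_0$ is a complete Riemannian metric on $M$ with $R(g)=0$.
   Context: Manifolds are connected and smooth. $\Delta_{g_0}$ is the Laplace–Beltrami operator of $g_0$ (the trace of the Hessian, so $\Delta=\sum\partial_i^2$ on Euclidean space), $R(g)$ is the scalar curvature of a metric $g$, and $x\to\infty$ means $d_{g_0}(x,p)\to\infty$ for a fixed point $p\in M$, where $d_{g_0}$ is the Riemannian distance of $g_0$. The conformal Laplacian is $Lu=-\frac{4(n-1)}{n-2}\Delta_{g_0}u+R_0u$, and for $g=u^{\frac{4}{n-2}}g_0$ with $0<u\in C^2(M)$ one has $R(g)=u^{-\frac{n+2}{n-2}}Lu$. A complete Yamabe metric on $(M,g_0)$ is a complete metric conformal to $g_0$ with constant scalar curvature. *)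

theory Defs
  imports "HOL-Analysis.Analysis" "HOL-Library.Extended_Nat"
begin

section \<open>Functions of class \<open>C\<^sup>k\<close> on open subsets of \<open>\<real>\<^sup>n\<close>\<close>

definition partial :: "'n::finite \<Rightarrow> (real^'n \<Rightarrow> real) \<Rightarrow> real^'n \<Rightarrow> real" where
  "partial i f y = frechet_derivative f (at y) (axis i 1)"

primrec Ck_on :: "nat \<Rightarrow> (real^'n::finite \<Rightarrow> real) \<Rightarrow> (real^'n) set \<Rightarrow> bool" where
  "Ck_on 0 f S \<longleftrightarrow> continuous_on S f"
| "Ck_on (Suc k) f S \<longleftrightarrow> f differentiable_on S \<and> (\<forall>i. Ck_on k (partial i f) S)"

text \<open>The order \<open>k\<close> may be \<open>\<infinity>\<close>, in which case the function is smooth.\<close>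

definition C_on :: "enat \<Rightarrow> (real^'n::finite \<Rightarrow> real) \<Rightarrow> (real^'n) set \<Rightarrow> bool" where
  "C_on k f S \<longleftrightarrow> (\<forall>m. enat m \<le> k \<longrightarrow> Ck_on m f S)"


section \<open>Smooth manifolds\<close>

text \<open>
  The underlying space of a manifold is a whole type \<open>'m\<close>, its dimension is \<open>CARD('n)\<close>.
  A chart is a pair \<open>(U, \<phi>)\<close>; the values of \<open>\<phi>\<close> outside \<open>U\<close> are irrelevant.
  A smooth structure is given by an arbitrary (not necessarily maximal) smooth atlas.
\<close>

type_synonym ('m, 'n) chart = "'m set \<times> ('m \<Rightarrow> real^'n)"

definition chart_inv :: "('m, 'n::finite) chart \<Rightarrow> real^'n \<Rightarrow> 'm" where
  "chart_inv c = inv_into (fst c) (snd c)"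

definition smooth_atlas ::
  "('m::{t2_space,second_countable_topology}, 'n::finite) chart set \<Rightarrow> bool" where
  "smooth_atlas A \<longleftrightarrow>
     (\<Union>c\<in>A. fst c) = UNIV \<and>
     (\<forall>c\<in>A. open (fst c) \<and> open (snd c ` fst c) \<and>
        homeomorphism (fst c) (snd c ` fst c) (snd c) (chart_inv c)) \<and>
     (\<forall>c\<in>A. \<forall>d\<in>A. \<forall>i.
        C_on \<infinity> (\<lambda>y. snd d (chart_inv c y) $ i) (snd c ` (fst c \<inter> fst d)))"

definition C_manifold :: "('m, 'n::finite) chart set \<Rightarrow> enat \<Rightarrow> ('m \<Rightarrow> real) \<Rightarrow> bool" where
  "C_manifold A k u \<longleftrightarrow> (\<forall>c\<in>A. C_on k (u \<circ> chart_inv c) (snd c ` fst c))"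


section \<open>Riemannian metrics\<close>

text \<open>
  A metric is the family of its component matrices: \<open>g c p $ i $ j\<close> is the value at \<open>p\<close> of the
  component \<open>g\<^sub>i\<^sub>j\<close> in the chart \<open>c\<close>, and the components in different charts are related by the
  transformation law of covariant 2-tensors.
\<close>

type_synonym ('m, 'n) metric_field = "('m, 'n) chart \<Rightarrow> 'm \<Rightarrow> real^'n^'n"

definition riemannian_metric ::
  "('m, 'n::finite) chart set \<Rightarrow> enat \<Rightarrow> ('m, 'n) metric_field \<Rightarrow> bool" where
  "riemannian_metric A k g \<longleftrightarrow>
     (\<forall>c\<in>A. \<forall>p\<in>fst c. transpose (g c p) = g c p \<and> (\<forall>v. v \<noteq> 0 \<longrightarrow> 0 < v \<bullet> (g c p *v v))) \<and>
     (\<forall>c\<in>A. \<forall>i j. C_on k (\<lambda>y. g c (chart_inv c y) $ i $ j) (snd c ` fst c)) \<and>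
     (\<forall>c\<in>A. \<forall>d\<in>A. \<forall>p\<in>fst c \<inter> fst d.
        g c p = (let J = jacobian (snd d \<circ> chart_inv c) (at (snd c p))
                 in transpose J ** g d p ** J))"

definition conformal_metric ::
  "('m \<Rightarrow> real) \<Rightarrow> ('m, 'n::finite) metric_field \<Rightarrow> ('m, 'n) metric_field" where
  "conformal_metric w g c p = (w p powr (4 / (real CARD('n) - 2))) *\<^sub>R g c p"


section \<open>Riemannian distance and completeness\<close>

text \<open>
  A piecewise \<open>C\<^sup>1\<close> curve is required to be \<open>C\<^sup>1\<close> up to the end points on each of the finitely many
  closed subintervals cut out by the break points. This is stronger than the library's
  \<^const>\<open>piecewise_C1_differentiable_on\<close> and makes the speed bounded, so that the integral defining
  the length always exists.
\<close>

definition C1_curve_on ::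
  "('m::topological_space, 'n::finite) chart set \<Rightarrow> (real \<Rightarrow> 'm) \<Rightarrow> real set \<Rightarrow> bool" where
  "C1_curve_on A \<gamma> T \<longleftrightarrow> continuous_on T \<gamma> \<and>
     (\<forall>c\<in>A. \<exists>D. continuous_on {t\<in>T. \<gamma> t \<in> fst c} D \<and>
        (\<forall>t\<in>T. \<gamma> t \<in> fst c \<longrightarrow> ((snd c \<circ> \<gamma>) has_vector_derivative D t) (at t within T)))"

definition piecewise_C1_path ::
  "('m::topological_space, 'n::finite) chart set \<Rightarrow> (real \<Rightarrow> 'm) \<Rightarrow> bool" where
  "piecewise_C1_path A \<gamma> \<longleftrightarrow> path \<gamma> \<and>
     (\<exists>S. finite S \<and>
        (\<forall>a b. 0 \<le> a \<and> a < b \<and> b \<le> 1 \<and> {a<..<b} \<inter> S = {} \<longrightarrow> C1_curve_on A \<gamma> {a..b}))"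

text \<open>
  By the transformation law the speed does not depend on the chart chosen around \<open>\<gamma> t\<close>.
  Its values at the end points and break points are irrelevant for the length.
\<close>

definition speed ::
  "('m, 'n::finite) chart set \<Rightarrow> ('m, 'n) metric_field \<Rightarrow> (real \<Rightarrow> 'm) \<Rightarrow> real \<Rightarrow> real" where
  "speed A g \<gamma> t =
     (let c = (SOME c. c \<in> A \<and> \<gamma> t \<in> fst c);
          v = vector_derivative (snd c \<circ> \<gamma>) (at t)
      in sqrt (v \<bullet> (g c (\<gamma> t) *v v)))"

definition curve_length ::
  "('m, 'n::finite) chart set \<Rightarrow> ('m, 'n) metric_field \<Rightarrow> (real \<Rightarrow> 'm) \<Rightarrow> real" where
  "curve_length A g \<gamma> = integral {0..1} (speed A g \<gamma>)"

definition riemannian_dist ::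
  "('m::topological_space, 'n::finite) chart set \<Rightarrow> ('m, 'n) metric_field \<Rightarrow> 'm \<Rightarrow> 'm \<Rightarrow> real" where
  "riemannian_dist A g p q =
     Inf {curve_length A g \<gamma> |\<gamma>. piecewise_C1_path A \<gamma> \<and> pathstart \<gamma> = p \<and> pathfinish \<gamma> = q}"

definition complete_metric ::
  "('m::topological_space, 'n::finite) chart set \<Rightarrow> ('m, 'n) metric_field \<Rightarrow> bool" where
  "complete_metric A g \<longleftrightarrow> Metric_space.mcomplete UNIV (riemannian_dist A g)"

definition manifold_at_infinity ::
  "('m::topological_space, 'n::finite) chart set \<Rightarrow> ('m, 'n) metric_field \<Rightarrow> 'm \<Rightarrow> 'm filter" where
  "manifold_at_infinity A g p = filtercomap (\<lambda>x. riemannian_dist A g x p) at_top"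


section \<open>Laplace--Beltrami operator and scalar curvature\<close>

text \<open>
  The following are the classical coordinate expressions for a metric \<open>G\<close> on an open subset of
  \<open>\<real>\<^sup>n\<close>. Conventions: \<open>christoffel G k i j\<close> is \<open>\<Gamma>\<^sup>k\<^sub>i\<^sub>j\<close>; \<open>riemann G l i j k\<close> is the component
  along the \<open>l\<close>-th coordinate field of \<open>R(\<partial>\<^sub>i,\<partial>\<^sub>j)\<partial>\<^sub>k\<close>, where
  \<open>R(X,Y) = [\<nabla>\<^sub>X,\<nabla>\<^sub>Y] - \<nabla>\<^sub>[\<^sub>X\<^sub>,\<^sub>Y\<^sub>]\<close>; the Ricci tensor is the trace of \<open>X \<mapsto> R(X,\<partial>\<^sub>j)\<partial>\<^sub>k\<close>.
  With these signs the round sphere has positive scalar curvature.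
\<close>

definition christoffel ::
  "(real^'n \<Rightarrow> real^'n^'n) \<Rightarrow> 'n::finite \<Rightarrow> 'n \<Rightarrow> 'n \<Rightarrow> real^'n \<Rightarrow> real" where
  "christoffel G k i j y =
     (\<Sum>l\<in>UNIV. matrix_inv (G y) $ k $ l *
        (partial i (\<lambda>z. G z $ j $ l) y + partial j (\<lambda>z. G z $ i $ l) y
          - partial l (\<lambda>z. G z $ i $ j) y)) / 2"

definition hessian ::
  "(real^'n \<Rightarrow> real^'n^'n) \<Rightarrow> (real^'n \<Rightarrow> real) \<Rightarrow> 'n::finite \<Rightarrow> 'n \<Rightarrow> real^'n \<Rightarrow> real" where
  "hessian G f i j y =
     partial i (partial j f) y - (\<Sum>k\<in>UNIV. christoffel G k i j y * partial k f y)"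

definition riemann ::
  "(real^'n \<Rightarrow> real^'n^'n) \<Rightarrow> 'n::finite \<Rightarrow> 'n \<Rightarrow> 'n \<Rightarrow> 'n \<Rightarrow> real^'n \<Rightarrow> real" where
  "riemann G l i j k y =
     partial i (christoffel G l j k) y - partial j (christoffel G l i k) y
     + (\<Sum>m\<in>UNIV. christoffel G l i m y * christoffel G m j k y
                 - christoffel G l j m y * christoffel G m i k y)"

definition ricci ::
  "(real^'n \<Rightarrow> real^'n^'n) \<Rightarrow> 'n::finite \<Rightarrow> 'n \<Rightarrow> real^'n \<Rightarrow> real" where
  "ricci G j k y = (\<Sum>i\<in>UNIV. riemann G i i j k y)"

definition metric_trace ::
  "(real^'n \<Rightarrow> real^'n^'n) \<Rightarrow> ('n::finite \<Rightarrow> 'n \<Rightarrow> real^'n \<Rightarrow> real) \<Rightarrow> real^'n \<Rightarrow> real" where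
  "metric_trace G h y = (\<Sum>i\<in>UNIV. \<Sum>j\<in>UNIV. matrix_inv (G y) $ i $ j * h i j y)"

text \<open>
  On a manifold, the value at \<open>p\<close> is computed in a chart \<open>c\<close> around \<open>p\<close>. It is independent of \<open>c\<close>,
  and statements about these quantities range over all charts around the point.
\<close>

definition coord_metric ::
  "('m, 'n::finite) metric_field \<Rightarrow> ('m, 'n) chart \<Rightarrow> real^'n \<Rightarrow> real^'n^'n" where
  "coord_metric g c y = g c (chart_inv c y)"

definition laplace_beltrami ::
  "('m, 'n::finite) metric_field \<Rightarrow> ('m, 'n) chart \<Rightarrow> ('m \<Rightarrow> real) \<Rightarrow> 'm \<Rightarrow> real" where
  "laplace_beltrami g c u p =
     metric_trace (coord_metric g c) (hessian (coord_metric g c) (u \<circ> chart_inv c)) (snd c p)"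

definition scalar_curvature ::
  "('m, 'n::finite) metric_field \<Rightarrow> ('m, 'n) chart \<Rightarrow> 'm \<Rightarrow> real" where
  "scalar_curvature g c p =
     metric_trace (coord_metric g c) (ricci (coord_metric g c)) (snd c p)"

definition conformal_laplacian ::
  "('m, 'n::finite) metric_field \<Rightarrow> ('m, 'n) chart \<Rightarrow> ('m \<Rightarrow> real) \<Rightarrow> 'm \<Rightarrow> real" where
  "conformal_laplacian g c u p =
     - (4 * (real CARD('n) - 1) / (real CARD('n) - 2)) * laplace_beltrami g c u p
     + scalar_curvature g c p * u p"

definition property_M ::
  "('m::topological_space, 'n::finite) chart set \<Rightarrow> ('m, 'n) metric_field \<Rightarrow> 'm \<Rightarrow> bool" where
  "property_M A g p \<longleftrightarrow>
     (\<exists>v. C_manifold A \<infinity> v \<and> (\<forall>x. 0 < v x) \<and>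
        (\<forall>c\<in>A. \<forall>x\<in>fst c. conformal_laplacian g c v x = scalar_curvature g c x) \<and>
        (v \<longlongrightarrow> 0) (manifold_at_infinity A g p))"

end

(*
  The conformal metric is w^(4/(n-2)) g0 with w = 1 - v. Since L is linear and L v = R0 = L 1, the
  function w satisfies L w = 0, and R(g) = 0 follows from the transformation law of the scalar
  curvature. At a nonpositive minimum mu of w the nonnegative function u = w - mu satisfies
  (4(n-1)/(n-2)) Delta u = R0 w <= R0 u, so by Hopf's strong maximum principle its zero set is open
  as well as closed, and w would be constant, which contradicts w -> 1 at infinity; hence w > 0.
  The minimum is attained, and infinity is nonempty, because by Hopf-Rinow closed balls of a complete
  metric are compact. For the same reason w is bounded below by a positive constant, so the distance
  of g dominates a multiple of the distance of g0 and g is complete.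
*)

theory Submission
  imports Defs
begin

text \<open>Curvature is given by classical coordinate formulas and distance as an infimum of
  integrals, so every geometric input is derived from these. For curvature the conformal factor is
  written \<open>exp (2 * f)\<close>; the change of the Ricci tensor then becomes an identity
  between finite sums at one point, and \<open>f = 2 / (n - 2) * ln w\<close> cancels the squared
  gradient, which is the origin of the exponent 4/(n-2). Nonnegativity of R0 enters through the
  maximum principle: it lets R0 w be replaced by R0 u, and it gives the zeroth-order coefficient the
  sign that Hopf's argument requires. Hopf-Rinow is proved without geodesics, in Cohn-Vossen's form
  for complete, locally compact length spaces: a curve only has to be divided at a prescribed arc
  length, which a continuous metric permits. The same theory of lengths therefore applies to g0 and
  to the conformal metric, and since both distances induce the manifold topology, limits pass from
  one to the other.\<close>

section \<open>Calculus of functions of class \<open>C\<^sup>k\<close>\<close>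

lemma partial_eq:
  "(f has_derivative f') (at y) \<Longrightarrow> partial i f y = f' (axis i 1)"
  unfolding partial_def using frechet_derivative_at by metis

text \<open>Near \<open>y\<close> both functions have the same derivatives, so the choice behind
  \<open>frechet_derivative\<close> agrees for them even where neither is differentiable.\<close>

lemma partial_cong:
  assumes "open S" "y \<in> S" "\<And>x. x \<in> S \<Longrightarrow> f x = g x"
  shows "partial i f y = partial i g y"
proof -
  have "(f has_derivative f') (at y) \<longleftrightarrow> (g has_derivative f') (at y)" for f'
    using has_derivative_transform_within_open[OF _ assms(1,2)] assms(3) by metis
  then show ?thesis by (simp add: partial_def frechet_derivative_def)
qed

lemma has_derivative_partial:
  fixes f :: "real^'n::finite \<Rightarrow> real"
  assumes "f differentiable (at y)"
  shows "(f has_derivative (\<lambda>v. \<Sum>i\<in>UNIV. v $ i * partial i f y)) (at y)"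
proof -
  obtain f' where f': "(f has_derivative f') (at y)"
    using assms by (auto simp: differentiable_def)
  interpret linear f' by (rule has_derivative_linear[OF f'])
  have "f' v = (\<Sum>i\<in>UNIV. v $ i * partial i f y)" for v
    by (subst basis_expansion[of v, symmetric, unfolded scalar_mult_eq_scaleR])
       (simp add: sum scale partial_eq[OF f'])
  then have "f' = (\<lambda>v. \<Sum>i\<in>UNIV. v $ i * partial i f y)" by auto
  with f' show ?thesis by simp
qed

lemma partial_const [simp]: "partial i (\<lambda>x. c) y = 0"
  by (rule partial_eq[OF has_derivative_const, THEN trans]) simp

lemma partial_add:
  assumes "f differentiable (at y)" "g differentiable (at y)"
  shows "partial i (\<lambda>x. f x + g x) y = partial i f y + partial i g y"
  using partial_eq[OF has_derivative_add[OF has_derivative_partial[OF assms(1)] has_derivative_partial[OF assms(2)]], of i]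
  by (simp add: axis_def if_distrib if_distribR cong: if_cong)

lemma partial_diff:
  assumes "f differentiable (at y)" "g differentiable (at y)"
  shows "partial i (\<lambda>x. f x - g x) y = partial i f y - partial i g y"
  using partial_eq[OF has_derivative_diff[OF has_derivative_partial[OF assms(1)] has_derivative_partial[OF assms(2)]], of i]
  by (simp add: axis_def if_distrib if_distribR cong: if_cong)

lemma partial_mult:
  assumes "f differentiable (at y)" "g differentiable (at y)"
  shows "partial i (\<lambda>x. f x * g x) y = f y * partial i g y + partial i f y * g y"
  using partial_eq[OF has_derivative_mult[OF has_derivative_partial[OF assms(1)] has_derivative_partial[OF assms(2)]], of i]
  by (simp add: axis_def if_distrib if_distribR cong: if_cong)

lemma partial_cmult:
  assumes "f differentiable (at y)"
  shows "partial i (\<lambda>x. c * f x) y = c * partial i f y"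
  using partial_mult[where f="\<lambda>_. c", OF differentiable_const assms, of i] by simp

lemma partial_sum:
  assumes "finite I" "\<And>k. k \<in> I \<Longrightarrow> f k differentiable (at y)"
  shows "partial i (\<lambda>x. \<Sum>k\<in>I. f k x) y = (\<Sum>k\<in>I. partial i (f k) y)"
  using assms
  by (induction rule: finite_induct) (auto simp: partial_add)

lemma partial_chain:
  assumes f: "f differentiable (at y)" and F: "(F has_real_derivative d) (at (f y))"
  shows "partial i (\<lambda>x. F (f x)) y = d * partial i f y"
proof -
  have "((\<lambda>x. F (f x)) has_derivative (\<lambda>v. d * (\<Sum>i\<in>UNIV. v $ i * partial i f y))) (at y)"
    using diff_chain_at[OF has_derivative_partial[OF f] F[unfolded has_field_derivative_def]]
    by (simp add: o_def)
  from partial_eq[OF this, of i] show ?thesis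
    by (simp add: axis_def if_distrib if_distribR cong: if_cong)
qed

lemma Ck_on_SucD: "Ck_on (Suc k) f S \<Longrightarrow> Ck_on k f S"
  by (induction k arbitrary: f) (auto intro: differentiable_imp_continuous_on)

lemma Ck_on_mono: "Ck_on k f S \<Longrightarrow> m \<le> k \<Longrightarrow> Ck_on m f S"
proof (induction k)
  case (Suc k)
  then show ?case using Ck_on_SucD[of k f S] by (cases "m = Suc k") (simp_all add: le_Suc_eq)
qed simp

lemma Ck_on_continuous: "Ck_on k f S \<Longrightarrow> continuous_on S f"
  using Ck_on_mono[of k f S 0] by simp

lemma C_on_enat: "C_on (enat k) f S \<longleftrightarrow> Ck_on k f S"
  by (auto simp: C_on_def intro: Ck_on_mono)

lemma C_on_numeral: "C_on (numeral k) f S \<longleftrightarrow> Ck_on (numeral k) f S"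
  using C_on_enat[of "numeral k"] by (simp add: numeral_eq_enat)

lemma C_on_infinity: "C_on \<infinity> f S \<longleftrightarrow> (\<forall>k. Ck_on k f S)"
  by (simp add: C_on_def)

lemma Ck_on_differentiable:
  "Ck_on (Suc k) f S \<Longrightarrow> open S \<Longrightarrow> y \<in> S \<Longrightarrow> f differentiable (at y)"
  by (auto simp: differentiable_on_def) (metis at_within_open)

lemma Ck_on_partial: "Ck_on (Suc k) f S \<Longrightarrow> Ck_on k (partial i f) S"
  by simp

lemma Ck_on_cong:
  assumes "open S" "\<And>x. x \<in> S \<Longrightarrow> f x = g x"
  shows "Ck_on k f S \<longleftrightarrow> Ck_on k g S"
  using assms(2)
proof (induction k arbitrary: f g)
  case 0
  then show ?case by (auto cong: continuous_on_cong)
next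
  case (Suc k)
  have "f differentiable_on S \<longleftrightarrow> g differentiable_on S"
    using Suc.prems unfolding differentiable_on_def
    by (metis differentiable_transform_within zero_less_one)
  moreover have "Ck_on k (partial i f) S \<longleftrightarrow> Ck_on k (partial i g) S" for i
    by (rule Suc.IH) (use partial_cong[OF assms(1)] Suc.prems in blast)
  ultimately show ?case by simp
qed

lemma Ck_on_subset: "Ck_on k f S \<Longrightarrow> T \<subseteq> S \<Longrightarrow> Ck_on k f T"
  by (induction k arbitrary: f)
     (auto intro: continuous_on_subset differentiable_on_subset)

text \<open>The induction step of the closure properties: outside \<open>S\<close> the function
  \<open>partial i f\<close> is uncontrolled, so it is compared only on \<open>S\<close> with a
  formula \<open>f' i\<close> to which the induction hypothesis applies.\<close>

lemma Ck_on_SucI: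
  assumes "open S" "\<And>y. y \<in> S \<Longrightarrow> f differentiable (at y)"
    and "\<And>i. Ck_on k (f' i) S" "\<And>y i. y \<in> S \<Longrightarrow> partial i f y = f' i y"
  shows "Ck_on (Suc k) f S"
proof -
  have "Ck_on k (partial i f) S" for i
    using Ck_on_cong[OF assms(1), of "partial i f" "f' i"] assms(3,4) by simp
  then show ?thesis
    using assms(2) by (auto simp: differentiable_on_def intro: differentiable_at_withinI)
qed

lemma Ck_on_const [simp]: "open S \<Longrightarrow> Ck_on k (\<lambda>x. c) S"
  by (induction k arbitrary: c) (auto intro: Ck_on_SucI[where f' = "\<lambda>i x. 0"] simp del: Ck_on.simps(2))

lemma Ck_on_add:
  assumes "open S" "Ck_on k f S" "Ck_on k g S"
  shows "Ck_on k (\<lambda>x. f x + g x) S"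
  using assms(2,3)
proof (induction k arbitrary: f g)
  case (Suc k)
  note d = Suc.prems[THEN Ck_on_differentiable[OF _ assms(1)]]
  show ?case
    by (rule Ck_on_SucI[OF assms(1), where f' = "\<lambda>i x. partial i f x + partial i g x"])
       (use Suc d in \<open>auto simp: partial_add\<close>)
qed (auto intro: continuous_intros)

lemma Ck_on_mult:
  assumes "open S" "Ck_on k f S" "Ck_on k g S"
  shows "Ck_on k (\<lambda>x. f x * g x) S"
  using assms(2,3)
proof (induction k arbitrary: f g)
  case (Suc k)
  note d = Suc.prems[THEN Ck_on_differentiable[OF _ assms(1)]]
  show ?case
  proof (rule Ck_on_SucI[OF assms(1), where f' = "\<lambda>i x. f x * partial i g x + partial i f x * g x"])
    fix i
    show "Ck_on k (\<lambda>x. f x * partial i g x + partial i f x * g x) S"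
      using Suc.prems
      by (intro Ck_on_add[OF assms(1)] Suc.IH) (simp_all add: Ck_on_SucD del: Ck_on.simps(2) add: Ck_on_partial)
  qed (use d in \<open>auto simp: partial_mult\<close>)
qed (auto intro: continuous_intros)

lemma Ck_on_minus:
  assumes "open S" "Ck_on k f S" shows "Ck_on k (\<lambda>x. - f x) S"
  using Ck_on_mult[OF assms(1) Ck_on_const[OF assms(1), of k "-1"] assms(2)] by simp

lemma Ck_on_diff:
  assumes "open S" "Ck_on k f S" "Ck_on k g S"
  shows "Ck_on k (\<lambda>x. f x - g x) S"
  using Ck_on_add[OF assms(1,2) Ck_on_minus[OF assms(1,3)]] by simp

lemma Ck_on_sum:
  assumes "open S" "\<And>i. i \<in> I \<Longrightarrow> Ck_on k (f i) S"
  shows "Ck_on k (\<lambda>x. \<Sum>i\<in>I. f i x) S"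
  using assms(2)
  by (induction I rule: infinite_finite_induct) (auto intro: Ck_on_add Ck_on_const assms(1))

lemma Ck_on_prod:
  assumes "open S" "\<And>i. i \<in> I \<Longrightarrow> Ck_on k (f i) S"
  shows "Ck_on k (\<lambda>x. \<Prod>i\<in>I. f i x) S"
  using assms(2)
  by (induction I rule: infinite_finite_induct) (auto intro: Ck_on_mult Ck_on_const assms(1))

lemma differentiable_compose_real:
  "f differentiable (at y) \<Longrightarrow> (F has_real_derivative d) (at (f y)) \<Longrightarrow>
     (\<lambda>x. F (f x)) differentiable (at y)"
  using differentiable_chain_at[of f y F]
  by (auto simp: o_def differentiable_def has_field_derivative_def)

text \<open>Differentiation lowers the exponent by one, so the induction has to range over all
  exponents.\<close>

lemma Ck_on_powr:
  assumes "open S" "\<And>x. x \<in> S \<Longrightarrow> 0 < f x" "Ck_on k f S"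
  shows "Ck_on k (\<lambda>x. f x powr a) S"
  using assms(3)
proof (induction k arbitrary: a)
  case 0
  then show ?case using assms(2) by (fastforce intro!: continuous_intros)
next
  case (Suc k)
  note d = Suc.prems[THEN Ck_on_differentiable[OF _ assms(1)]]
  have D: "((\<lambda>t. t powr a) has_real_derivative a * f y powr (a - 1)) (at (f y))" if "y \<in> S" for y
    using has_real_derivative_powr[of "f y" a] assms(2)[OF that] by simp
  show ?case
  proof (rule Ck_on_SucI[OF assms(1), where f' = "\<lambda>i x. a * f x powr (a - 1) * partial i f x"])
    show "Ck_on k (\<lambda>x. a * f x powr (a - 1) * partial i f x) S" for i
      using Suc.prems Ck_on_SucD[OF Suc.prems]
      by (intro Ck_on_mult[OF assms(1)] Ck_on_const assms(1) Suc.IH) auto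
    show "(\<lambda>x. f x powr a) differentiable at y" if "y \<in> S" for y
      using d[OF that] D[OF that] by (rule differentiable_compose_real)
    show "partial i (\<lambda>x. f x powr a) y = a * f y powr (a - 1) * partial i f y" if "y \<in> S" for y i
      by (rule partial_chain[OF d[OF that] D[OF that]])
  qed
qed

text \<open>Here \<open>f\<close> may have either sign. Writing the reciprocal as
  \<open>f * (f * f) powr (-1)\<close> moves the singular factor to the positive function
  \<open>f * f\<close>, where \<open>Ck_on_powr\<close> applies.\<close>

lemma Ck_on_inverse:
  assumes "open S" "\<And>x. x \<in> S \<Longrightarrow> f x \<noteq> 0" "Ck_on k f S"
  shows "Ck_on k (\<lambda>x. inverse (f x)) S"
proof -
  have "inverse (f x) = f x * (f x * f x) powr (-1)" if "x \<in> S" for x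
    using assms(2)[OF that] by (simp add: powr_minus field_simps power2_eq_square)
  moreover have "Ck_on k (\<lambda>x. f x * (f x * f x) powr (-1)) S"
    by (intro Ck_on_mult[OF assms(1)] Ck_on_powr assms)
       (use assms(2) in \<open>auto simp: zero_less_mult_iff linorder_neq_iff\<close>)
  ultimately show ?thesis
    by (subst Ck_on_cong[OF assms(1)])
qed

text \<open>One differentiation turns the logarithm into a reciprocal, whose class is already known;
  hence a case distinction instead of an induction.\<close>

lemma Ck_on_ln:
  assumes "open S" "\<And>x. x \<in> S \<Longrightarrow> 0 < f x" "Ck_on k f S"
  shows "Ck_on k (\<lambda>x. ln (f x)) S"
proof (cases k)
  case 0
  then show ?thesis using assms(2,3) by (fastforce intro!: continuous_intros)
next
  case (Suc m)
  note d = Ck_on_differentiable[OF assms(3)[unfolded Suc] assms(1)]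
  have D: "(ln has_real_derivative inverse (f y)) (at (f y))" if "y \<in> S" for y
    using assms(2)[OF that] by (auto intro!: derivative_eq_intros simp: field_simps)
  show ?thesis unfolding Suc
  proof (rule Ck_on_SucI[OF assms(1), where f' = "\<lambda>i x. inverse (f x) * partial i f x"])
    show "Ck_on m (\<lambda>x. inverse (f x) * partial i f x) S" for i
      using assms(2) Ck_on_mult[OF assms(1) Ck_on_inverse[OF assms(1) _ Ck_on_SucD] Ck_on_partial,
          OF _ assms(3)[unfolded Suc] assms(3)[unfolded Suc]] by force
    show "(\<lambda>x. ln (f x)) differentiable at y" if "y \<in> S" for y
      using d[OF that] D[OF that] by (rule differentiable_compose_real)
    show "partial i (\<lambda>x. ln (f x)) y = inverse (f y) * partial i f y" if "y \<in> S" for y i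
      by (rule partial_chain[OF d[OF that] D[OF that]])
  qed
qed

lemma Ck_on_exp:
  assumes "open S" "Ck_on k f S" shows "Ck_on k (\<lambda>x. exp (f x)) S"
  using assms(2)
proof (induction k)
  case 0
  then show ?case by (auto intro: continuous_intros)
next
  case (Suc k)
  note d = Ck_on_differentiable[OF Suc.prems assms(1)]
  show ?case
    by (rule Ck_on_SucI[OF assms(1), where f' = "\<lambda>i x. exp (f x) * partial i f x"])
       (use Suc d assms(1) in \<open>auto intro!: Ck_on_mult Ck_on_SucD[OF Suc.prems] Ck_on_partial partial_chain
          differentiable_compose_real[where F = exp] DERIV_exp\<close>)
qed

section \<open>Regularity of the inverse matrix\<close>

lemma matrix_inv_inverse:
  fixes M :: "real^'n^'n"
  assumes "det M \<noteq> 0"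
  shows "M ** matrix_inv M = mat 1" "matrix_inv M ** M = mat 1"
proof -
  have "\<exists>M'. M ** M' = mat 1 \<and> M' ** M = mat 1"
    using assms invertible_det_nz invertible_def by blast
  from someI_ex[OF this] show "M ** matrix_inv M = mat 1" "matrix_inv M ** M = mat 1"
    by (simp_all add: matrix_inv_def)
qed

text \<open>Cramer's rule for \<open>M *v x = axis j 1\<close>. Each entry of the inverse becomes a
  polynomial in the entries of \<open>M\<close> divided by the determinant, so its regularity is a
  matter of sums, products and one reciprocal.\<close>

lemma matrix_inv_cofactor:
  fixes M :: "real^'n^'n"
  assumes "det M \<noteq> 0"
  shows "matrix_inv M $ i $ j =
    det (\<chi> a b. if b = i then axis j 1 $ a else M $ a $ b) * inverse (det M)"
proof -
  have "M *v (matrix_inv M *v axis j 1) = axis j 1"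
    by (simp add: matrix_vector_mul_assoc matrix_inv_inverse[OF assms])
  then have "matrix_inv M *v axis j 1 =
      (\<chi> k. det (\<chi> a b. if b = k then axis j 1 $ a else M $ a $ b) / det M)"
    using cramer[OF assms] by simp
  moreover have "(matrix_inv M *v axis j 1) $ i = matrix_inv M $ i $ j"
    by (simp add: matrix_vector_mult_basis column_def)
  ultimately show ?thesis by (simp add: divide_inverse)
qed

lemma Ck_on_det:
  assumes "open S" "\<And>i j. Ck_on k (\<lambda>y. M y $ i $ j) S"
  shows "Ck_on k (\<lambda>y. det (M y)) S"
  unfolding det_def
  by (intro Ck_on_sum Ck_on_mult Ck_on_prod Ck_on_const assms)

lemma Ck_on_matrix_inv:
  assumes "open S" "\<And>i j. Ck_on k (\<lambda>y. M y $ i $ j) S" "\<And>y. y \<in> S \<Longrightarrow> det (M y) \<noteq> 0"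
  shows "Ck_on k (\<lambda>y. matrix_inv (M y) $ i $ j) S"
proof -
  have "Ck_on k (\<lambda>y. (\<chi> a b. if b = i then axis j 1 $ a else M y $ a $ b) $ a $ b) S" for a b
    using assms(1,2) by (cases "b = i") auto
  then have "Ck_on k (\<lambda>y. det (\<chi> a b. if b = i then axis j 1 $ a else M y $ a $ b) * inverse (det (M y))) S"
    by (intro Ck_on_mult Ck_on_det Ck_on_inverse assms)
  then show ?thesis
    by (subst Ck_on_cong[OF assms(1) matrix_inv_cofactor[OF assms(3)]])
qed

declare Ck_on.simps(2) [simp del]

lemma Ck_on_2_differentiable:
  assumes "Ck_on 2 f S" "open S" "y \<in> S"
  shows "f differentiable (at y)" "partial j f differentiable (at y)"
proof -
  show "f differentiable (at y)"
    by (rule Ck_on_differentiable[of 1 f S]) (use assms in \<open>simp_all add: numeral_2_eq_2\<close>)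
  show "partial j f differentiable (at y)"
    by (rule Ck_on_differentiable[of 0 _ S], rule Ck_on_partial) (use assms in \<open>simp_all add: numeral_2_eq_2\<close>)
qed

section \<open>Conformal change of the scalar curvature in coordinates\<close>

definition kron :: "'n \<Rightarrow> 'n \<Rightarrow> real" where
  "kron i j = (if i = j then 1 else 0)"

lemma sum_kron [simp]:
  fixes x :: "'n::finite \<Rightarrow> real"
  shows "(\<Sum>i\<in>UNIV. kron i k * x i) = x k" "(\<Sum>i\<in>UNIV. kron k i * x i) = x k"
    "(\<Sum>i\<in>UNIV. x i * kron i k) = x k" "(\<Sum>i\<in>UNIV. x i * kron k i) = x k"
  by (simp_all add: kron_def if_distrib if_distribR cong: if_cong)

lemma kron_refl [simp]: "kron i i = 1" by (simp add: kron_def)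

lemma sum_kron' [simp]:
  fixes x :: "'n::finite \<Rightarrow> real"
  shows "(\<Sum>i\<in>UNIV. kron i k * (x i * z)) = x k * z" "(\<Sum>i\<in>UNIV. kron i k * (z * x i)) = z * x k"
    "(\<Sum>i\<in>UNIV. kron k i * (x i * z)) = x k * z" "(\<Sum>i\<in>UNIV. kron k i * (z * x i)) = z * x k"
    "(\<Sum>i\<in>UNIV. kron i k * z) = z"  "(\<Sum>i\<in>UNIV. kron k i * z) = z"
  by (simp_all add: kron_def if_distrib if_distribR cong: if_cong)

text \<open>
  The algebra behind the transformation of the Ricci tensor at one point: \<open>a\<close> is the differential of
  the conformal exponent, \<open>b\<close> its gradient, \<open>H\<close> its second partial derivatives, \<open>d\<close> the partial
  derivatives of the gradient and \<open>dg\<close> those of the metric. The trace contracts \<open>H\<close> with a symmetric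
  tensor, so the equality of mixed partial derivatives is not needed.
\<close>

locale conformal_algebra =
  fixes g h :: "'n::finite \<Rightarrow> 'n \<Rightarrow> real" and C dg :: "'n \<Rightarrow> 'n \<Rightarrow> 'n \<Rightarrow> real"
    and a b :: "'n \<Rightarrow> real" and H d :: "'n \<Rightarrow> 'n \<Rightarrow> real"
  assumes g_sym: "g i j = g j i" and h_sym: "h i j = h j i"
    and hg: "(\<Sum>j\<in>UNIV. h i j * g j k) = kron i k"
    and C_sym: "C k i j = C k j i"
    and dg: "dg k i j = (\<Sum>m\<in>UNIV. C m k i * g m j) + (\<Sum>m\<in>UNIV. C m k j * g m i)"
    and a: "a i = (\<Sum>l\<in>UNIV. g i l * b l)"
    and H: "H i j = (\<Sum>l\<in>UNIV. dg i j l * b l) + (\<Sum>l\<in>UNIV. g j l * d i l)"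
begin

text \<open>Difference of the Christoffel symbols of the metric multiplied by
  \<open>exp (2 * f)\<close> and of the metric itself, with \<open>a\<close> the differential and
  \<open>b\<close> the gradient of \<open>f\<close>; unlike \<open>C\<close> it is a tensor.\<close>

definition A :: "'n \<Rightarrow> 'n \<Rightarrow> 'n \<Rightarrow> real" where
  "A k i j = kron k j * a i + kron k i * a j - g i j * b k"

text \<open>\<open>S\<close> is the trace of the Christoffel symbols, \<open>N\<close> the squared
  length of the gradient, \<open>H - E\<close> the covariant Hessian and \<open>lap\<close> its
  trace, the Laplacian. \<open>P\<close> is a contraction of \<open>C\<close> with the gradient;
  \<open>S\<close> and \<open>P\<close> are not tensors and have to cancel in the end.\<close>

definition S :: "'n \<Rightarrow> real" where "S m = (\<Sum>i\<in>UNIV. C i i m)"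
definition N :: real where "N = (\<Sum>m\<in>UNIV. a m * b m)"
definition E :: "'n \<Rightarrow> 'n \<Rightarrow> real" where "E j k = (\<Sum>m\<in>UNIV. a m * C m j k)"
definition P :: "'n \<Rightarrow> 'n \<Rightarrow> real" where "P j k = (\<Sum>i\<in>UNIV. \<Sum>m\<in>UNIV. g i k * C i j m * b m)"
definition lap :: real where "lap = (\<Sum>i\<in>UNIV. \<Sum>j\<in>UNIV. h i j * (H i j - E i j))"

lemma lower_b: "(\<Sum>l\<in>UNIV. b l * g i l) = a i" "(\<Sum>l\<in>UNIV. b l * g l i) = a i" "(\<Sum>l\<in>UNIV. g l i * b l) = a i"
  by (simp_all add: a mult.commute g_sym)

lemma g_h_contract: "(\<Sum>j\<in>UNIV. h i j * g k j) = kron i k" "(\<Sum>j\<in>UNIV. g j k * h i j) = kron i k"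
   "(\<Sum>j\<in>UNIV. g k j * h i j) = kron i k"
  using hg[of i k] by (simp_all add: g_sym mult.commute)

lemma raise_a: "(\<Sum>l\<in>UNIV. h i l * a l) = b i"
proof -
  have "(\<Sum>l\<in>UNIV. h i l * a l) = (\<Sum>l\<in>UNIV. \<Sum>m\<in>UNIV. (h i l * g l m) * b m)"
    by (simp add: a sum_distrib_left mult.assoc)
  also have "\<dots> = (\<Sum>m\<in>UNIV. (\<Sum>l\<in>UNIV. h i l * g l m) * b m)"
    by (subst sum.swap) (simp add: sum_distrib_right)
  finally show ?thesis by (simp add: hg)
qed

lemma A_trace: "(\<Sum>i\<in>UNIV. A i i m) = real CARD('n) * a m"
  by (simp add: A_def sum.distrib sum_subtractf lower_b)

lemma a_A: "(\<Sum>m\<in>UNIV. a m * A m j k) = 2 * a j * a k - g j k * N"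
proof -
  have "(\<Sum>m\<in>UNIV. a m * A m j k) =
      (\<Sum>m\<in>UNIV. kron m k * (a m * a j)) + (\<Sum>m\<in>UNIV. kron m j * (a m * a k)) - g j k * (\<Sum>m\<in>UNIV. a m * b m)"
    by (simp add: A_def sum.distrib sum_subtractf sum_distrib_left algebra_simps del: sum_kron')
  then show ?thesis by (simp add: N_def)
qed

lemma trace_C_A: "(\<Sum>i\<in>UNIV. \<Sum>m\<in>UNIV. C i i m * A m j k) = S k * a j + S j * a k - g j k * (\<Sum>m\<in>UNIV. S m * b m)"
proof -
  have "(\<Sum>i\<in>UNIV. \<Sum>m\<in>UNIV. C i i m * A m j k) = (\<Sum>m\<in>UNIV. S m * A m j k)"
    by (subst sum.swap) (simp add: S_def sum_distrib_right)
  also have "\<dots> = (\<Sum>m\<in>UNIV. kron m k * (S m * a j)) + (\<Sum>m\<in>UNIV. kron m j * (S m * a k)) - g j k * (\<Sum>m\<in>UNIV. S m * b m)"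
    by (simp add: A_def sum.distrib sum_subtractf sum_distrib_left algebra_simps del: sum_kron')
  finally show ?thesis by simp
qed

lemma trace_A_mult: "(\<Sum>i\<in>UNIV. \<Sum>m\<in>UNIV. A i i m * X m) = real CARD('n) * (\<Sum>m\<in>UNIV. a m * X m)"
  by (subst sum.swap) (simp add: A_trace sum_distrib_right[symmetric] sum_distrib_left mult.assoc)

text \<open>Stated for an arbitrary \<open>X\<close>, because a product of two perturbed Christoffel
  symbols contains \<open>A\<close> both against \<open>C\<close> and against itself.\<close>

lemma A_left:
  "(\<Sum>i\<in>UNIV. \<Sum>m\<in>UNIV. A i j m * X m i) =
   a j * (\<Sum>i\<in>UNIV. X i i) + (\<Sum>m\<in>UNIV. a m * X m j) - (\<Sum>i\<in>UNIV. \<Sum>m\<in>UNIV. g m j * X m i * b i)"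
proof -
  have "(\<Sum>m\<in>UNIV. A i j m * X m i) = a j * X i i + kron i j * (\<Sum>m\<in>UNIV. a m * X m i)
      - (\<Sum>m\<in>UNIV. g m j * X m i * b i)" for i
  proof -
    have "(\<Sum>m\<in>UNIV. A i j m * X m i) = (\<Sum>m\<in>UNIV. kron i m * (a j * X m i)) +
      kron i j * (\<Sum>m\<in>UNIV. a m * X m i) - (\<Sum>m\<in>UNIV. g m j * X m i * b i)"
      by (simp add: A_def sum.distrib sum_subtractf sum_distrib_left algebra_simps g_sym[of j] del: sum_kron')
    then show ?thesis by simp
  qed
  then show ?thesis
    by (simp add: sum.distrib sum_subtractf sum_distrib_left[symmetric])
qed

lemma A_right:
  "(\<Sum>i\<in>UNIV. \<Sum>m\<in>UNIV. X i m * A m i k) =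
   (\<Sum>i\<in>UNIV. a i * X i k) + a k * (\<Sum>i\<in>UNIV. X i i) - (\<Sum>i\<in>UNIV. \<Sum>m\<in>UNIV. g i k * X i m * b m)"
proof -
  have "(\<Sum>m\<in>UNIV. X i m * A m i k) = a i * X i k + a k * X i i - (\<Sum>m\<in>UNIV. g i k * X i m * b m)" for i
  proof -
    have "(\<Sum>m\<in>UNIV. X i m * A m i k) = (\<Sum>m\<in>UNIV. kron m k * (a i * X i m)) +
      (\<Sum>m\<in>UNIV. kron m i * (a k * X i m)) - (\<Sum>m\<in>UNIV. g i k * X i m * b m)"
      by (simp add: A_def sum.distrib sum_subtractf sum_distrib_left algebra_simps del: sum_kron')
    then show ?thesis by simp
  qed
  then show ?thesis
    by (simp add: sum.distrib sum_subtractf sum_distrib_left[symmetric])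
qed

lemma contract_C_A: "(\<Sum>i\<in>UNIV. \<Sum>m\<in>UNIV. C i j m * A m i k) = E j k + S j * a k - P j k"
  by (simp add: A_right E_def S_def P_def C_sym[of _ j] mult.commute[of "a k"])

lemma contract_A_C: "(\<Sum>i\<in>UNIV. \<Sum>m\<in>UNIV. A i j m * C m i k) = S k * a j + E j k - P k j"
proof -
  have "(\<Sum>i\<in>UNIV. \<Sum>m\<in>UNIV. g m j * C m i k * b i) = P k j"
    unfolding P_def by (subst sum.swap) (simp add: C_sym[of _ k])
  then show ?thesis by (simp add: A_left E_def S_def mult.commute[of "a j"])
qed

lemma contract_A_A: "(\<Sum>i\<in>UNIV. \<Sum>m\<in>UNIV. A i j m * A m i k) = (real CARD('n) + 2) * a j * a k - 2 * g j k * N"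
proof -
  have "(\<Sum>i\<in>UNIV. \<Sum>m\<in>UNIV. g m j * A m i k * b i) =
     (\<Sum>i\<in>UNIV. \<Sum>m\<in>UNIV. (b i * g m j) * A m i k)" by (simp add: mult_ac)
  also have "\<dots> = (\<Sum>i\<in>UNIV. a i * (b i * g k j)) + a k * (\<Sum>i\<in>UNIV. b i * g i j)
       - (\<Sum>i\<in>UNIV. \<Sum>m\<in>UNIV. (g i k * b i) * (g m j * b m))"
    using A_right[of "\<lambda>i m. b i * g m j" k] by (simp add: mult_ac)
  also have "(\<Sum>i\<in>UNIV. \<Sum>m\<in>UNIV. (g i k * b i) * (g m j * b m)) = a k * a j"
    by (simp add: sum_distrib_left[symmetric] sum_distrib_right[symmetric] lower_b)
  also have "(\<Sum>i\<in>UNIV. a i * (b i * g k j)) = g j k * N"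
    by (simp add: N_def sum_distrib_left mult_ac g_sym[of k])
  finally have "(\<Sum>i\<in>UNIV. \<Sum>m\<in>UNIV. g m j * A m i k * b i) = g j k * N"
    by (simp add: lower_b)
  then show ?thesis
    by (simp add: A_left A_trace a_A algebra_simps)
qed

lemma dg_b: "(\<Sum>i\<in>UNIV. dg i j k * b i) = P j k + P k j"
proof -
  have "(\<Sum>i\<in>UNIV. dg i j k * b i) = (\<Sum>i\<in>UNIV. \<Sum>m\<in>UNIV. g m k * C m j i * b i) +
     (\<Sum>i\<in>UNIV. \<Sum>m\<in>UNIV. g m j * C m k i * b i)"
    by (simp add: dg sum.distrib distrib_right distrib_left sum_distrib_left sum_distrib_right C_sym[of _ j] C_sym[of _ k] mult_ac)
  also have "(\<Sum>i\<in>UNIV. \<Sum>m\<in>UNIV. g m k * C m j i * b i) = P j k"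
    unfolding P_def by (rule sum.swap)
  also have "(\<Sum>i\<in>UNIV. \<Sum>m\<in>UNIV. g m j * C m k i * b i) = P k j"
    unfolding P_def by (rule sum.swap)
  finally show ?thesis .
qed

lemma sum_dg_d: "(\<Sum>i\<in>UNIV. dg j i k * b i + g i k * d j i) = H j k"
proof -
  have "dg j i k = dg j k i" for i by (simp add: dg)
  then show ?thesis by (simp add: H sum.distrib g_sym[of k])
qed

text \<open>The assumption \<open>H\<close> is the product rule for \<open>a = g b\<close>;
  inverting \<open>g\<close> isolates \<open>d\<close>, and metric compatibility turns the
  \<open>dg\<close> term into Christoffel symbols. The partial divergence misses the Laplacian by
  \<open>S\<close> contracted with \<open>b\<close>.\<close>

lemma div_b: "(\<Sum>i\<in>UNIV. d i i) = lap - (\<Sum>m\<in>UNIV. S m * b m)"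
proof -
  have "d i k = (\<Sum>j\<in>UNIV. h k j * (H i j - (\<Sum>l\<in>UNIV. dg i j l * b l)))" for i k
  proof -
    have "(\<Sum>j\<in>UNIV. h k j * (H i j - (\<Sum>l\<in>UNIV. dg i j l * b l))) = (\<Sum>j\<in>UNIV. \<Sum>l\<in>UNIV. h k j * g j l * d i l)"
      by (simp add: H sum_distrib_left mult_ac)
    also have "\<dots> = (\<Sum>l\<in>UNIV. (\<Sum>j\<in>UNIV. h k j * g j l) * d i l)"
      by (subst sum.swap) (simp add: sum_distrib_right)
    finally show ?thesis by (simp add: hg)
  qed
  then have "(\<Sum>i\<in>UNIV. d i i) = (\<Sum>i\<in>UNIV. \<Sum>j\<in>UNIV. h i j * (H i j - (\<Sum>l\<in>UNIV. dg i j l * b l)))"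
    by (rule sum.cong[OF refl])
  also have "\<dots> = (\<Sum>i\<in>UNIV. \<Sum>j\<in>UNIV. h i j * H i j) - (\<Sum>i\<in>UNIV. \<Sum>j\<in>UNIV. h i j * (\<Sum>l\<in>UNIV. dg i j l * b l))"
    by (simp add: right_diff_distrib sum_subtractf)
  also have "(\<Sum>i\<in>UNIV. \<Sum>j\<in>UNIV. h i j * (\<Sum>l\<in>UNIV. dg i j l * b l)) =
      (\<Sum>i\<in>UNIV. \<Sum>j\<in>UNIV. h i j * E i j) + (\<Sum>m\<in>UNIV. S m * b m)"
  proof -
    have "(\<Sum>l\<in>UNIV. dg i j l * b l) = E i j + (\<Sum>l\<in>UNIV. \<Sum>m\<in>UNIV. g m j * C m i l * b l)" for i j
    proof -
      have "(\<Sum>l\<in>UNIV. dg i j l * b l) = (\<Sum>l\<in>UNIV. \<Sum>m\<in>UNIV. C m i j * (g m l * b l)) +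
         (\<Sum>l\<in>UNIV. \<Sum>m\<in>UNIV. g m j * C m i l * b l)"
        by (simp add: dg sum.distrib distrib_right distrib_left sum_distrib_left sum_distrib_right mult_ac)
      also have "(\<Sum>l\<in>UNIV. \<Sum>m\<in>UNIV. C m i j * (g m l * b l)) = E i j"
        by (subst sum.swap) (simp add: E_def a sum_distrib_left sum_distrib_right mult_ac)
      finally show ?thesis .
    qed
    moreover have "(\<Sum>i\<in>UNIV. \<Sum>j\<in>UNIV. h i j * (\<Sum>l\<in>UNIV. \<Sum>m\<in>UNIV. g m j * C m i l * b l)) = (\<Sum>m\<in>UNIV. S m * b m)"
    proof -
      have "(\<Sum>j\<in>UNIV. h i j * (\<Sum>l\<in>UNIV. \<Sum>m\<in>UNIV. g m j * C m i l * b l)) = (\<Sum>l\<in>UNIV. C i i l * b l)" for i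
      proof -
        have "(\<Sum>j\<in>UNIV. h i j * (\<Sum>l\<in>UNIV. \<Sum>m\<in>UNIV. g m j * C m i l * b l)) =
          (\<Sum>j\<in>UNIV. \<Sum>l\<in>UNIV. \<Sum>m\<in>UNIV. (h i j * g m j) * (C m i l * b l))"
          by (simp add: sum_distrib_left mult_ac)
        also have "\<dots> = (\<Sum>l\<in>UNIV. \<Sum>j\<in>UNIV. \<Sum>m\<in>UNIV. (h i j * g m j) * (C m i l * b l))"
          by (rule sum.swap)
        also have "\<dots> = (\<Sum>l\<in>UNIV. \<Sum>m\<in>UNIV. \<Sum>j\<in>UNIV. (h i j * g m j) * (C m i l * b l))"
          by (rule sum.cong[OF refl sum.swap])
        also have "\<dots> = (\<Sum>l\<in>UNIV. \<Sum>m\<in>UNIV. kron i m * (C m i l * b l))"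
          by (simp add: sum_distrib_right[symmetric] g_h_contract del: sum_kron')
        finally show ?thesis by simp
      qed
      then show ?thesis
        by (simp add: S_def sum_distrib_right sum.swap[of "\<lambda>i m. C i i m * b m"])
    qed
    ultimately show ?thesis by (simp add: distrib_left sum.distrib)
  qed
  finally show ?thesis by (simp add: lap_def algebra_simps sum_subtractf)
qed

text \<open>Change of the Ricci tensor: curvature formed with \<open>C + A\<close> minus curvature
  formed with \<open>C\<close>, the derivatives of \<open>A\<close> being already expanded by the
  product rule.\<close>

definition Q :: "'n \<Rightarrow> 'n \<Rightarrow> real" where
  "Q j k = (\<Sum>i\<in>UNIV. (kron i k * H i j + kron i j * H i k - (dg i j k * b i + g j k * d i i))
      - (kron i k * H j i + kron i i * H j k - (dg j i k * b i + g i k * d j i))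
      + (\<Sum>m\<in>UNIV. (C i i m * A m j k + A i i m * C m j k + A i i m * A m j k)
          - (C i j m * A m i k + A i j m * C m i k + A i j m * A m i k)))"

text \<open>All \<open>S\<close> and \<open>P\<close> terms cancel, which leaves the classical
  formula in the covariant Hessian up to the antisymmetric remainder
  \<open>H k j - H j k\<close>.\<close>

lemma Q_eq:
  "Q j k = H k j - H j k - (real CARD('n) - 2) * (H j k - E j k - a j * a k)
     - g j k * (lap + (real CARD('n) - 2) * N)"
proof -
  have "Q j k = H k j + H j k - (P j k + P k j) - g j k * (lap - (\<Sum>m\<in>UNIV. S m * b m))
     - (H j k + real CARD('n) * H j k - H j k)
     + (S k * a j + S j * a k - g j k * (\<Sum>m\<in>UNIV. S m * b m)
        + real CARD('n) * E j k + real CARD('n) * (2 * a j * a k - g j k * N))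
     - ((E j k + S j * a k - P j k) + (S k * a j + E j k - P k j)
        + ((real CARD('n) + 2) * a j * a k - 2 * g j k * N))"
    unfolding Q_def
    by (simp only: sum.distrib sum_subtractf trace_C_A trace_A_mult contract_C_A contract_A_C contract_A_A a_A)
       (simp add: sum_distrib_left[symmetric] dg_b div_b E_def sum.distrib[symmetric] sum_dg_d)
  then show ?thesis by (simp add: algebra_simps)
qed

lemma trace_Q:
  "(\<Sum>j\<in>UNIV. \<Sum>k\<in>UNIV. h j k * Q j k) =
     - 2 * (real CARD('n) - 1) * lap - (real CARD('n) - 1) * (real CARD('n) - 2) * N"
proof -
  have 1: "(\<Sum>j\<in>UNIV. \<Sum>k\<in>UNIV. h j k * H k j) = (\<Sum>j\<in>UNIV. \<Sum>k\<in>UNIV. h j k * H j k)"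
    by (subst sum.swap) (simp add: h_sym)
  have 2: "(\<Sum>j\<in>UNIV. \<Sum>k\<in>UNIV. h j k * (a j * a k)) = N"
  proof -
    have "(\<Sum>j\<in>UNIV. \<Sum>k\<in>UNIV. h j k * (a j * a k)) = (\<Sum>j\<in>UNIV. a j * (\<Sum>k\<in>UNIV. h j k * a k))"
      by (simp add: sum_distrib_left mult_ac)
    then show ?thesis by (simp add: raise_a N_def)
  qed
  have 3: "(\<Sum>j\<in>UNIV. \<Sum>k\<in>UNIV. h j k * g j k) = real CARD('n)"
    by (simp add: g_h_contract)
  define K where "K = lap + (real CARD('n) - 2) * N"
  have "h j k * Q j k = h j k * H k j - h j k * H j k
      - (real CARD('n) - 2) * (h j k * (H j k - E j k) - h j k * (a j * a k)) - (h j k * g j k) * K" for j k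
    by (simp add: Q_eq K_def algebra_simps)
  then have "(\<Sum>j\<in>UNIV. \<Sum>k\<in>UNIV. h j k * Q j k) = (\<Sum>j\<in>UNIV. \<Sum>k\<in>UNIV. h j k * H k j)
     - (\<Sum>j\<in>UNIV. \<Sum>k\<in>UNIV. h j k * H j k) - (real CARD('n) - 2) * (lap - (\<Sum>j\<in>UNIV. \<Sum>k\<in>UNIV. h j k * (a j * a k)))
     - (\<Sum>j\<in>UNIV. \<Sum>k\<in>UNIV. h j k * g j k) * K"
    by (simp only: sum_subtractf sum_distrib_left[symmetric] sum_distrib_right[symmetric] lap_def)
  then show ?thesis unfolding 1 2 3 by (simp add: K_def algebra_simps)
qed

end


section \<open>Christoffel symbols of a metric in coordinates\<close>

locale coordinate_metric =
  fixes U :: "(real^'n::finite) set" and G :: "real^'n \<Rightarrow> real^'n^'n"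
  assumes open_U: "open U"
    and G_C2: "Ck_on 2 (\<lambda>y. G y $ i $ j) U"
    and G_sym: "y \<in> U \<Longrightarrow> transpose (G y) = G y"
    and G_det: "y \<in> U \<Longrightarrow> det (G y) \<noteq> 0"
begin

lemma G_component_sym: "y \<in> U \<Longrightarrow> G y $ i $ j = G y $ j $ i"
  using G_sym[of y] by (metis transpose_def vec_lambda_beta)

lemma inv_C2: "Ck_on 2 (\<lambda>y. matrix_inv (G y) $ i $ j) U"
  by (rule Ck_on_matrix_inv[OF open_U G_C2 G_det])

lemma inv_left: "y \<in> U \<Longrightarrow> (\<Sum>j\<in>UNIV. matrix_inv (G y) $ i $ j * G y $ j $ k) = kron i k"
  using matrix_inv_inverse(2)[OF G_det, of y]
  by (simp add: matrix_matrix_mult_def mat_def vec_eq_iff kron_def)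

lemma inv_right: "y \<in> U \<Longrightarrow> (\<Sum>j\<in>UNIV. G y $ i $ j * matrix_inv (G y) $ j $ k) = kron i k"
  using matrix_inv_inverse(1)[OF G_det, of y]
  by (simp add: matrix_matrix_mult_def mat_def vec_eq_iff kron_def)

lemma inv_sym:
  assumes "y \<in> U" shows "matrix_inv (G y) $ i $ j = matrix_inv (G y) $ j $ i"
proof -
  let ?h = "matrix_inv (G y)"
  have tr: "?h = transpose ?h"
  proof -
    have "transpose ?h ** G y = mat 1"
      using matrix_inv_inverse(1)[OF G_det[OF assms]] G_sym[OF assms]
      by (metis matrix_transpose_mul transpose_mat)
    then have "transpose ?h ** (G y ** ?h) = ?h"
      by (simp add: matrix_mul_assoc)
    then show ?thesis by (simp add: matrix_inv_inverse(1)[OF G_det[OF assms]])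
  qed
  show ?thesis by (subst (1) tr) (simp add: transpose_def)
qed

lemma C2_diff: "Ck_on 2 f U \<Longrightarrow> y \<in> U \<Longrightarrow> f differentiable (at y)"
  using Ck_on_differentiable[of 1 f U y] open_U by (simp add: numeral_2_eq_2)

lemma C2_partial: "Ck_on 2 f U \<Longrightarrow> Ck_on 1 (partial i f) U"
  by (simp add: numeral_2_eq_2 Ck_on.simps(2))

lemma C1_diff: "Ck_on 1 f U \<Longrightarrow> y \<in> U \<Longrightarrow> f differentiable (at y)"
  using Ck_on_differentiable[of 0 f U y] open_U by simp

lemma C2_C1: "Ck_on 2 f U \<Longrightarrow> Ck_on 1 f U"
  by (rule Ck_on_mono) auto

lemma christoffel_C1: "Ck_on 1 (christoffel G k i j) U"
proof -
  have "christoffel G k i j = (\<lambda>y. (\<Sum>l\<in>UNIV. matrix_inv (G y) $ k $ l *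
        (partial i (\<lambda>z. G z $ j $ l) y + partial j (\<lambda>z. G z $ i $ l) y
          - partial l (\<lambda>z. G z $ i $ j) y)) * (1/2))"
    by (simp add: christoffel_def fun_eq_iff)
  then show ?thesis
    by (simp only:) (intro Ck_on_mult Ck_on_sum Ck_on_add Ck_on_diff open_U Ck_on_const
        C2_C1[OF inv_C2] C2_partial G_C2)
qed

lemma partial_sym: "y \<in> U \<Longrightarrow> partial k (\<lambda>z. G z $ i $ j) y = partial k (\<lambda>z. G z $ j $ i) y"
  by (rule partial_cong[OF open_U]) (auto simp: G_component_sym)

lemma christoffel_sym: "y \<in> U \<Longrightarrow> christoffel G k i j y = christoffel G k j i y"
  unfolding christoffel_def partial_sym[of y _ j i] by (simp add: add.commute)

lemma christoffel_lower:
  assumes "y \<in> U"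
  shows "(\<Sum>m\<in>UNIV. christoffel G m k i y * G y $ m $ j) =
    (partial k (\<lambda>z. G z $ i $ j) y + partial i (\<lambda>z. G z $ k $ j) y - partial j (\<lambda>z. G z $ k $ i) y) / 2"
proof -
  let ?X = "\<lambda>l. partial k (\<lambda>z. G z $ i $ l) y + partial i (\<lambda>z. G z $ k $ l) y - partial l (\<lambda>z. G z $ k $ i) y"
  have "(\<Sum>m\<in>UNIV. christoffel G m k i y * G y $ m $ j)
    = (\<Sum>m\<in>UNIV. \<Sum>l\<in>UNIV. (G y $ j $ m * matrix_inv (G y) $ m $ l) * ?X l) / 2"
    by (simp add: christoffel_def sum_divide_distrib sum_distrib_left sum_distrib_right G_component_sym[OF assms, of _ j] mult_ac)
  also have "\<dots> = (\<Sum>l\<in>UNIV. (\<Sum>m\<in>UNIV. G y $ j $ m * matrix_inv (G y) $ m $ l) * ?X l) / 2"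
    by (subst sum.swap) (simp only: sum_distrib_right)
  finally show ?thesis by (simp add: inv_right[OF assms])
qed

text \<open>The metric is covariantly constant: the two lowered symbols share one derivative, and
  their remaining derivatives occur with opposite signs.\<close>

lemma metric_compatible:
  assumes "y \<in> U"
  shows "partial k (\<lambda>z. G z $ i $ j) y =
    (\<Sum>m\<in>UNIV. christoffel G m k i y * G y $ m $ j) + (\<Sum>m\<in>UNIV. christoffel G m k j y * G y $ m $ i)"
  unfolding christoffel_lower[OF assms] partial_sym[OF assms, of _ j i] by (simp add: field_simps)

end

section \<open>Conformal change of Christoffel symbols and curvature\<close>

lemma matrix_inv_scaleR:
  fixes M :: "real^'n^'n"
  assumes "det M \<noteq> 0" "c \<noteq> 0"
  shows "matrix_inv (c *\<^sub>R M) = inverse c *\<^sub>R matrix_inv M"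
proof -
  have det: "det (c *\<^sub>R M) \<noteq> 0"
    using assms invertible_det_nz scalar_invertible by blast
  have "(inverse c *\<^sub>R matrix_inv M) ** (c *\<^sub>R M) = mat 1"
    using assms by (simp add: matrix_scalar_ac matrix_inv_inverse scalar_matrix_assoc[symmetric])
  then have "(inverse c *\<^sub>R matrix_inv M) ** ((c *\<^sub>R M) ** matrix_inv (c *\<^sub>R M)) = matrix_inv (c *\<^sub>R M)"
    by (simp add: matrix_mul_assoc)
  then show ?thesis by (simp add: matrix_inv_inverse[OF det])
qed

locale conformal_coordinates = coordinate_metric U G
  for U :: "(real^'n::finite) set" and G +
  fixes f :: "real^'n \<Rightarrow> real"
  assumes f_C2: "Ck_on 2 f U"
begin

definition grad :: "'n \<Rightarrow> real^'n \<Rightarrow> real" where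
  "grad k y = (\<Sum>l\<in>UNIV. matrix_inv (G y) $ k $ l * partial l f y)"

text \<open>Its value at a point is the tensor \<open>A\<close> of \<open>conformal_algebra\<close>;
  it is kept as a function of the point because curvature differentiates the Christoffel symbols
  once more.\<close>

definition shift :: "'n \<Rightarrow> 'n \<Rightarrow> 'n \<Rightarrow> real^'n \<Rightarrow> real" where
  "shift k i j y = kron k j * partial i f y + kron k i * partial j f y - G y $ i $ j * grad k y"

abbreviation Gt :: "real^'n \<Rightarrow> real^'n^'n" where
  "Gt \<equiv> \<lambda>y. exp (2 * f y) *\<^sub>R G y"

lemma grad_C1: "Ck_on 1 (grad k) U"
  unfolding grad_def[abs_def]
  by (intro Ck_on_sum Ck_on_mult open_U C2_C1[OF inv_C2] C2_partial f_C2)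

lemma grad_lower: "y \<in> U \<Longrightarrow> partial i f y = (\<Sum>l\<in>UNIV. G y $ i $ l * grad l y)"
proof -
  assume y: "y \<in> U"
  have "(\<Sum>l\<in>UNIV. G y $ i $ l * grad l y) =
    (\<Sum>l\<in>UNIV. \<Sum>m\<in>UNIV. (G y $ i $ l * matrix_inv (G y) $ l $ m) * partial m f y)"
    by (simp add: grad_def sum_distrib_left mult_ac)
  also have "\<dots> = (\<Sum>m\<in>UNIV. (\<Sum>l\<in>UNIV. G y $ i $ l * matrix_inv (G y) $ l $ m) * partial m f y)"
    by (subst sum.swap) (simp only: sum_distrib_right)
  finally show ?thesis by (simp add: inv_right[OF y])
qed

lemma partial_Gt:
  assumes "y \<in> U"
  shows "partial k (\<lambda>z. Gt z $ i $ j) y = exp (2 * f y) * (partial k (\<lambda>z. G z $ i $ j) y + 2 * partial k f y * G y $ i $ j)"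
proof -
  note d = C2_diff[OF f_C2 assms]
  have D: "((\<lambda>t. exp (2 * t)) has_real_derivative 2 * exp (2 * f y)) (at (f y))"
    by (auto intro!: derivative_eq_intros)
  show ?thesis
    using partial_mult[OF differentiable_compose_real[OF d D] C2_diff[OF G_C2 assms], of k i j]
      partial_chain[OF d D, of k] by (simp add: algebra_simps)
qed

text \<open>The factor \<open>exp (2 * f)\<close> cancels against the one of the inverse metric, so
  only the derivatives of the exponent are left.\<close>

lemma christoffel_Gt:
  assumes "y \<in> U"
  shows "christoffel Gt k i j y = christoffel G k i j y + shift k i j y"
proof -
  let ?h = "matrix_inv (G y)"
  have "christoffel Gt k i j y = (\<Sum>l\<in>UNIV. ?h $ k $ l *
      ((partial i (\<lambda>z. G z $ j $ l) y + partial j (\<lambda>z. G z $ i $ l) y - partial l (\<lambda>z. G z $ i $ j) y)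
        + 2 * (partial i f y * G y $ j $ l + partial j f y * G y $ i $ l - G y $ i $ j * partial l f y))) / 2"
    unfolding christoffel_def partial_Gt[OF assms] matrix_inv_scaleR[OF G_det[OF assms] exp_not_eq_zero]
    by (intro arg_cong[of _ _ "\<lambda>x. x / 2"] sum.cong[OF refl]) (simp add: field_simps)
  also have "\<dots> = christoffel G k i j y + (\<Sum>l\<in>UNIV. ?h $ k $ l *
      (partial i f y * G y $ j $ l + partial j f y * G y $ i $ l - G y $ i $ j * partial l f y))"
  proof -
    have "(\<Sum>l\<in>UNIV. p l * (x l + 2 * q l)) / 2 = (\<Sum>l\<in>UNIV. p l * x l) / 2 + (\<Sum>l\<in>UNIV. p l * q l)"
      for p x q :: "'n \<Rightarrow> real"
      by (simp add: distrib_left sum.distrib add_divide_distrib sum_divide_distrib)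
    then show ?thesis unfolding christoffel_def .
  qed
  also have "(\<Sum>l\<in>UNIV. ?h $ k $ l *
      (partial i f y * G y $ j $ l + partial j f y * G y $ i $ l - G y $ i $ j * partial l f y)) =
      partial i f y * (\<Sum>l\<in>UNIV. ?h $ k $ l * G y $ l $ j) + partial j f y * (\<Sum>l\<in>UNIV. ?h $ k $ l * G y $ l $ i)
      - G y $ i $ j * grad k y"
    unfolding grad_def sum_distrib_left sum.distrib[symmetric] sum_subtractf[symmetric]
  proof (rule sum.cong[OF refl])
    fix l
    have "G y $ j $ l = G y $ l $ j" "G y $ i $ l = G y $ l $ i"
      by (rule G_component_sym[OF assms])+
    then show "?h $ k $ l * (partial i f y * G y $ j $ l + partial j f y * G y $ i $ l - G y $ i $ j * partial l f y) =
      partial i f y * (?h $ k $ l * G y $ l $ j) + partial j f y * (?h $ k $ l * G y $ l $ i)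
      - G y $ i $ j * (?h $ k $ l * partial l f y)"
      by (simp add: algebra_simps)
  qed
  finally show ?thesis
    by (simp add: shift_def inv_left[OF assms])
qed

lemma partial_shift:
  assumes "y \<in> U"
  shows "partial i (shift l j k) y = kron l k * partial i (partial j f) y + kron l j * partial i (partial k f) y
     - (partial i (\<lambda>z. G z $ j $ k) y * grad l y + G y $ j $ k * partial i (grad l) y)"
proof -
  note d = C1_diff[OF C2_partial[OF f_C2] assms]  C2_diff[OF G_C2 assms] C1_diff[OF grad_C1 assms]
  show ?thesis
    unfolding shift_def[abs_def]
    by (simp add: partial_add partial_diff partial_mult partial_cmult d
        differentiable_add differentiable_mult differentiable_const)
qed

lemma conformal_algebra_at:
  assumes y: "y \<in> U"
  shows "conformal_algebra (\<lambda>i j. G y $ i $ j) (\<lambda>i j. matrix_inv (G y) $ i $ j)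
   (\<lambda>k i j. christoffel G k i j y) (\<lambda>k i j. partial k (\<lambda>z. G z $ i $ j) y)
   (\<lambda>i. partial i f y) (\<lambda>i. grad i y) (\<lambda>i j. partial i (partial j f) y) (\<lambda>i j. partial i (grad j) y)"
proof
  show "G y $ i $ j = G y $ j $ i" for i j by (rule G_component_sym[OF y])
  show "matrix_inv (G y) $ i $ j = matrix_inv (G y) $ j $ i" for i j by (rule inv_sym[OF y])
  show "(\<Sum>j\<in>UNIV. matrix_inv (G y) $ i $ j * G y $ j $ k) = kron i k" for i k by (rule inv_left[OF y])
  show "christoffel G k i j y = christoffel G k j i y" for i j k by (rule christoffel_sym[OF y])
  show "partial k (\<lambda>z. G z $ i $ j) y =
    (\<Sum>m\<in>UNIV. christoffel G m k i y * G y $ m $ j) + (\<Sum>m\<in>UNIV. christoffel G m k j y * G y $ m $ i)" for i j k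
    by (rule metric_compatible[OF y])
  show "partial i f y = (\<Sum>l\<in>UNIV. G y $ i $ l * grad l y)" for i by (rule grad_lower[OF y])
  show "partial i (partial j f) y =
     (\<Sum>l\<in>UNIV. partial i (\<lambda>z. G z $ j $ l) y * grad l y) + (\<Sum>l\<in>UNIV. G y $ j $ l * partial i (grad l) y)" for i j
  proof -
    note d = C2_diff[OF G_C2 y] C1_diff[OF grad_C1 y]
    \<comment> \<open>Differentiating the lowered relation \<open>grad_lower\<close>, rather than
      the definition of \<open>grad\<close>, keeps derivatives of the inverse metric out of the
      algebra.\<close>
    have "partial i (partial j f) y = partial i (\<lambda>y. \<Sum>l\<in>UNIV. G y $ j $ l * grad l y) y"
      by (rule partial_cong[OF open_U y]) (rule grad_lower)
    then show ?thesis
      by (simp add: partial_sum partial_mult d differentiable_mult sum.distrib add.commute)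
  qed
qed

text \<open>The outer factor is that of the inverse metric; the terms in \<open>f\<close> are the
  trace of the Ricci difference \<open>Q\<close>.\<close>

lemma scalar_Gt:
  assumes "y \<in> U"
  shows "metric_trace Gt (ricci Gt) y = exp (- 2 * f y) * (metric_trace G (ricci G) y
     - 2 * (real CARD('n) - 1) * metric_trace G (hessian G f) y
     - (real CARD('n) - 1) * (real CARD('n) - 2) * (\<Sum>m\<in>UNIV. partial m f y * grad m y))"
proof -
  interpret alg: conformal_algebra "\<lambda>i j. G y $ i $ j" "\<lambda>i j. matrix_inv (G y) $ i $ j"
   "\<lambda>k i j. christoffel G k i j y" "\<lambda>k i j. partial k (\<lambda>z. G z $ i $ j) y"
   "\<lambda>i. partial i f y" "\<lambda>i. grad i y" "\<lambda>i j. partial i (partial j f) y" "\<lambda>i j. partial i (grad j) y"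
   by (rule conformal_algebra_at[OF assms])
  have 1: "partial i (christoffel Gt l j k) y = partial i (christoffel G l j k) y + partial i (shift l j k) y" for i l j k
  proof -
    have "Ck_on 1 (shift l j k) U"
      unfolding shift_def[abs_def]
      by (intro Ck_on_diff Ck_on_add Ck_on_mult open_U C2_partial f_C2 Ck_on_const grad_C1 C2_C1[OF G_C2])
    then show ?thesis
      by (subst partial_add[symmetric])
         (auto intro!: partial_cong[OF open_U assms] christoffel_Gt C1_diff[OF _ assms] christoffel_C1)
  qed
  have 2: "shift k i j y = alg.A k i j" for i j k
    by (simp add: alg.A_def shift_def)
  define C where "C = (\<lambda>k i j. christoffel G k i j y)"
  have ricci: "ricci Gt j k y = ricci G j k y + alg.Q j k" for j k
  proof -
    have "riemann Gt i i j k y = riemann G i i j k y +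
        ((partial i (shift i j k) y - partial j (shift i i k) y)
         + (\<Sum>m\<in>UNIV. (C i i m * alg.A m j k + alg.A i i m * C m j k + alg.A i i m * alg.A m j k)
          - (C i j m * alg.A m i k + alg.A i j m * C m i k + alg.A i j m * alg.A m i k)))" for i
    proof -
      have "(\<Sum>m\<in>UNIV. (C i i m + alg.A i i m) * (C m j k + alg.A m j k)
          - (C i j m + alg.A i j m) * (C m i k + alg.A m i k)) =
        (\<Sum>m\<in>UNIV. C i i m * C m j k - C i j m * C m i k) +
        (\<Sum>m\<in>UNIV. (C i i m * alg.A m j k + alg.A i i m * C m j k + alg.A i i m * alg.A m j k)
          - (C i j m * alg.A m i k + alg.A i j m * C m i k + alg.A i j m * alg.A m i k))"
        unfolding sum.distrib[symmetric] by (rule sum.cong[OF refl]) (simp add: algebra_simps)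
      then show ?thesis
        unfolding riemann_def 1 christoffel_Gt[OF assms] 2 by (simp add: C_def)
    qed
    then show ?thesis
      unfolding ricci_def alg.Q_def partial_shift[OF assms] by (simp add: sum.distrib C_def)
  qed
  have "alg.lap = metric_trace G (hessian G f) y"
    by (simp add: alg.lap_def alg.E_def metric_trace_def hessian_def mult.commute)
  moreover have "metric_trace Gt (ricci Gt) y = exp (- 2 * f y) * (metric_trace G (ricci G) y +
     (\<Sum>j\<in>UNIV. \<Sum>k\<in>UNIV. matrix_inv (G y) $ j $ k * alg.Q j k))"
    unfolding metric_trace_def ricci matrix_inv_scaleR[OF G_det[OF assms] exp_not_eq_zero]
    by (simp add: sum_distrib_left sum.distrib distrib_left exp_minus mult.assoc)
  ultimately show ?thesis
    by (simp add: alg.trace_Q alg.N_def algebra_simps)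
qed

end


text \<open>Positivity of \<open>W\<close> on the whole space allows \<open>Gt\<close> to be
  rewritten with \<open>exp (2 * f)\<close> as an equality of functions;
  \<open>w \<circ> chart_inv c\<close> has it because \<open>w\<close> is positive
  everywhere.\<close>

lemma (in coordinate_metric) scalar_curvature_conformal:
  fixes W :: "real^'n \<Rightarrow> real"
  assumes W: "Ck_on 2 W U" "\<And>y. 0 < W y" and n: "CARD('n) \<ge> 3" and y: "y \<in> U"
  defines "n \<equiv> real CARD('n)"
  defines "Gt \<equiv> \<lambda>y. (W y powr (4 / (n - 2))) *\<^sub>R G y"
  shows "metric_trace Gt (ricci Gt) y = W y powr (- 4 / (n - 2)) *
    (metric_trace G (ricci G) y - 4 * (n - 1) / (n - 2) * metric_trace G (hessian G W) y / W y)"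
proof -
  \<comment> \<open>Half of 4/(n-2), so that \<open>exp (2 * f)\<close> is the given power of
    \<open>W\<close>.\<close>
  define c where "c = 2 / (n - 2)"
  define f where "f = (\<lambda>y. c * ln (W y))"
  have n2: "n - 2 > 0" using n by (simp add: n_def)
  interpret conformal_coordinates U G f
    by unfold_locales (auto simp: f_def intro!: Ck_on_mult Ck_on_const open_U Ck_on_ln W)
  have exp_f: "exp (2 * f z) = W z powr (4 / (n - 2))" "exp (- 2 * f z) = W z powr (- 4 / (n - 2))" for z
    using W(2)[of z] by (simp_all add: powr_def f_def c_def)
  have Gt: "Gt = (\<lambda>y. exp (2 * f y) *\<^sub>R G y)"
    by (simp add: Gt_def exp_f)
  have df: "partial i f z = c * (inverse (W z) * partial i W z)" if "z \<in> U" for z i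
  proof -
    have D: "((\<lambda>t. c * ln t) has_real_derivative c * inverse (W z)) (at (W z))"
      using W(2)[of z] by (auto intro!: derivative_eq_intros simp: field_simps)
    show ?thesis unfolding f_def using partial_chain[OF C2_diff[OF W(1) that] D] by simp
  qed
  have ddf: "partial i (partial j f) y =
      c * (inverse (W y) * partial i (partial j W) y - inverse (W y) * inverse (W y) * (partial i W y * partial j W y))" for i j
  proof -
    have D: "(inverse has_real_derivative - (inverse (W y) * inverse (W y))) (at (W y))"
      using W(2)[of y] DERIV_inverse[of "W y"] by (simp add: power2_eq_square)
    note d = C2_diff[OF W(1) y] C1_diff[OF C2_partial[OF W(1)] y]
    have "partial i (partial j f) y = partial i (\<lambda>z. c * (inverse (W z) * partial j W z)) y"
      by (rule partial_cong[OF open_U y df])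
    also have "\<dots> = c * partial i (\<lambda>z. inverse (W z) * partial j W z) y"
      by (rule partial_cmult[OF differentiable_mult[OF differentiable_compose_real[OF d(1) D] d(2)]])
    finally show ?thesis
      using partial_mult[OF differentiable_compose_real[OF d(1) D] d(2), of i]
      by (simp add: partial_chain[OF d(1) D] algebra_simps)
  qed
  define Z where "Z = (\<Sum>i\<in>UNIV. \<Sum>j\<in>UNIV. matrix_inv (G y) $ i $ j * (partial i W y * partial j W y))"
  have gradN: "(\<Sum>m\<in>UNIV. partial m f y * grad m y) = c\<^sup>2 * inverse (W y) * inverse (W y) * Z"
    by (simp add: grad_def df[OF y] Z_def sum_distrib_left power2_eq_square mult_ac)
  have hessT: "metric_trace G (hessian G f) y =
     c * (metric_trace G (hessian G W) y * inverse (W y)) - c * (inverse (W y) * inverse (W y) * Z)"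
  proof -
    have hf: "hessian G f i j y = c * inverse (W y) * hessian G W i j y
        - c * inverse (W y) * inverse (W y) * (partial i W y * partial j W y)" for i j
      by (simp add: hessian_def df[OF y] ddf algebra_simps sum_distrib_left sum_subtractf)
    have "metric_trace G (hessian G f) y = (\<Sum>i\<in>UNIV. \<Sum>j\<in>UNIV.
        (c * inverse (W y)) * (matrix_inv (G y) $ i $ j * hessian G W i j y) -
        (c * inverse (W y) * inverse (W y)) * (matrix_inv (G y) $ i $ j * (partial i W y * partial j W y)))"
      unfolding metric_trace_def hf by (simp add: right_diff_distrib mult_ac)
    also have "\<dots> = (c * inverse (W y)) * metric_trace G (hessian G W) y - (c * inverse (W y) * inverse (W y)) * Z"
      by (simp only: sum_subtractf sum_distrib_left[symmetric] metric_trace_def Z_def)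
    finally show ?thesis by (simp add: mult_ac)
  qed
  \<comment> \<open>As \<open>(n - 2) * c = 2\<close>, the squared gradient coming from the Ricci
    trace equals the one produced by differentiating the logarithm twice, and the two cancel: this
    singles out the exponent 4/(n-2).\<close>
  have prodE: "(n - 1) * (n - 2) * (c\<^sup>2 * inverse (W y) * inverse (W y) * Z) =
      2 * (n - 1) * (c * (inverse (W y) * inverse (W y) * Z))"
  proof -
    have "(n - 2) * c = 2" using n2 by (simp add: c_def field_simps)
    then have "(n - 2) * c\<^sup>2 = 2 * c" by (simp add: power2_eq_square mult.assoc[symmetric])
    then have "(n - 1) * ((n - 2) * c\<^sup>2) * (inverse (W y) * inverse (W y) * Z) =
       (n - 1) * (2 * c) * (inverse (W y) * inverse (W y) * Z)" by simp
    then show ?thesis by (simp only: mult_ac)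
  qed
  have "metric_trace Gt (ricci Gt) y = W y powr (- 4 / (n - 2)) *
     (metric_trace G (ricci G) y - 2 * (n - 1) * (c * (metric_trace G (hessian G W) y * inverse (W y))))"
    unfolding Gt scalar_Gt[OF y] unfolding exp_f n_def[symmetric] gradN hessT prodE by (simp add: right_diff_distrib)
  then show ?thesis by (simp add: c_def divide_inverse mult_ac)
qed

section \<open>The strong maximum principle\<close>

definition quad :: "('n::finite \<Rightarrow> 'n \<Rightarrow> real) \<Rightarrow> ('n \<Rightarrow> real) \<Rightarrow> real" where
  "quad a v = (\<Sum>i\<in>UNIV. \<Sum>j\<in>UNIV. a i j * (v i * v j))"

text \<open>The form along a coordinate line is a quadratic polynomial in \<open>t\<close>, from
  which both the vanishing of a row and the completion of the square are read off.\<close>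

lemma quad_add_kron:
  assumes "\<And>i j. a i j = a j i"
  shows "quad a (\<lambda>i. v i + t * kron i k) = quad a v + 2 * t * (\<Sum>i\<in>UNIV. a k i * v i) + t\<^sup>2 * a k k"
proof -
  have "(\<Sum>j\<in>UNIV. a i j * ((v i + t * kron i k) * (v j + t * kron j k))) =
     (\<Sum>j\<in>UNIV. a i j * (v i * v j)) + t * (v i * a i k) + kron i k * (t * (\<Sum>j\<in>UNIV. a i j * v j) + t\<^sup>2 * a i k)" for i
  proof -
    have "(\<Sum>j\<in>UNIV. a i j * ((v i + t * kron i k) * (v j + t * kron j k))) =
      (\<Sum>j\<in>UNIV. a i j * (v i * v j)) + t * v i * (\<Sum>j\<in>UNIV. kron j k * a i j)
      + kron i k * t * (\<Sum>j\<in>UNIV. a i j * v j) + t\<^sup>2 * kron i k * (\<Sum>j\<in>UNIV. kron j k * a i j)"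
      unfolding sum_distrib_left sum.distrib[symmetric]
      by (rule sum.cong[OF refl]) (simp add: algebra_simps power2_eq_square)
    then show ?thesis by (simp add: algebra_simps)
  qed
  then have "quad a (\<lambda>i. v i + t * kron i k) = quad a v + t * (\<Sum>i\<in>UNIV. v i * a i k)
      + (t * (\<Sum>j\<in>UNIV. a k j * v j) + t\<^sup>2 * a k k)"
    by (simp add: quad_def sum.distrib sum_distrib_left[symmetric])
  moreover have "(\<Sum>i\<in>UNIV. v i * a i k) = (\<Sum>j\<in>UNIV. a k j * v j)"
    using assms by (simp add: mult.commute)
  ultimately show ?thesis by (simp add: algebra_simps)
qed

text \<open>A positive semidefinite matrix is a sum of rank-one ones: split off one row at a time.\<close>

lemma trace_psd_nonneg:
  fixes a H :: "'n::finite \<Rightarrow> 'n \<Rightarrow> real"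
  assumes sym: "\<And>i j. a i j = a j i" and a: "\<And>v. 0 \<le> quad a v" and H: "\<And>v. 0 \<le> quad H v"
  shows "0 \<le> (\<Sum>i\<in>UNIV. \<Sum>j\<in>UNIV. a i j * H i j)"
proof -
  have "0 \<le> (\<Sum>i\<in>UNIV. \<Sum>j\<in>UNIV. a i j * H i j)"
    if "finite S" "\<And>i j. a i j = a j i" "\<And>v. 0 \<le> quad a v" "\<And>i j. i \<notin> S \<Longrightarrow> a i j = 0"
    for S and a :: "'n \<Rightarrow> 'n \<Rightarrow> real"
    using that
  proof (induction S arbitrary: a rule: finite_induct)
    case (insert k S)
    note sym = insert.prems(1) and psd = insert.prems(2)
    have quad0: "quad a (\<lambda>i. 0 + t * kron i k) = t\<^sup>2 * a k k" for t
      by (simp only: quad_add_kron[OF sym]) (simp add: quad_def)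
    have kk: "0 \<le> a k k" using psd[of "\<lambda>i. 0 + 1 * kron i k"] unfolding quad0 by simp
    show ?case
    proof (cases "a k k = 0")
      case True
      have "a k i = 0" for i
      proof (rule ccontr)
        assume n: "a k i \<noteq> 0"
        \<comment> \<open>With a zero diagonal entry the form is affine in \<open>t\<close>; if the
          slope were nonzero, the value of \<open>t\<close> inserted next would make it -1.\<close>
        have q: "quad a (\<lambda>j. kron j i + t * kron j k) = quad a (\<lambda>j. kron j i) + 2 * t * a k i" for t
          by (simp add: quad_add_kron[OF sym] True)
        have "0 \<le> quad a (\<lambda>j. kron j i) + 2 * (- (quad a (\<lambda>j. kron j i) + 1) / (2 * a k i)) * a k i"
          unfolding q[symmetric] by (rule psd)
        with n show False by (simp add: field_simps)
      qed
      then have "a i j = 0" if "i \<notin> S" for i j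
        using insert.prems(3)[of i j] that by (cases "i = k") auto
      then show ?thesis
        by (intro insert.IH sym psd)
    next
      case False
      with kk have pos: "0 < a k k" by simp
      \<comment> \<open>Schur complement of the entry \<open>a k k\<close>: subtracting a rank-one
        matrix clears row and column \<open>k\<close>. It stays semidefinite since
        \<open>quad a' v\<close> is the minimum of \<open>quad a\<close> over the line through
        \<open>v\<close> in direction \<open>k\<close>, attained at
        \<open>t = - s / a k k\<close>.\<close>
      define a' where "a' i j = a i j - a k i * a k j / a k k" for i j
      have quad': "quad a' v = quad a v - (\<Sum>i\<in>UNIV. a k i * v i)\<^sup>2 / a k k" for v
      proof -
        have "quad a' v = (\<Sum>i\<in>UNIV. \<Sum>j\<in>UNIV. a i j * (v i * v j) - (a k i * v i) * (a k j * v j) / a k k)"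
          by (simp add: quad_def a'_def algebra_simps)
        then show ?thesis
          by (simp add: quad_def sum_subtractf power2_eq_square sum_product sum_divide_distrib)
      qed
      have "0 \<le> quad a' v" for v
      proof -
        define s where "s = (\<Sum>i\<in>UNIV. a k i * v i)"
        have "0 \<le> quad a (\<lambda>i. v i + (- s / a k k) * kron i k)" by (rule psd)
        also have "\<dots> = quad a' v"
          using pos unfolding quad_add_kron[OF sym] quad' s_def[symmetric]
          by (simp add: power2_eq_square field_simps)
        finally show ?thesis .
      qed
      moreover have "a' i j = 0" if "i \<notin> S" for i j
        using insert.prems(3)[of i j] insert.prems(3)[of i k] that pos sym[of k i] by (cases "i = k") (auto simp: a'_def)
      moreover have "a' i j = a' j i" for i j by (simp add: a'_def sym[of i j])
      ultimately have "0 \<le> (\<Sum>i\<in>UNIV. \<Sum>j\<in>UNIV. a' i j * H i j)"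
        by (intro insert.IH) auto
      moreover have "(\<Sum>i\<in>UNIV. \<Sum>j\<in>UNIV. a i j * H i j) =
         (\<Sum>i\<in>UNIV. \<Sum>j\<in>UNIV. a' i j * H i j) + quad H (a k) / a k k"
        by (simp add: quad_def a'_def sum.distrib[symmetric] sum_divide_distrib algebra_simps)
      ultimately show ?thesis using H[of "a k"] pos by simp
    qed
  qed simp
  from this[of UNIV a] show ?thesis using sym a by simp
qed

text \<open>Restriction to lines: were the second derivative negative, the first derivative, zero at
  the minimum, would be negative just after it and the function would fall below its
  minimum.\<close>

lemma interior_minimum:
  fixes f :: "real^'n::finite \<Rightarrow> real"
  assumes S: "open S" "z \<in> S" and f: "Ck_on 2 f S" and min: "\<And>y. y \<in> S \<Longrightarrow> f z \<le> f y"
  shows "partial j f z = 0" "0 \<le> quad (\<lambda>i j. partial i (partial j f) z) (($) v)"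
proof -
  have d: "f differentiable (at y)" "partial j f differentiable (at y)" if "y \<in> S" for j y
    using Ck_on_2_differentiable[OF f S(1) that] .
  have p0: "partial j f z = 0" for j
  proof -
    have "(\<lambda>v. \<Sum>i\<in>UNIV. v $ i * partial i f z) = (\<lambda>v. 0)"
      by (rule differential_zero_maxmin[OF S(2,1) has_derivative_partial[OF d(1)[OF S(2)]]]) (use min in auto)
    then have "(\<Sum>i\<in>UNIV. axis j 1 $ i * partial i f z) = 0" by metis
    then show ?thesis by (simp add: axis_def if_distrib if_distribR cong: if_cong)
  qed
  then show "partial j f z = 0" .
  define \<phi> where "\<phi> t = f (z + t *\<^sub>R v)" for t
  define \<phi>' where "\<phi>' t = (\<Sum>j\<in>UNIV. v $ j * partial j f (z + t *\<^sub>R v))" for t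
  have line: "((\<lambda>t. F (z + t *\<^sub>R v)) has_real_derivative (\<Sum>i\<in>UNIV. v $ i * partial i F (z + t *\<^sub>R v))) (at t)"
    if "F differentiable (at (z + t *\<^sub>R v))" for F t
  proof -
    have 1: "((\<lambda>t. z + t *\<^sub>R v) has_derivative (\<lambda>s. s *\<^sub>R v)) (at t)"
      by (auto intro!: derivative_eq_intros)
    have "(\<lambda>s. \<Sum>i\<in>UNIV. (s *\<^sub>R v) $ i * partial i F (z + t *\<^sub>R v)) =
        (*) (\<Sum>i\<in>UNIV. v $ i * partial i F (z + t *\<^sub>R v))"
      by (rule ext) (simp add: sum_distrib_left mult_ac)
    with diff_chain_at[OF 1 has_derivative_partial[OF that]]
    show ?thesis
      by (simp add: o_def has_field_derivative_def)
  qed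
  obtain r where r: "r > 0" "ball z r \<subseteq> S" using S by (meson openE)
  \<comment> \<open>Adding 1 to the norm covers \<open>v = 0\<close> as well.\<close>
  define e where "e = r / (norm v + 1)"
  have e: "e > 0" using r by (simp add: e_def add_nonneg_pos)
  have inS: "z + t *\<^sub>R v \<in> S" if "\<bar>t\<bar> < e" for t
  proof -
    have "\<bar>t\<bar> * norm v \<le> \<bar>t\<bar> * (norm v + 1)" by (simp add: mult_left_mono)
    also have "\<dots> < r" using that by (simp add: e_def pos_less_divide_eq add_nonneg_pos)
    finally show ?thesis using r by (auto simp: subset_eq dist_norm)
  qed
  have \<phi>: "(\<phi> has_real_derivative \<phi>' t) (at t)" if "\<bar>t\<bar> < e" for t
    unfolding \<phi>_def \<phi>'_def by (rule line[OF d(1)[OF inS[OF that]]])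
  define q where "q = quad (\<lambda>i j. partial i (partial j f) z) (($) v)"
  have \<phi>': "(\<phi>' has_real_derivative q) (at 0)"
  proof -
    have "((\<lambda>t. \<Sum>j\<in>UNIV. v $ j * partial j f (z + t *\<^sub>R v)) has_real_derivative
        (\<Sum>j\<in>UNIV. v $ j * (\<Sum>i\<in>UNIV. v $ i * partial i (partial j f) (z + 0 *\<^sub>R v)))) (at 0)"
      by (intro DERIV_sum DERIV_cmult line) (use d(2) S(2) in simp)
    moreover have "(\<Sum>j\<in>UNIV. v $ j * (\<Sum>i\<in>UNIV. v $ i * partial i (partial j f) (z + 0 *\<^sub>R v))) = q"
      unfolding q_def quad_def sum_distrib_left by (subst sum.swap) (simp add: mult_ac)
    ultimately show ?thesis by (simp add: \<phi>'_def[abs_def])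
  qed
  have \<phi>'0: "\<phi>' 0 = 0" by (simp add: \<phi>'_def p0)
  show "0 \<le> quad (\<lambda>i j. partial i (partial j f) z) (($) v)"
  proof (rule ccontr)
    assume "\<not> ?thesis"
    then have "q < 0" by (simp add: q_def)
    from DERIV_neg_dec_right[OF \<phi>' this] obtain s where s: "s > 0" "\<And>h. h > 0 \<Longrightarrow> h < s \<Longrightarrow> \<phi>' h < 0"
      using \<phi>'0 by auto
    define t where "t = min s e / 2"
    have t: "0 < t" "t < s" "t < e" using s e by (auto simp: t_def)
    have "\<phi> t < \<phi> 0"
    proof (rule DERIV_neg_imp_decreasing_open[OF t(1)])
      show "\<exists>y. (\<phi> has_real_derivative y) (at x) \<and> y < 0" if "0 < x" "x < t" for x
        using \<phi>[of x] s(2)[of x] that t by force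
      show "continuous_on {0..t} \<phi>"
        by (rule continuous_at_imp_continuous_on) (use \<phi> t in \<open>force intro: DERIV_isCont\<close>)
    qed
    moreover have "\<phi> 0 \<le> \<phi> t" using min[OF inS[of t]] t by (simp add: \<phi>_def)
    ultimately show False by simp
  qed
qed

section \<open>Second-order operators and derivatives of the Gaussian\<close>

definition second_order ::
  "('n::finite \<Rightarrow> 'n \<Rightarrow> real^'n \<Rightarrow> real) \<Rightarrow> ('n \<Rightarrow> real^'n \<Rightarrow> real) \<Rightarrow> (real^'n \<Rightarrow> real) \<Rightarrow> real^'n \<Rightarrow> real" where
  "second_order a b F z = (\<Sum>i\<in>UNIV. \<Sum>j\<in>UNIV. a i j z * partial i (partial j F) z) + (\<Sum>k\<in>UNIV. b k z * partial k F z)"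

lemma partial_component: "partial i (\<lambda>z. (z - y) $ j) x = kron i j"
proof -
  have "((\<lambda>z. (z - y) $ j) has_derivative (\<lambda>v. v $ j)) (at x)"
    using bounded_linear.has_derivative[OF bounded_linear_vec_nth has_derivative_diff[OF has_derivative_ident has_derivative_const]]
    by simp
  from partial_eq[OF this, of i] show ?thesis by (simp add: axis_def kron_def eq_commute)
qed

lemma component_differentiable: "(\<lambda>z. (z - y) $ j) differentiable (at x)"
  for y :: "real^'n::finite"
  using bounded_linear.has_derivative[OF bounded_linear_vec_nth has_derivative_diff[OF has_derivative_ident has_derivative_const]]
  unfolding differentiable_def by blast

lemma Ck_on_component: "open S \<Longrightarrow> Ck_on k (\<lambda>z. (z - y) $ j) S"
proof (cases k)
  case (Suc m)
  assume S: "open S"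
  show ?thesis unfolding Suc
    by (rule Ck_on_SucI[OF S component_differentiable, where f' = "\<lambda>i x. kron i j"])
       (auto simp: partial_component S simp del: vector_minus_component)
qed (auto intro!: continuous_intros)

context
  fixes y :: "real^'n::finite" and \<alpha> :: real
begin

lemma norm_sq_sum: "(norm (z - y))\<^sup>2 = (\<Sum>i\<in>UNIV. (z - y) $ i * (z - y) $ i)"
  by (simp add: power2_norm_eq_inner inner_vec_def)

lemma Ck_on_gauss: "open S \<Longrightarrow> Ck_on k (\<lambda>z. exp (- \<alpha> * (norm (z - y))\<^sup>2)) S"
  unfolding norm_sq_sum by (intro Ck_on_exp Ck_on_mult Ck_on_sum Ck_on_component) auto

lemma partial_gauss:
  "partial j (\<lambda>z. exp (- \<alpha> * (norm (z - y))\<^sup>2)) x = - 2 * \<alpha> * ((x - y) $ j * exp (- \<alpha> * (norm (x - y))\<^sup>2))"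
proof -
  have "partial j (\<lambda>z. \<Sum>i\<in>UNIV. (z - y) $ i * (z - y) $ i) x = 2 * (x - y) $ j"
    by (subst partial_sum) (simp_all add: partial_mult[OF component_differentiable component_differentiable]
       partial_component differentiable_mult[OF component_differentiable component_differentiable] sum.distrib sum_distrib_left[symmetric]
       del: vector_minus_component)
  moreover have "(\<lambda>z. \<Sum>i\<in>UNIV. (z - y) $ i * (z - y) $ i) differentiable (at x)"
    by (intro differentiable_sum differentiable_mult component_differentiable ballI allI impI finite)
  moreover have "((\<lambda>t. exp (- \<alpha> * t)) has_real_derivative - \<alpha> * exp (- \<alpha> * t)) (at t)" for t
    by (auto intro!: derivative_eq_intros)
  ultimately show ?thesis
    unfolding norm_sq_sum using partial_chain[where F = "\<lambda>t. exp (- \<alpha> * t)" and y = x] by force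
qed

lemma partial2_gauss:
  "partial i (partial j (\<lambda>z. exp (- \<alpha> * (norm (z - y))\<^sup>2))) x =
     (4 * \<alpha>\<^sup>2 * ((x - y) $ i * (x - y) $ j) - 2 * \<alpha> * kron i j) * exp (- \<alpha> * (norm (x - y))\<^sup>2)"
proof -
  have d: "(\<lambda>z. exp (- \<alpha> * (norm (z - y))\<^sup>2)) differentiable (at x)"
    using Ck_on_differentiable[OF Ck_on_gauss[OF open_UNIV, where k = "Suc 0"], of x] by simp
  have "partial i (\<lambda>x. - 2 * \<alpha> * ((x - y) $ j * exp (- \<alpha> * (norm (x - y))\<^sup>2))) x =
    - 2 * \<alpha> * ((x - y) $ j * (- 2 * \<alpha> * ((x - y) $ i * exp (- \<alpha> * (norm (x - y))\<^sup>2)))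
       + kron i j * exp (- \<alpha> * (norm (x - y))\<^sup>2))"
    by (simp only: partial_cmult[OF differentiable_mult[OF component_differentiable[of y j x] d]]
      partial_mult[OF component_differentiable[of y j x] d] partial_gauss partial_component)
  then show ?thesis
    unfolding partial_gauss[abs_def] by (simp add: algebra_simps power2_eq_square)
qed

end


text \<open>The operator in question is \<open>second_order a b u - c * u\<close>. With
  \<open>c\<close> nonnegative, a minimum with nonpositive value is subject to the maximum
  principle.\<close>

locale elliptic_operator =
  fixes U :: "(real^'n::finite) set" and a :: "'n \<Rightarrow> 'n \<Rightarrow> real^'n \<Rightarrow> real"
    and b :: "'n \<Rightarrow> real^'n \<Rightarrow> real" and c :: "real^'n \<Rightarrow> real"
  assumes open_U: "open U"
    and cont_a: "continuous_on U (a i j)" and cont_b: "continuous_on U (b k)" and cont_c: "continuous_on U c"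
    and a_sym: "z \<in> U \<Longrightarrow> a i j z = a j i z"
    and a_pos: "z \<in> U \<Longrightarrow> v \<noteq> 0 \<Longrightarrow> 0 < quad (\<lambda>i j. a i j z) (($) v)"
    and c_nonneg: "z \<in> U \<Longrightarrow> 0 \<le> c z"
begin

text \<open>The gradient vanishes at the minimum, and the leading part is the trace of a product of
  two positive semidefinite matrices.\<close>

lemma second_order_interior_minimum:
  assumes "open S" "S \<subseteq> U" "z \<in> S" "Ck_on 2 f S" "\<And>y. y \<in> S \<Longrightarrow> f z \<le> f y"
  shows "0 \<le> second_order a b f z"
proof -
  have z: "z \<in> U" using assms by auto
  have "0 \<le> (\<Sum>i\<in>UNIV. \<Sum>j\<in>UNIV. a i j z * partial i (partial j f) z)"
  proof (rule trace_psd_nonneg)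
    have e: "($) (vec_lambda v) = v" for v :: "'n \<Rightarrow> real" by (rule ext) simp
    show "0 \<le> quad (\<lambda>i j. a i j z) v" for v
    proof (cases "v = (\<lambda>_. 0)")
      case False
      then have "(\<chi> i. v i) \<noteq> 0" by (auto simp: vec_eq_iff)
      from a_pos[OF z this] show ?thesis unfolding e by simp
    qed (simp add: quad_def)
    show "0 \<le> quad (\<lambda>i j. partial i (partial j f) z) v" for v
      using interior_minimum(2)[OF assms(1,3,4,5), of "\<chi> i. v i"] unfolding e .
  qed (rule a_sym[OF z])
  then show ?thesis
    using interior_minimum(1)[OF assms(1,3,4,5)] by (simp add: second_order_def)
qed

text \<open>Hopf's barrier, positive exactly inside the sphere of radius \<open>r\<close> around \<open>y\<close>.\<close>

lemma barrier:
  assumes K: "compact K" "K \<subseteq> U" "y \<notin> K"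
  obtains \<alpha> where "\<alpha> > 0" "\<And>z r. z \<in> K \<Longrightarrow>
    c z * (exp (- \<alpha> * (norm (z - y))\<^sup>2) - exp (- \<alpha> * r\<^sup>2)) <
    second_order a b (\<lambda>z. exp (- \<alpha> * (norm (z - y))\<^sup>2) - exp (- \<alpha> * r\<^sup>2)) z"
proof (cases "K = {}")
  case True
  then show ?thesis using that[of 1] by simp
next
  case False
  define Q where "Q z = quad (\<lambda>i j. a i j z) (($) (z - y))" for z
  define B where "B z = (\<Sum>i\<in>UNIV. a i i z) + (\<Sum>k\<in>UNIV. b k z * (z - y) $ k)" for z
  note cont = cont_a[THEN continuous_on_subset[OF _ K(2)]] cont_b[THEN continuous_on_subset[OF _ K(2)]]
    cont_c[THEN continuous_on_subset[OF _ K(2)]]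
  have "continuous_on K Q"
    unfolding Q_def quad_def by (intro continuous_intros cont)
  from continuous_attains_inf[OF K(1) False this] obtain z0 where z0: "z0 \<in> K" "\<And>z. z \<in> K \<Longrightarrow> Q z0 \<le> Q z" by blast
  define m where "m = Q z0"
  have m: "m > 0"
    unfolding m_def Q_def using z0(1) K(2,3) by (intro a_pos) auto
  have "continuous_on K (\<lambda>z. \<bar>B z\<bar> + c z)"
    unfolding B_def by (intro continuous_intros cont)
  from continuous_attains_sup[OF K(1) False this] obtain z1 where
    z1: "z1 \<in> K" "\<And>z. z \<in> K \<Longrightarrow> \<bar>B z\<bar> + c z \<le> \<bar>B z1\<bar> + c z1" by blast
  define M where "M = \<bar>B z1\<bar> + c z1"
  have M: "M \<ge> 0" using c_nonneg[of z1] z1(1) K(2) by (auto simp: M_def)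
  \<comment> \<open>The squared gradient of the exponent contributes at least
    \<open>4 * \<alpha>\<^sup>2 * m\<close>, the other terms together at most
    \<open>2 * \<alpha> * M\<close>; this choice gives \<open>\<alpha> * m = m + M\<close>, which
    exceeds \<open>M\<close>. Here \<open>m\<close> is positive because \<open>y\<close> lies
    outside \<open>K\<close>.\<close>
  define \<alpha> where "\<alpha> = 1 + M / m"
  have \<alpha>: "\<alpha> \<ge> 1" "\<alpha> * m = m + M" using m M by (simp_all add: \<alpha>_def field_simps)
  show ?thesis
  proof (rule that[of \<alpha>])
    fix z r assume z: "z \<in> K"
    let ?e = "exp (- \<alpha> * (norm (z - y))\<^sup>2)"
    let ?g = "\<lambda>z. exp (- \<alpha> * (norm (z - y))\<^sup>2)"
    have zU: "z \<in> U" using z K by auto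
    have C: "Ck_on 2 ?g UNIV" by (rule Ck_on_gauss) simp
    have d: "?g differentiable (at x)" for x
      using Ck_on_differentiable[of 1 ?g UNIV x] C by (simp add: numeral_2_eq_2)
    have p: "partial j (\<lambda>z. ?g z - exp (- \<alpha> * r\<^sup>2)) = partial j ?g" for j
      using partial_diff[OF d, of "\<lambda>_. exp (- \<alpha> * r\<^sup>2)"] by (simp add: fun_eq_iff)
    have "second_order a b (\<lambda>z. ?g z - exp (- \<alpha> * r\<^sup>2)) z =
       (\<Sum>i\<in>UNIV. \<Sum>j\<in>UNIV. (4 * \<alpha>\<^sup>2 * ?e) * (a i j z * ((z - y) $ i * (z - y) $ j)) - (2 * \<alpha> * ?e) * (kron i j * a i j z))
       + (\<Sum>k\<in>UNIV. (- 2 * \<alpha> * ?e) * (b k z * (z - y) $ k))"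
      unfolding second_order_def p partial_gauss partial2_gauss by (simp add: algebra_simps del: vector_minus_component)
    also have "\<dots> = (4 * \<alpha>\<^sup>2 * Q z - 2 * \<alpha> * B z) * ?e"
      unfolding sum_subtractf sum_distrib_left[symmetric] sum_kron Q_def quad_def B_def by (simp add: algebra_simps)
    finally have eq: "second_order a b (\<lambda>z. ?g z - exp (- \<alpha> * r\<^sup>2)) z = (4 * \<alpha>\<^sup>2 * Q z - 2 * \<alpha> * B z) * ?e" .
    have "c z < 4 * \<alpha>\<^sup>2 * Q z - 2 * \<alpha> * B z"
    proof -
      have b: "\<bar>B z\<bar> + c z \<le> M" "0 \<le> c z" using z1(2)[OF z] c_nonneg[OF zU] by (auto simp: M_def)
      have "c z + 2 * \<alpha> * B z \<le> 2 * \<alpha> * (c z + \<bar>B z\<bar>)"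
      proof -
        have "1 * c z \<le> 2 * \<alpha> * c z" using \<alpha> b by (intro mult_right_mono) auto
        moreover have "2 * \<alpha> * B z \<le> 2 * \<alpha> * \<bar>B z\<bar>" using \<alpha> by (intro mult_left_mono) auto
        ultimately show ?thesis by (simp add: distrib_left)
      qed
      also have "\<dots> \<le> 2 * \<alpha> * M" using \<alpha> b by (intro mult_left_mono) auto
      also have "\<dots> < 4 * \<alpha> * (\<alpha> * m)"
      proof -
        have "2 * \<alpha> * M \<le> 4 * \<alpha> * M" using \<alpha> M by (intro mult_right_mono) auto
        also have "\<dots> < 4 * \<alpha> * (m + M)" using \<alpha> m by (intro mult_strict_left_mono) auto
        finally show ?thesis using \<alpha> by simp
      qed
      also have "\<dots> \<le> 4 * \<alpha>\<^sup>2 * Q z"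
        using mult_left_mono[OF z0(2)[OF z], of "4 * \<alpha>\<^sup>2"] by (simp add: m_def power2_eq_square mult_ac)
      finally show ?thesis by simp
    qed
    \<comment> \<open>Subtracting the constant only lowers the left side since \<open>c\<close> is
      nonnegative; hence one \<open>\<alpha>\<close> serves all \<open>r\<close>.\<close>
    moreover have "c z * (?e - exp (- \<alpha> * r\<^sup>2)) \<le> c z * ?e"
      using c_nonneg[OF zU] by (simp add: mult_left_mono)
    ultimately show "c z * (?e - exp (- \<alpha> * r\<^sup>2)) < second_order a b (\<lambda>z. ?g z - exp (- \<alpha> * r\<^sup>2)) z"
      unfolding eq by (meson exp_gt_zero le_less_trans mult_strict_right_mono)
  qed (use \<alpha> in auto)
qed

text \<open>Hopf's comparison, carried out on a ball around the touching point \<open>x\<close>: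
  \<open>F = u - \<epsilon> * h\<close> is positive on its sphere and zero at \<open>x\<close>, so
  it has an interior minimum with nonpositive value, where the strict inequality for the barrier
  contradicts ellipticity. No normal derivative at \<open>x\<close> is involved.\<close>

lemma no_touching_ball:
  assumes u: "Ck_on 2 u U" "\<And>z. z \<in> U \<Longrightarrow> 0 \<le> u z"
    and super: "\<And>z. z \<in> U \<Longrightarrow> second_order a b u z \<le> c z * u z"
    and r: "dist x y = r" "r > 0" and K: "cball x (r / 2) \<subseteq> U" and x: "u x = 0"
    and pos: "\<And>z. z \<in> cball y r \<inter> cball x (r / 2) \<Longrightarrow> z \<noteq> x \<Longrightarrow> 0 < u z"
  shows False
proof -
  \<comment> \<open>Half the radius keeps the centre \<open>y\<close>, where the barrier
    degenerates, out of the comparison ball.\<close>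
  define s where "s = r / 2"
  have s: "s > 0" using r by (simp add: s_def)
  have yK: "y \<notin> cball x s" using r by (simp add: s_def)
  obtain \<alpha> where \<alpha>: "\<alpha> > 0" "\<And>z r. z \<in> cball x s \<Longrightarrow>
    c z * (exp (- \<alpha> * (norm (z - y))\<^sup>2) - exp (- \<alpha> * r\<^sup>2)) <
    second_order a b (\<lambda>z. exp (- \<alpha> * (norm (z - y))\<^sup>2) - exp (- \<alpha> * r\<^sup>2)) z"
    using barrier[OF compact_cball _ yK] K unfolding s_def by metis
  define h where "h z = exp (- \<alpha> * (norm (z - y))\<^sup>2) - exp (- \<alpha> * r\<^sup>2)" for z
  have contu: "continuous_on (cball x s) u"
    using Ck_on_continuous[OF u(1)] K unfolding s_def by (rule continuous_on_subset)
  have "\<exists>\<delta>>0. \<forall>z \<in> sphere x s \<inter> cball y r. \<delta> \<le> u z"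
  proof (cases "sphere x s \<inter> cball y r = {}")
    case True
    then show ?thesis by (intro exI[of _ 1]) simp
  next
    case False
    have "compact (sphere x s \<inter> cball y r)" by (simp add: compact_Int_closed)
    moreover have "continuous_on (sphere x s \<inter> cball y r) u"
      by (rule continuous_on_subset[OF contu]) auto
    ultimately obtain z0 where "z0 \<in> sphere x s \<inter> cball y r" "\<forall>z\<in>sphere x s \<inter> cball y r. u z0 \<le> u z"
      using continuous_attains_inf False by metis
    moreover then have "0 < u z0" using s by (intro pos) (auto simp: s_def)
    ultimately show ?thesis by blast
  qed
  then obtain \<delta> where \<delta>: "\<delta> > 0" "\<And>z. z \<in> sphere x s \<inter> cball y r \<Longrightarrow> \<delta> \<le> u z" by blast
  \<comment> \<open>Since \<open>h\<close> is at most 1, this leaves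
    \<open>u - \<epsilon> * h\<close> positive wherever \<open>u\<close> is at least
    \<open>\<delta>\<close>.\<close>
  define \<epsilon> where "\<epsilon> = \<delta> / 2"
  define F where "F z = u z - \<epsilon> * h z" for z
  have \<epsilon>: "\<epsilon> > 0" using \<delta> by (simp add: \<epsilon>_def)
  have h1: "h z \<le> 1" for z
  proof -
    have "exp (- \<alpha> * (norm (z - y))\<^sup>2) \<le> 1" using \<alpha>(1) by simp
    then show ?thesis unfolding h_def using exp_gt_zero[of "- \<alpha> * r\<^sup>2"] by linarith
  qed
  \<comment> \<open>On the part of the sphere inside \<open>cball y r\<close> the function
    \<open>u\<close> is at least \<open>\<delta>\<close>; outside it \<open>h\<close> is negative
    and \<open>u\<close> nonnegative.\<close>
  have Fsphere: "F z > 0" if z: "z \<in> sphere x s" for z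
  proof (cases "z \<in> cball y r")
    case True
    have "\<epsilon> * h z \<le> \<epsilon>" using mult_left_mono[OF h1[of z], of \<epsilon>] \<epsilon> by simp
    moreover have "\<delta> \<le> u z" using \<delta>(2)[of z] True z by simp
    ultimately show ?thesis using \<delta>(1) \<epsilon>_def unfolding F_def by linarith
  next
    case False
    then have "r < norm (z - y)" by (simp add: dist_norm norm_minus_commute)
    then have "r\<^sup>2 < (norm (z - y))\<^sup>2" using r by (intro power_strict_mono) auto
    then have "h z < 0" using \<alpha>(1) by (simp add: h_def)
    then have "\<epsilon> * h z < 0" using \<epsilon> by (simp add: mult_less_0_iff)
    then show ?thesis using u(2)[of z] K z by (auto simp: F_def s_def subset_eq)
  qed
  have C2h: "Ck_on 2 h UNIV" unfolding h_def[abs_def]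
    by (intro Ck_on_diff Ck_on_gauss Ck_on_const) auto
  have contF: "continuous_on (cball x s) F"
    unfolding F_def using continuous_on_subset[OF Ck_on_continuous[OF C2h]] by (auto intro!: continuous_intros contu)
  have "cball x s \<noteq> {}" using s by auto
  from continuous_attains_inf[OF compact_cball this contF]
  obtain z where z: "z \<in> cball x s" "\<And>z'. z' \<in> cball x s \<Longrightarrow> F z \<le> F z'" by blast
  have "F x = 0" using x r by (simp add: F_def h_def dist_norm)
  then have Fz: "F z \<le> 0" using z(2)[of x] s by simp
  then have zb: "z \<in> ball x s" using Fsphere[of z] z(1) by (cases "dist x z = s") (auto simp: sphere_def)
  have bU: "ball x s \<subseteq> U" using K by (auto simp: s_def subset_eq)
  have zU: "z \<in> U" using zb bU by auto
  have C2F: "Ck_on 2 F (ball x s)"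
    unfolding F_def[abs_def]
    by (intro Ck_on_diff Ck_on_mult Ck_on_const) (use Ck_on_subset[OF u(1) bU] Ck_on_subset[OF C2h] in auto)
  have "0 \<le> second_order a b F z"
    by (rule second_order_interior_minimum[OF open_ball bU zb C2F]) (use z(2) in auto)
  also have "second_order a b F z = second_order a b u z - \<epsilon> * second_order a b h z"
  proof -
    have du: "u differentiable (at x)" "partial j u differentiable (at x)" if "x \<in> U" for j x
      using Ck_on_2_differentiable[OF u(1) open_U that] .
    have dh: "h differentiable (at x)" "partial j h differentiable (at x)" for j x
      using Ck_on_2_differentiable[OF C2h open_UNIV UNIV_I] .
    have p: "partial j F x = partial j u x - \<epsilon> * partial j h x" if "x \<in> U" for j x
      unfolding F_def[abs_def] by (simp add: partial_diff partial_cmult du[OF that] dh differentiable_mult)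
    have pp: "partial i (partial j F) z = partial i (partial j u) z - \<epsilon> * partial i (partial j h) z" for i j
    proof -
      have "partial i (partial j F) z = partial i (\<lambda>x. partial j u x - \<epsilon> * partial j h x) z"
        by (rule partial_cong[OF open_U zU p])
      then show ?thesis by (simp add: partial_diff partial_cmult du[OF zU] dh differentiable_mult)
    qed
    show ?thesis
      unfolding second_order_def p[OF zU] pp
      by (simp add: right_diff_distrib distrib_left sum_subtractf sum_distrib_left mult_ac)
  qed
  also have "\<dots> < c z * u z - \<epsilon> * (c z * h z)"
  proof -
    have "\<epsilon> * (c z * h z) < \<epsilon> * second_order a b h z"
      using \<alpha>(2)[OF z(1), of r] \<epsilon> unfolding h_def[abs_def] by (intro mult_strict_left_mono)
    then show ?thesis using super[OF zU] by linarith
  qed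
  also have "\<dots> = c z * F z" by (simp add: F_def algebra_simps)
  also have "\<dots> \<le> 0" using c_nonneg[OF zU] Fz by (simp add: mult_nonneg_nonpos)
  finally show False by simp
qed

text \<open>A nonzero value near \<open>x\<close> would give a nearest zero \<open>x1\<close> and a
  ball of positivity touching it. A second ball, of half the radius and internally tangent at
  \<open>x1\<close>, meets the zero set nowhere else even on its boundary, as
  \<open>no_touching_ball\<close> demands.\<close>

theorem strong_maximum_principle:
  assumes u: "Ck_on 2 u U" "\<And>z. z \<in> U \<Longrightarrow> 0 \<le> u z"
    and super: "\<And>z. z \<in> U \<Longrightarrow> second_order a b u z \<le> c z * u z"
    and x: "x \<in> U" "u x = 0"
  shows "\<exists>\<rho>>0. ball x \<rho> \<subseteq> U \<and> (\<forall>z\<in>ball x \<rho>. u z = 0)"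
proof -
  obtain R0 where R0: "R0 > 0" "ball x R0 \<subseteq> U" using open_U x(1) by (meson openE)
  \<comment> \<open>Room for the whole construction: \<open>x1\<close> is within
    \<open>2 * \<rho>\<close> of \<open>x\<close>, and the comparison ball around \<open>x1\<close>
    has radius below \<open>\<rho>\<close>, so it stays within \<open>3 * \<rho>\<close> of
    \<open>x\<close>.\<close>
  define \<rho> where "\<rho> = R0 / 4"
  have \<rho>: "\<rho> > 0" using R0 by (simp add: \<rho>_def)
  have inU: "z \<in> U" if "dist x z < 4 * \<rho>" for z using R0 that by (auto simp: \<rho>_def)
  have "u y = 0" if y: "y \<in> ball x \<rho>" for y
  proof (rule ccontr)
    assume uy: "u y \<noteq> 0"
    define Z where "Z = {z \<in> cball x (2 * \<rho>). u z = 0}"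
    have "continuous_on (cball x (2 * \<rho>)) u"
      by (rule continuous_on_subset[OF Ck_on_continuous[OF u(1)]]) (use inU \<rho> in auto)
    then have "closed Z"
      unfolding Z_def by (rule continuous_closed_preimage_constant) simp
    moreover have "bounded Z"
      by (rule bounded_subset[OF bounded_cball]) (auto simp: Z_def)
    ultimately have "compact Z" by (simp add: compact_eq_bounded_closed)
    moreover have "x \<in> Z" using x \<rho> by (simp add: Z_def)
    moreover have "continuous_on Z (dist y)" by (intro continuous_intros)
    ultimately obtain x1 where x1: "x1 \<in> Z" "\<And>z. z \<in> Z \<Longrightarrow> dist y x1 \<le> dist y z"
      using continuous_attains_inf[of Z "dist y"] by blast
    define R where "R = dist y x1"
    have R: "R > 0" using x1(1) uy by (auto simp: R_def Z_def)
    have Rr: "R < \<rho>" using x1(2)[OF \<open>x \<in> Z\<close>] y by (simp add: R_def dist_commute)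
    have pos: "0 < u z" if "dist y z < R" for z
    proof -
      have "dist x z < 2 * \<rho>" using dist_triangle[of x z y] that Rr y by simp
      moreover have "z \<notin> Z" using x1(2)[of z] that by (auto simp: R_def)
      ultimately show ?thesis using u(2)[OF inU[of z]] \<rho> by (auto simp: Z_def less_le)
    qed
    define y' where "y' = (1/2) *\<^sub>R (y + x1)"
    define r where "r = R / 2"
    have n1: "norm (y' - y) = r" "norm (x1 - y') = r"
    proof -
      have "y' - y = (1/2) *\<^sub>R (x1 - y)" by (simp add: vec_eq_iff y'_def field_simps)
      then show "norm (y' - y) = r" by (simp add: r_def R_def dist_norm norm_minus_commute)
      have "x1 - y' = (1/2) *\<^sub>R (x1 - y)" by (simp add: vec_eq_iff y'_def field_simps)
      then show "norm (x1 - y') = r" by (simp add: r_def R_def dist_norm norm_minus_commute)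
    qed
    show False
    proof (rule no_touching_ball[OF u super, of x1 y' r])
      show "dist x1 y' = r" using n1 by (simp add: dist_norm)
      show "r > 0" "u x1 = 0" using R x1 by (auto simp: r_def Z_def)
      show "cball x1 (r / 2) \<subseteq> U"
      proof
        fix z assume "z \<in> cball x1 (r / 2)"
        then have "dist x1 z \<le> \<rho>" using Rr R by (simp add: r_def)
        moreover have "dist x x1 \<le> 2 * \<rho>" using x1(1) by (simp add: Z_def)
        ultimately have "dist x z \<le> 3 * \<rho>" using dist_triangle[of x z x1] by linarith
        then show "z \<in> U" using inU[of z] \<rho> by simp
      qed
      show "0 < u z" if "z \<in> cball y' r \<inter> cball x1 (r / 2)" "z \<noteq> x1" for z
      proof (rule pos)
        \<comment> \<open>Parallelogram law: \<open>y\<close> and \<open>x1\<close> are antipodal on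
          the half-size sphere, so for a point of the closed half-size ball the squared distances to
          them add up to at most \<open>4 * r\<^sup>2 = R\<^sup>2\<close>. A point other than
          \<open>x1\<close> is therefore closer to \<open>y\<close> than \<open>R\<close>.\<close>
        have "(norm ((z - y') + (y' - y)))\<^sup>2 + (norm ((z - y') - (y' - y)))\<^sup>2 = 2 * (norm (z - y'))\<^sup>2 + 2 * (norm (y' - y))\<^sup>2"
          by (simp only: power2_norm_eq_inner inner_add_left inner_add_right inner_diff_left inner_diff_right)
             (simp add: inner_commute)
        moreover have "(z - y') - (y' - y) = z - x1" "(z - y') + (y' - y) = z - y"
          by (simp_all add: vec_eq_iff y'_def field_simps)
        ultimately have P: "(norm (z - y))\<^sup>2 + (norm (z - x1))\<^sup>2 = 2 * (norm (z - y'))\<^sup>2 + 2 * r\<^sup>2"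
          unfolding n1 by simp
        have "(norm (z - y'))\<^sup>2 \<le> r\<^sup>2"
          using that(1) by (intro power_mono) (auto simp: dist_norm norm_minus_commute)
        moreover have "0 < (norm (z - x1))\<^sup>2" using that(2) by simp
        ultimately have "(norm (z - y))\<^sup>2 < 4 * r\<^sup>2" using P by linarith
        then have "(norm (z - y))\<^sup>2 < R\<^sup>2" by (simp add: r_def power2_eq_square)
        then show "dist y z < R" using R by (simp add: dist_norm norm_minus_commute power2_less_imp_less)
      qed
    qed
  qed
  moreover have "ball x \<rho> \<subseteq> U" using inU \<rho> by auto
  ultimately show ?thesis using \<rho> by blast
qed

end

section \<open>The Hopf--Rinow--Cohn-Vossen theorem\<close>

context Metric_space
begin

text \<open>By \<open>len\<close> every point of the large ball is within
  \<open>\<epsilon> / 2\<close> of the ball of radius \<open>R - \<epsilon> / 2\<close>, so an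
  \<open>\<epsilon> / 2\<close>-net of the latter is an \<open>\<epsilon>\<close>-net of the former.
  If that radius is not positive, the centre alone is a net.\<close>

lemma mtotally_bounded_mball_limit:
  assumes len: "\<And>x y r s. x \<in> M \<Longrightarrow> y \<in> M \<Longrightarrow> r > 0 \<Longrightarrow> s > 0 \<Longrightarrow> d x y < r + s \<Longrightarrow>
      \<exists>z\<in>M. d x z < r \<and> d z y < s"
    and x: "x \<in> M" and R: "R > 0" and tb: "\<And>r. r < R \<Longrightarrow> mtotally_bounded (mball x r)"
  shows "mtotally_bounded (mball x R)"
  unfolding mtotally_bounded_def
proof (intro allI impI)
  fix \<epsilon> :: real assume \<epsilon>: "\<epsilon> > 0"
  define r where "r = R - \<epsilon> / 2"
  show "\<exists>K. finite K \<and> K \<subseteq> mball x R \<and> mball x R \<subseteq> (\<Union>x\<in>K. mball x \<epsilon>)"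
  proof (cases "r > 0")
    case False
    then have "mball x R \<subseteq> mball x \<epsilon>" using \<epsilon> by (intro mball_subset_concentric) (simp add: r_def)
    then show ?thesis using x R by (intro exI[of _ "{x}"]) simp
  next
    case True
    have e: "\<epsilon> / 2 > 0" "r < R" using \<epsilon> by (auto simp: r_def)
    from tb[OF e(2), unfolded mtotally_bounded_def, rule_format, OF e(1)]
    obtain K where K: "finite K" "K \<subseteq> mball x r" "mball x r \<subseteq> (\<Union>x\<in>K. mball x (\<epsilon> / 2))"
      by (elim exE conjE)
    have "mball x R \<subseteq> (\<Union>x\<in>K. mball x \<epsilon>)"
    proof
      fix y assume y: "y \<in> mball x R"
      then obtain z where z: "z \<in> M" "d x z < r" "d z y < \<epsilon> / 2"
        using len[of x y r "\<epsilon> / 2"] True \<epsilon> by (auto simp: r_def)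
      then obtain k where k: "k \<in> K" "z \<in> mball k (\<epsilon> / 2)" using K(3) x by auto
      then have "d k y < \<epsilon>" using triangle[of k z y] z y by auto
      then show "y \<in> (\<Union>x\<in>K. mball x \<epsilon>)" using k y by auto
    qed
    moreover have "K \<subseteq> mball x R" using K(2) mball_subset_concentric[of r R x] e by auto
    ultimately show ?thesis using K(1) by blast
  qed
qed

text \<open>Completeness makes the closure of the ball compact, so finitely many balls of half their
  compact radius cover it; by \<open>len\<close> the points of the enlarged ball are within the
  smallest half radius of the original ball and stay inside the full compact balls.\<close>

lemma mtotally_bounded_mball_extend:
  assumes complete: mcomplete
    and loc: "\<And>x. x \<in> M \<Longrightarrow> \<exists>r>0. compactin mtopology (mcball x r)"
    and len: "\<And>x y r s. x \<in> M \<Longrightarrow> y \<in> M \<Longrightarrow> r > 0 \<Longrightarrow> s > 0 \<Longrightarrow> d x y < r + s \<Longrightarrow>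
      \<exists>z\<in>M. d x z < r \<and> d z y < s"
    and x: "x \<in> M" and R: "R > 0" and tb: "mtotally_bounded (mball x R)"
  shows "\<exists>\<delta>>0. mtotally_bounded (mball x (R + \<delta>))"
proof -
  define K where "K = mtopology closure_of (mball x R)"
  have K: "compactin mtopology K"
    using tb mtotally_bounded_eq_compact_closure_of[OF complete] by (simp add: K_def)
  have KM: "K \<subseteq> M" using compactin_subset_topspace[OF K] by simp
  have sub: "mball x R \<subseteq> K" unfolding K_def by (rule closure_of_subset) auto
  obtain \<rho> where \<rho>: "\<And>z. z \<in> M \<Longrightarrow> \<rho> z > 0 \<and> compactin mtopology (mcball z (\<rho> z))"
    using loc by metis
  obtain F where F: "finite F" "F \<subseteq> K" "K \<subseteq> (\<Union>z\<in>F. mball z (\<rho> z / 2))"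
  proof -
    have 1: "K \<subseteq> \<Union> ((\<lambda>z. mball z (\<rho> z / 2)) ` K)"
    proof
      fix z assume z: "z \<in> K"
      then have "z \<in> mball z (\<rho> z / 2)" using KM \<rho>[of z] by auto
      with z show "z \<in> \<Union> ((\<lambda>z. mball z (\<rho> z / 2)) ` K)" by blast
    qed
    have 2: "\<And>U. U \<in> (\<lambda>z. mball z (\<rho> z / 2)) ` K \<Longrightarrow> openin mtopology U" by auto
    from compactinD[OF K 2 1] obtain \<F> where \<F>: "finite \<F>" "\<F> \<subseteq> (\<lambda>z. mball z (\<rho> z / 2)) ` K" "K \<subseteq> \<Union>\<F>"
      by auto
    from finite_subset_image[OF \<F>(1,2)] \<F>(3) that show thesis by auto
  qed
  have xK: "x \<in> K" using sub x R by auto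
  then have "F \<noteq> {}" using F(3) by auto
  define \<delta> where "\<delta> = Min ((\<lambda>z. \<rho> z / 2) ` F)"
  have \<delta>: "\<delta> > 0" "\<And>z. z \<in> F \<Longrightarrow> \<delta> \<le> \<rho> z / 2"
  proof -
    show "\<delta> > 0" unfolding \<delta>_def using F \<open>F \<noteq> {}\<close> KM \<rho> by (subst Min_gr_iff) auto
    show "\<delta> \<le> \<rho> z / 2" if "z \<in> F" for z
      unfolding \<delta>_def using F(1) that by (intro Min_le) auto
  qed
  have "mball x (R + \<delta>) \<subseteq> (\<Union>z\<in>F. mcball z (\<rho> z))"
  proof
    fix y assume y: "y \<in> mball x (R + \<delta>)"
    then obtain z where z: "z \<in> M" "d x z < R" "d z y < \<delta>"
      using len[of x y R \<delta>] R \<delta> by auto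
    then have "z \<in> K" using sub x by auto
    then obtain k where k: "k \<in> F" "z \<in> mball k (\<rho> k / 2)" using F(3) by auto
    then have "d k y \<le> \<rho> k" using triangle[of k z y] z y \<delta>(2)[OF k(1)] by auto
    then show "y \<in> (\<Union>z\<in>F. mcball z (\<rho> z))" using k y by auto
  qed
  moreover have "compactin mtopology (\<Union>z\<in>F. mcball z (\<rho> z))"
    using F KM \<rho> by (intro compactin_Union) auto
  ultimately show ?thesis
    using \<delta>(1) compactin_imp_mtotally_bounded mtotally_bounded_subset by blast
qed

text \<open>Approximate interpolation \<open>len\<close> takes the place of minimising geodesics.
  The infimum of the radii whose balls are not totally bounded would be a good radius by the limit
  lemma, and could then be enlarged past itself.\<close>

theorem Hopf_Rinow:
  assumes complete: mcomplete
    and loc: "\<And>x. x \<in> M \<Longrightarrow> \<exists>r>0. compactin mtopology (mcball x r)"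
    and len: "\<And>x y r s. x \<in> M \<Longrightarrow> y \<in> M \<Longrightarrow> r > 0 \<Longrightarrow> s > 0 \<Longrightarrow> d x y < r + s \<Longrightarrow>
      \<exists>z\<in>M. d x z < r \<and> d z y < s"
    and x: "x \<in> M"
  shows "compactin mtopology (mcball x r)"
proof -
  have tb: "mtotally_bounded (mball x R)" for R
  proof (rule ccontr)
    assume n: "\<not> ?thesis"
    define B where "B = {r. \<not> mtotally_bounded (mball x r)}"
    obtain r0 where r0: "r0 > 0" "compactin mtopology (mcball x r0)" using loc[OF x] by blast
    then have tb0: "mtotally_bounded (mball x r0)"
      by (meson compactin_imp_mtotally_bounded mball_subset_mcball mtotally_bounded_subset)
    have mono: "mtotally_bounded (mball x r)" if "mtotally_bounded (mball x r')" "r \<le> r'" for r r'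
      using that by (meson mball_subset_concentric mtotally_bounded_subset)
    have ge: "r0 \<le> r" if "r \<in> B" for r using that mono[OF tb0, of r] by (cases "r \<le> r0") (auto simp: B_def)
    then have bdd: "bdd_below B" by (auto simp: bdd_below_def)
    have ne: "B \<noteq> {}" using n by (auto simp: B_def)
    define I where "I = Inf B"
    have "I > 0" using cInf_greatest[OF ne ge] r0 by (auto simp: I_def)
    moreover have "mtotally_bounded (mball x r)" if "r < I" for r
      using cInf_lower[OF _ bdd, of r] that by (auto simp: I_def B_def)
    ultimately have "mtotally_bounded (mball x I)"
      using mtotally_bounded_mball_limit[OF len x] by blast
    then obtain \<delta> where \<delta>: "\<delta> > 0" "mtotally_bounded (mball x (I + \<delta>))"
      using mtotally_bounded_mball_extend[OF complete loc len x \<open>I > 0\<close>] by blast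
    have "I + \<delta> \<le> r" if "r \<in> B" for r using that mono[OF \<delta>(2), of r] by (cases "r \<le> I + \<delta>") (auto simp: B_def)
    then have "I + \<delta> \<le> I" unfolding I_def by (intro cInf_greatest[OF ne])
    then show False using \<delta>(1) by simp
  qed
  have "mcball x r \<subseteq> mball x (r + 1)" by auto
  then have "mtotally_bounded (mcball x r)" using tb mtotally_bounded_subset by blast
  then show ?thesis
    using mtotally_bounded_eq_compact_closure_of[OF complete, of "mcball x r"] by (simp add: closure_of_closedin)
qed

end

section \<open>The Riemannian distance\<close>

lemma C_on_mono: "C_on k f S \<Longrightarrow> m \<le> k \<Longrightarrow> C_on m f S"
  by (auto simp: C_on_def intro: order_trans)

lemma riemannian_metric_mono: "riemannian_metric A k g \<Longrightarrow> m \<le> k \<Longrightarrow> riemannian_metric A m g"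
  unfolding riemannian_metric_def by (elim conjE, intro conjI) (assumption | blast intro: C_on_mono)+

text \<open>Induction on the finite set, one break point at a time: it either splits the interval,
  or lies outside its interior and may be dropped.\<close>

lemma breakpoint_induct [consumes 2, case_names piece join]:
  fixes a b :: real
  assumes "finite S" "a < b"
    and piece: "\<And>c d. a \<le> c \<Longrightarrow> c < d \<Longrightarrow> d \<le> b \<Longrightarrow> {c<..<d} \<inter> S = {} \<Longrightarrow> P c d"
    and join: "\<And>c d e. a \<le> c \<Longrightarrow> c < d \<Longrightarrow> d < e \<Longrightarrow> e \<le> b \<Longrightarrow> P c d \<Longrightarrow> P d e \<Longrightarrow> P c e"
  shows "P a b"
proof -
  have "P c d" if "a \<le> c" "c < d" "d \<le> b" "finite T"
    "\<And>c' d'. c \<le> c' \<Longrightarrow> c' < d' \<Longrightarrow> d' \<le> d \<Longrightarrow> {c'<..<d'} \<inter> T = {} \<Longrightarrow> P c' d'" for c d T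
    using that(4,1,2,3,5)
  proof (induction T arbitrary: c d rule: finite_induct)
    case (insert s T)
    show ?case
    proof (cases "c < s \<and> s < d")
      case True
      have "P c s" by (rule insert.IH) (use True insert.prems in auto)
      moreover have "P s d" by (rule insert.IH) (use True insert.prems in auto)
      ultimately show ?thesis using join insert.prems True by auto
    next
      case False
      show ?thesis by (rule insert.IH) (use False insert.prems in auto)
    qed
  qed auto
  from this[of a b S] show ?thesis using assms by auto
qed

lemma quadratic_form_sum:
  fixes v :: "real^'n"
  shows "v \<bullet> (M *v v) = (\<Sum>i\<in>UNIV. v $ i * (\<Sum>j\<in>UNIV. M $ i $ j * v $ j))"
  by (simp add: inner_vec_def matrix_vector_mult_def)

text \<open>Continuity is the regularity that lengths see; fixing it here lets \<open>g0\<close> and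
  the conformal metric instantiate the same theory.\<close>

locale riemannian_manifold =
  fixes A :: "('m::{t2_space,second_countable_topology}, 'n::finite) chart set"
    and g :: "('m, 'n) metric_field"
  assumes atlas: "smooth_atlas A" and metric: "riemannian_metric A 0 g"
    and connected: "connected (UNIV :: 'm set)"
begin

lemma cover: "\<exists>c\<in>A. p \<in> fst c"
  using atlas unfolding smooth_atlas_def by blast

context
  fixes c assumes c: "c \<in> A"
begin

lemma chart_open: "open (fst c)" "open (snd c ` fst c)"
  and chart_homeo: "homeomorphism (fst c) (snd c ` fst c) (snd c) (chart_inv c)"
  using atlas c unfolding smooth_atlas_def by auto

lemma chart_cont: "continuous_on (fst c) (snd c)" "continuous_on (snd c ` fst c) (chart_inv c)"
  using chart_homeo by (auto simp: homeomorphism_def)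

lemma chart_left: "p \<in> fst c \<Longrightarrow> chart_inv c (snd c p) = p"
  using chart_homeo by (auto simp: homeomorphism_def)

lemma chart_right: "y \<in> snd c ` fst c \<Longrightarrow> snd c (chart_inv c y) = y"
  using chart_homeo by (auto simp: homeomorphism_def)

lemma chart_inv_in: "y \<in> snd c ` fst c \<Longrightarrow> chart_inv c y \<in> fst c"
  using chart_homeo by (auto simp: homeomorphism_def)

lemma chart_vimage_open: "open W \<Longrightarrow> open {p \<in> fst c. snd c p \<in> W}"
  using continuous_open_preimage[OF chart_cont(1) chart_open(1), of W]
  by (simp add: vimage_def Int_def)

lemma chart_image_compact:
  assumes "compact K" "K \<subseteq> snd c ` fst c" shows "compact (chart_inv c ` K)"
  by (rule compact_continuous_image[OF continuous_on_subset[OF chart_cont(2) assms(2)] assms(1)])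

lemma g_cont: "continuous_on (fst c) (\<lambda>p. g c p $ i $ j)"
proof -
  have "C_on 0 (\<lambda>y. g c (chart_inv c y) $ i $ j) (snd c ` fst c)"
    using metric c unfolding riemannian_metric_def by auto
  then have "continuous_on (snd c ` fst c) (\<lambda>y. g c (chart_inv c y) $ i $ j)"
    by (auto simp: C_on_def zero_enat_def dest: spec[of _ 0])
  from continuous_on_compose[OF chart_cont(1) this] have
    "continuous_on (fst c) (\<lambda>p. g c (chart_inv c (snd c p)) $ i $ j)" by (simp add: o_def)
  then show ?thesis by (rule continuous_on_eq) (simp add: chart_left)
qed

lemma g_pos: "p \<in> fst c \<Longrightarrow> v \<noteq> 0 \<Longrightarrow> 0 < v \<bullet> (g c p *v v)"
  using metric c unfolding riemannian_metric_def by blast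

lemma g_nonneg: "p \<in> fst c \<Longrightarrow> 0 \<le> v \<bullet> (g c p *v v)"
  using g_pos[of p v] by (cases "v = 0") auto

end

section \<open>Change of charts, and the speed of a curve\<close>

definition overlap :: "('m, 'n) chart \<Rightarrow> ('m, 'n) chart \<Rightarrow> (real^'n) set" where
  "overlap c d = snd c ` (fst c \<inter> fst d)"

definition transition :: "('m, 'n) chart \<Rightarrow> ('m, 'n) chart \<Rightarrow> real^'n \<Rightarrow> real^'n" where
  "transition c d = snd d \<circ> chart_inv c"

context
  fixes c d assumes c: "c \<in> A" and d: "d \<in> A"
begin

lemma overlap_open: "open (overlap c d)"
proof -
  have "overlap c d = snd c ` fst c \<inter> chart_inv c -` fst d"
    by (auto simp: overlap_def chart_left[OF c] chart_inv_in[OF c] image_iff)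
  then show ?thesis
    using continuous_open_preimage[OF chart_cont(2)[OF c] chart_open(2)[OF c] chart_open(1)[OF d]] by simp
qed

lemma transition_smooth: "Ck_on k (\<lambda>y. transition c d y $ i) (overlap c d)"
  using atlas c d unfolding smooth_atlas_def transition_def overlap_def by (auto simp: C_on_infinity)

lemma transition_derivative:
  assumes "y \<in> overlap c d"
  shows "(transition c d has_derivative (\<lambda>v. \<chi> j. \<Sum>i\<in>UNIV. v $ i * partial i (\<lambda>z. transition c d z $ j) y)) (at y)"
  unfolding has_derivative_componentwise_within[of "transition c d"]
proof
  fix b :: "real^'n" assume "b \<in> Basis"
  then obtain j where b: "b = axis j 1" by (auto simp: Basis_vec_def)
  have "(\<lambda>z. transition c d z $ j) differentiable (at y)"
    by (rule Ck_on_differentiable[OF transition_smooth[of "Suc 0"] overlap_open assms])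
  from has_derivative_partial[OF this]
  show "((\<lambda>x. transition c d x \<bullet> b) has_derivative
     (\<lambda>x. (\<chi> j. \<Sum>i\<in>UNIV. x $ i * partial i (\<lambda>z. transition c d z $ j) y) \<bullet> b)) (at y)"
    by (simp add: b inner_axis)
qed

lemma jacobian_transition:
  assumes "y \<in> overlap c d"
  shows "jacobian (transition c d) (at y) *v v = (\<chi> j. \<Sum>i\<in>UNIV. v $ i * partial i (\<lambda>z. transition c d z $ j) y)"
proof -
  have "(transition c d has_derivative (\<lambda>h. jacobian (transition c d) (at y) *v h)) (at y)"
    using transition_derivative[OF assms] by (simp add: jacobian_works[symmetric] differentiable_def) blast
  from has_derivative_unique[OF this transition_derivative[OF assms]] show ?thesis by metis
qed

text \<open>Formulated within \<open>T\<close>, so that one-sided derivatives at the ends of a piece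
  are covered too.\<close>

lemma chain_transition:
  assumes t: "t \<in> T" "\<gamma> t \<in> fst c" "\<gamma> t \<in> fst d" and cont: "continuous (at t within T) \<gamma>"
    and D: "((snd c \<circ> \<gamma>) has_vector_derivative D) (at t within T)"
  shows "((snd d \<circ> \<gamma>) has_vector_derivative jacobian (transition c d) (at (snd c (\<gamma> t))) *v D) (at t within T)"
proof -
  let ?J = "jacobian (transition c d) (at (snd c (\<gamma> t)))"
  have y: "snd c (\<gamma> t) \<in> overlap c d" using t by (auto simp: overlap_def)
  have "(transition c d has_derivative (\<lambda>v. ?J *v v)) (at (snd c (\<gamma> t)))"
    using transition_derivative[OF y] by (simp add: jacobian_transition[OF y])
  then have "(transition c d has_derivative (\<lambda>v. ?J *v v)) (at ((snd c \<circ> \<gamma>) t) within (snd c \<circ> \<gamma>) ` T)"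
    by (simp add: has_derivative_at_withinI)
  from diff_chain_within[OF D[unfolded has_vector_derivative_def] this]
  have "((transition c d \<circ> (snd c \<circ> \<gamma>)) has_derivative (\<lambda>x. x *\<^sub>R (?J *v D))) (at t within T)"
    by (simp add: o_def matrix_vector_mult_scaleR)
  moreover have "\<forall>\<^sub>F s in at t within T. (transition c d \<circ> (snd c \<circ> \<gamma>)) s = (snd d \<circ> \<gamma>) s"
  proof -
    have "\<forall>\<^sub>F s in at t within T. \<gamma> s \<in> fst c"
      using cont chart_open(1)[OF c] t(2) unfolding continuous_within by (rule topological_tendstoD)
    then show ?thesis by eventually_elim (simp add: transition_def chart_left[OF c])
  qed
  ultimately show ?thesis
    unfolding has_vector_derivative_def
    by (rule has_derivative_transform_eventually) (use t in \<open>auto simp: transition_def chart_left[OF c]\<close>)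
qed

text \<open>The transformation law read as invariance of squared length: the Jacobian takes
  components in \<open>c\<close> to components in \<open>d\<close>.\<close>

lemma g_transition:
  assumes "p \<in> fst c" "p \<in> fst d"
  shows "(jacobian (transition c d) (at (snd c p)) *v v) \<bullet> (g d p *v (jacobian (transition c d) (at (snd c p)) *v v))
     = v \<bullet> (g c p *v v)"
proof -
  let ?J = "jacobian (transition c d) (at (snd c p))"
  have "g c p = transpose ?J ** g d p ** ?J"
    using metric c d assms unfolding riemannian_metric_def transition_def Let_def by blast
  then have "g c p *v v = transpose ?J *v (g d p *v (?J *v v))"
    by (simp add: matrix_vector_mul_assoc matrix_mul_assoc)
  then have "v \<bullet> (g c p *v v) = ((g d p *v (?J *v v)) v* ?J) \<bullet> v"
    by (simp only: transpose_matrix_vector inner_commute)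
  then have "v \<bullet> (g c p *v v) = (g d p *v (?J *v v)) \<bullet> (?J *v v)"
    by (simp only: dot_lmul_matrix)
  then show ?thesis by (simp only: inner_commute)
qed

end

text \<open>\<open>speed\<close> uses a chart picked by choice; velocity and metric components
  transform in opposite ways, so any chart around the point computes the same value.\<close>

lemma speed_eq:
  assumes c: "c \<in> A" "\<gamma> t \<in> fst c" and cont: "isCont \<gamma> t"
    and D: "((snd c \<circ> \<gamma>) has_vector_derivative D) (at t)"
  shows "speed A g \<gamma> t = sqrt (D \<bullet> (g c (\<gamma> t) *v D))"
proof -
  define d where "d = (SOME d. d \<in> A \<and> \<gamma> t \<in> fst d)"
  have "d \<in> A \<and> \<gamma> t \<in> fst d" unfolding d_def by (rule someI_ex) (use c in blast)
  then have d: "d \<in> A" "\<gamma> t \<in> fst d" by auto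
  have "vector_derivative (snd d \<circ> \<gamma>) (at t) = jacobian (transition c d) (at (snd c (\<gamma> t))) *v D"
    by (rule vector_derivative_at, rule chain_transition) (use c d cont D in auto)
  then show ?thesis
    unfolding speed_def d_def[symmetric] Let_def using g_transition[OF c(1) d(1) c(2) d(2)] by simp
qed

lemma speed_nonneg: "0 \<le> speed A g \<gamma> t"
proof -
  define d where "d = (SOME d. d \<in> A \<and> \<gamma> t \<in> fst d)"
  have "d \<in> A \<and> \<gamma> t \<in> fst d" unfolding d_def by (rule someI_ex) (use cover in blast)
  then show ?thesis unfolding speed_def d_def[symmetric] Let_def by (simp add: g_nonneg)
qed

section \<open>Integrability of the speed along piecewise C^1 curves\<close>

lemma C1_curve_subset: "C1_curve_on A \<gamma> T \<Longrightarrow> T' \<subseteq> T \<Longrightarrow> C1_curve_on A \<gamma> T'"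
  unfolding C1_curve_on_def
  by (smt (verit) continuous_on_subset has_vector_derivative_within_subset mem_Collect_eq subset_eq)

lemma C1_curveE:
  assumes "C1_curve_on A \<gamma> T" "c \<in> A"
  obtains D where "continuous_on {t\<in>T. \<gamma> t \<in> fst c} D"
    "\<And>t. t \<in> T \<Longrightarrow> \<gamma> t \<in> fst c \<Longrightarrow> ((snd c \<circ> \<gamma>) has_vector_derivative D t) (at t within T)"
proof -
  from bspec[OF assms(1)[unfolded C1_curve_on_def, THEN conjunct2] assms(2)] show thesis
    by (elim exE conjE) (rule that, assumption, drule bspec, assumption, drule mp, assumption+)
qed

lemma C1_curve_regular:
  assumes C: "C1_curve_on A \<gamma> {a..b}" and t: "t \<in> {a<..<b}"
  shows "isCont \<gamma> t" "c \<in> A \<Longrightarrow> \<gamma> t \<in> fst c \<Longrightarrow> \<exists>D. ((snd c \<circ> \<gamma>) has_vector_derivative D) (at t)"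
proof -
  have at: "at t within {a..b} = at t" using t by (intro at_within_interior) auto
  have t': "t \<in> {a..b}" using t by auto
  show "isCont \<gamma> t"
    using C t' unfolding C1_curve_on_def continuous_on_eq_continuous_within at[symmetric] by blast
  show "\<exists>D. ((snd c \<circ> \<gamma>) has_vector_derivative D) (at t)" if "c \<in> A" "\<gamma> t \<in> fst c"
    using C t' that unfolding C1_curve_on_def at[symmetric] by metis
qed

text \<open>The derivatives within the interval define a continuous function \<open>s\<close> on all
  of it. The speed equals \<open>s\<close> except possibly at the two ends, where the two-sided
  \<open>vector_derivative\<close> is not under control.\<close>

lemma speed_integrable_C1:
  assumes ab: "a < b" and C: "C1_curve_on A \<gamma> {a..b}"
  shows "speed A g \<gamma> integrable_on {a..b}"
proof -
  have contg: "continuous_on {a..b} \<gamma>" using C by (simp add: C1_curve_on_def)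
  have "\<forall>c\<in>A. \<exists>D. continuous_on {t\<in>{a..b}. \<gamma> t \<in> fst c} D \<and>
        (\<forall>t\<in>{a..b}. \<gamma> t \<in> fst c \<longrightarrow> ((snd c \<circ> \<gamma>) has_vector_derivative D t) (at t within {a..b}))"
    by (rule C[unfolded C1_curve_on_def, THEN conjunct2])
  from bchoice[OF this] obtain D where DD: "\<forall>c\<in>A. continuous_on {t\<in>{a..b}. \<gamma> t \<in> fst c} (D c) \<and>
        (\<forall>t\<in>{a..b}. \<gamma> t \<in> fst c \<longrightarrow> ((snd c \<circ> \<gamma>) has_vector_derivative D c t) (at t within {a..b}))"
    by (elim exE)
  have Dc: "\<And>c. c \<in> A \<Longrightarrow> continuous_on {t\<in>{a..b}. \<gamma> t \<in> fst c} (D c)"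
    and D: "\<And>c t. c \<in> A \<Longrightarrow> t \<in> {a..b} \<Longrightarrow> \<gamma> t \<in> fst c \<Longrightarrow>
        ((snd c \<circ> \<gamma>) has_vector_derivative D c t) (at t within {a..b})"
    using DD by blast+
  define \<sigma> where "\<sigma> c t = sqrt (D c t \<bullet> (g c (\<gamma> t) *v D c t))" for c t
  have \<sigma>_indep: "\<sigma> c t = \<sigma> d t" if "c \<in> A" "d \<in> A" "t \<in> {a..b}" "\<gamma> t \<in> fst c" "\<gamma> t \<in> fst d" for c d t
  proof -
    have "((snd d \<circ> \<gamma>) has_vector_derivative jacobian (transition c d) (at (snd c (\<gamma> t))) *v D c t) (at t within {a..b})"
      using contg that by (intro chain_transition D) (auto simp: continuous_on_eq_continuous_within)
    then have "jacobian (transition c d) (at (snd c (\<gamma> t))) *v D c t = D d t"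
      using vector_derivative_unique_within[of t "{a..b}" "snd d \<circ> \<gamma>"] D[OF that(2,3,5)] that(3) ab
      by (metis trivial_limit_within islimpt_Icc atLeastAtMost_iff)
    then show ?thesis
      using g_transition[OF that(1,2,4,5), of "D c t"] by (simp add: \<sigma>_def)
  qed
  define s where "s t = \<sigma> (SOME c. c \<in> A \<and> \<gamma> t \<in> fst c) t" for t
  have s: "s t = \<sigma> c t" if "c \<in> A" "t \<in> {a..b}" "\<gamma> t \<in> fst c" for c t
  proof -
    have "(SOME c. c \<in> A \<and> \<gamma> t \<in> fst c) \<in> A \<and> \<gamma> t \<in> fst (SOME c. c \<in> A \<and> \<gamma> t \<in> fst c)"
      by (rule someI_ex) (use that in blast)
    then show ?thesis unfolding s_def using \<sigma>_indep that by blast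
  qed
  have "continuous_on {a..b} s"
    unfolding continuous_on_eq_continuous_within
  proof
    fix t assume t: "t \<in> {a..b}"
    obtain c where c: "c \<in> A" "\<gamma> t \<in> fst c" using cover by blast
    define N where "N = {t\<in>{a..b}. \<gamma> t \<in> fst c}"
    have "N \<subseteq> {a..b}" by (auto simp: N_def)
    then have "continuous_on N (\<lambda>t. g c (\<gamma> t) $ i $ j)" for i j
      using continuous_on_compose[OF continuous_on_subset[OF contg, of N] continuous_on_subset[OF g_cont[OF c(1), of i j]]]
      by (auto simp: N_def o_def image_subset_iff)
    then have "continuous_on N (\<lambda>t. \<chi> i j. g c (\<gamma> t) $ i $ j)"
      by (intro continuous_on_vec_lambda)
    then have "continuous_on N (\<lambda>t. g c (\<gamma> t))" by simp
    then have "continuous_on N (\<sigma> c)"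
      unfolding \<sigma>_def quadratic_form_sum
      using Dc[OF c(1)] by (auto intro!: continuous_intros simp: N_def)
    then have "continuous_on N s"
      by (rule continuous_on_eq) (use s c in \<open>auto simp: N_def\<close>)
    then have "continuous (at t within N) s"
      using t c by (auto simp: continuous_on_eq_continuous_within N_def)
    \<comment> \<open>\<open>N\<close> is relatively open in the interval, so continuity within
      \<open>N\<close> at one of its points is continuity within the interval.\<close>
    moreover have "at t within N = at t within {a..b}"
    proof -
      obtain W where W: "open W" "N = W \<inter> {a..b}"
      proof -
        have "openin (top_of_set {a..b}) ({a..b} \<inter> \<gamma> -` fst c)"
          using continuous_openin_preimage_gen[OF contg chart_open(1)[OF c(1)]] .
        moreover have "{a..b} \<inter> \<gamma> -` fst c = N" by (auto simp: N_def)
        ultimately show thesis using that by (auto simp: openin_open Int_commute)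
      qed
      moreover have "t \<in> W" using W t c by (auto simp: N_def)
      ultimately show ?thesis
        by (intro at_within_nhd[of t W]) (auto simp: Int_commute)
    qed
    ultimately show "continuous (at t within {a..b}) s" by simp
  qed
  then have "s integrable_on {a..b}" by (rule integrable_continuous_real)
  then show ?thesis
  proof (rule integrable_spike_finite[where S = "{a, b}", rotated 2])
    fix t assume t: "t \<in> {a..b} - {a, b}"
    obtain c where c: "c \<in> A" "\<gamma> t \<in> fst c" using cover by blast
    have at: "at t within {a..b} = at t" using t by (intro at_within_interior) auto
    have "speed A g \<gamma> t = \<sigma> c t"
      unfolding \<sigma>_def
      using D[OF c(1) _ c(2)] C1_curve_regular(1)[OF C] t c by (intro speed_eq) (auto simp: at)
    then show "speed A g \<gamma> t = s t" using s c t by auto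
  qed auto
qed

text \<open>Arbitrary parameter intervals allow paths to be cut, joined and reparametrised; the unit
  interval gives \<open>piecewise_C1_path\<close>.\<close>

definition pw :: "real \<Rightarrow> real \<Rightarrow> (real \<Rightarrow> 'm) \<Rightarrow> bool" where
  "pw a b \<gamma> \<longleftrightarrow> continuous_on {a..b} \<gamma> \<and>
     (\<exists>S. finite S \<and> (\<forall>c d. a \<le> c \<and> c < d \<and> d \<le> b \<and> {c<..<d} \<inter> S = {} \<longrightarrow> C1_curve_on A \<gamma> {c..d}))"

lemma piecewise_C1_path_pw: "piecewise_C1_path A \<gamma> \<longleftrightarrow> pw 0 1 \<gamma>"
  by (simp add: piecewise_C1_path_def pw_def path_def)

lemma pw_subset:
  assumes "pw a b \<gamma>" "a \<le> c" "d \<le> b" shows "pw c d \<gamma>"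
proof -
  obtain S where "finite S" "\<And>c d. a \<le> c \<Longrightarrow> c < d \<Longrightarrow> d \<le> b \<Longrightarrow> {c<..<d} \<inter> S = {} \<Longrightarrow> C1_curve_on A \<gamma> {c..d}"
    using assms(1) unfolding pw_def by blast
  moreover have "continuous_on {c..d} \<gamma>"
    using assms unfolding pw_def by (auto intro: continuous_on_subset)
  ultimately show ?thesis unfolding pw_def using assms(2,3) by (meson order_trans)
qed

lemma C1_imp_pw: "C1_curve_on A \<gamma> {a..b} \<Longrightarrow> pw a b \<gamma>"
  using C1_curve_subset[of \<gamma> "{a..b}"] unfolding pw_def
  by (intro conjI exI[of _ "{}"]) (auto simp: C1_curve_on_def[of A \<gamma> "{a..b}"])

lemma pw_join:
  assumes "pw a b \<gamma>" "pw b c \<gamma>" "a \<le> b" "b \<le> c" shows "pw a c \<gamma>"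
proof -
  obtain S where S: "finite S" "\<And>c d. a \<le> c \<Longrightarrow> c < d \<Longrightarrow> d \<le> b \<Longrightarrow> {c<..<d} \<inter> S = {} \<Longrightarrow> C1_curve_on A \<gamma> {c..d}"
    using assms(1) unfolding pw_def by blast
  obtain S' where S': "finite S'" "\<And>a d. b \<le> a \<Longrightarrow> a < d \<Longrightarrow> d \<le> c \<Longrightarrow> {a<..<d} \<inter> S' = {} \<Longrightarrow> C1_curve_on A \<gamma> {a..d}"
    using assms(2) unfolding pw_def by blast
  have "continuous_on ({a..b} \<union> {b..c}) \<gamma>"
    using assms unfolding pw_def by (intro continuous_on_closed_Un) auto
  moreover have "{a..b} \<union> {b..c} = {a..c}" using assms by (simp add: ivl_disj_un_two_touch)
  moreover have "C1_curve_on A \<gamma> {x..y}" if "a \<le> x" "x < y" "y \<le> c" "{x<..<y} \<inter> (S \<union> S' \<union> {b}) = {}" for x y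
  proof -
    have "y \<le> b \<or> b \<le> x" using that by auto
    then show ?thesis using S(2)[of x y] S'(2)[of x y] that by blast
  qed
  ultimately show ?thesis
    unfolding pw_def using S(1) S'(1) by (intro conjI exI[of _ "S \<union> S' \<union> {b}"]) auto
qed

lemma C1_curve_cong:
  assumes "C1_curve_on A \<gamma> T" "\<And>t. t \<in> T \<Longrightarrow> \<gamma> t = \<delta> t"
  shows "C1_curve_on A \<delta> T"
proof -
  have D: "((snd c \<circ> \<delta>) has_vector_derivative D) (at t within T)"
    if "((snd c \<circ> \<gamma>) has_vector_derivative D) (at t within T)" "t \<in> T" for c D t
    by (rule has_vector_derivative_transform[OF that(2) _ that(1)]) (simp add: assms(2))
  have eq: "{t \<in> T. \<delta> t \<in> U} = {t \<in> T. \<gamma> t \<in> U}" for U using assms(2) by auto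
  have "continuous_on T \<delta>"
    using assms unfolding C1_curve_on_def by (metis continuous_on_eq)
  moreover have "\<exists>D. continuous_on {t\<in>T. \<delta> t \<in> fst c} D \<and>
      (\<forall>t\<in>T. \<delta> t \<in> fst c \<longrightarrow> ((snd c \<circ> \<delta>) has_vector_derivative D t) (at t within T))" if cA: "c \<in> A" for c
  proof -
    obtain E where E: "continuous_on {t\<in>T. \<gamma> t \<in> fst c} E"
      "\<And>t. t \<in> T \<Longrightarrow> \<gamma> t \<in> fst c \<Longrightarrow> ((snd c \<circ> \<gamma>) has_vector_derivative E t) (at t within T)"
      by (rule C1_curveE[OF assms(1) cA]) (rule that)
    show ?thesis
    proof (intro exI conjI ballI impI)
      show "continuous_on {t\<in>T. \<delta> t \<in> fst c} E" unfolding eq by (rule E(1))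
      fix t assume t: "t \<in> T" "\<delta> t \<in> fst c"
      then have "\<gamma> t \<in> fst c" by (simp add: assms(2))
      then show "((snd c \<circ> \<delta>) has_vector_derivative E t) (at t within T)"
        using D E(2) t(1) by blast
    qed
  qed
  ultimately show ?thesis unfolding C1_curve_on_def by blast
qed

lemma pw_cong:
  assumes "pw a b \<gamma>" "\<And>t. t \<in> {a..b} \<Longrightarrow> \<gamma> t = \<delta> t"
  shows "pw a b \<delta>"
proof -
  obtain S where S: "finite S" "\<And>c d. a \<le> c \<Longrightarrow> c < d \<Longrightarrow> d \<le> b \<Longrightarrow> {c<..<d} \<inter> S = {} \<Longrightarrow> C1_curve_on A \<gamma> {c..d}"
    using assms(1) unfolding pw_def by blast
  have "continuous_on {a..b} \<delta>" using assms unfolding pw_def by (metis continuous_on_eq)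
  moreover have "C1_curve_on A \<delta> {c..d}" if "a \<le> c \<and> c < d \<and> d \<le> b \<and> {c<..<d} \<inter> S = {}" for c d
    by (rule C1_curve_cong[OF S(2)[of c d]]) (use that assms(2) in auto)
  ultimately show ?thesis unfolding pw_def using S(1) by blast
qed

lemma C1_curve_affine:
  assumes C: "C1_curve_on A \<gamma> T" and sub: "(\<lambda>t. m * t + k) ` T' \<subseteq> T"
  shows "C1_curve_on A (\<gamma> \<circ> (\<lambda>t. m * t + k)) T'"
  unfolding C1_curve_on_def
proof (intro conjI ballI)
  let ?\<phi> = "\<lambda>t. m * t + k"
  have "continuous_on T' ?\<phi>" by (intro continuous_intros)
  then show "continuous_on T' (\<gamma> \<circ> ?\<phi>)"
    using C sub unfolding C1_curve_on_def by (intro continuous_on_compose) (auto intro: continuous_on_subset)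
  fix c assume c: "c \<in> A"
  obtain D where D: "continuous_on {t\<in>T. \<gamma> t \<in> fst c} D"
     "\<And>t. t \<in> T \<Longrightarrow> \<gamma> t \<in> fst c \<Longrightarrow> ((snd c \<circ> \<gamma>) has_vector_derivative D t) (at t within T)"
    by (rule C1_curveE[OF C c]) (rule that)
  show "\<exists>D. continuous_on {t \<in> T'. (\<gamma> \<circ> ?\<phi>) t \<in> fst c} D \<and>
     (\<forall>t\<in>T'. (\<gamma> \<circ> ?\<phi>) t \<in> fst c \<longrightarrow> ((snd c \<circ> (\<gamma> \<circ> ?\<phi>)) has_vector_derivative D t) (at t within T'))"
  proof (intro exI conjI ballI impI)
    have "continuous_on {t \<in> T'. (\<gamma> \<circ> ?\<phi>) t \<in> fst c} (D \<circ> ?\<phi>)"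
      by (intro continuous_on_compose continuous_intros continuous_on_subset[OF D(1)]) (use sub in auto)
    then show "continuous_on {t \<in> T'. (\<gamma> \<circ> ?\<phi>) t \<in> fst c} (\<lambda>t. m *\<^sub>R D (?\<phi> t))"
      by (auto intro!: continuous_intros simp: o_def)
    fix t assume t: "t \<in> T'" "(\<gamma> \<circ> ?\<phi>) t \<in> fst c"
    have "(?\<phi> has_vector_derivative m) (at t within T')"
      by (auto intro!: derivative_eq_intros simp: has_vector_derivative_def)
    moreover have "((snd c \<circ> \<gamma>) has_vector_derivative D (?\<phi> t)) (at (?\<phi> t) within ?\<phi> ` T')"
      by (rule has_vector_derivative_within_subset[OF D(2) sub]) (use t sub in auto)
    ultimately show "((snd c \<circ> (\<gamma> \<circ> ?\<phi>)) has_vector_derivative m *\<^sub>R D (?\<phi> t)) (at t within T')"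
      using vector_diff_chain_within[of ?\<phi> m t T' "snd c \<circ> \<gamma>"] by (simp add: o_assoc)
  qed
qed

lemma speed_integrable:
  assumes "pw a b \<gamma>" shows "speed A g \<gamma> integrable_on {a..b}"
proof (cases "a < b")
  case True
  obtain S where S: "finite S" "\<And>c d. a \<le> c \<Longrightarrow> c < d \<Longrightarrow> d \<le> b \<Longrightarrow> {c<..<d} \<inter> S = {} \<Longrightarrow> C1_curve_on A \<gamma> {c..d}"
    using assms(1) unfolding pw_def by blast
  from S(1) True show ?thesis
  proof (induction rule: breakpoint_induct)
    case (piece c d)
    then show ?case by (intro speed_integrable_C1 S(2))
  next
    case (join c d e)
    then show ?case using Henstock_Kurzweil_Integration.integrable_combine[where a = c and c = d and b = e] by auto
  qed
next
  case False
  then show ?thesis using integrable_on_refl[of "speed A g \<gamma>" b] by (cases "a = b") (auto intro: integrable_on_empty)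
qed

lemma pw_regular:
  assumes "pw a b \<gamma>"
  obtains S where "finite S" "\<And>t. t \<in> {a<..<b} - S \<Longrightarrow> isCont \<gamma> t"
    "\<And>t c. t \<in> {a<..<b} - S \<Longrightarrow> c \<in> A \<Longrightarrow> \<gamma> t \<in> fst c \<Longrightarrow> \<exists>D. ((snd c \<circ> \<gamma>) has_vector_derivative D) (at t)"
proof -
  obtain S where S: "finite S" "\<And>c d. a \<le> c \<Longrightarrow> c < d \<Longrightarrow> d \<le> b \<Longrightarrow> {c<..<d} \<inter> S = {} \<Longrightarrow> C1_curve_on A \<gamma> {c..d}"
    using assms(1) unfolding pw_def by blast
  have "\<exists>c d. C1_curve_on A \<gamma> {c..d} \<and> t \<in> {c<..<d}" if t: "t \<in> {a<..<b} - S" for t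
  proof -
    obtain e where e: "e > 0" "\<And>x. x \<in> S \<Longrightarrow> x \<noteq> t \<Longrightarrow> e \<le> dist t x"
      using finite_set_avoid[OF S(1), of t] by blast
    \<comment> \<open>A piece around \<open>t\<close> that reaches no further than the nearest other
      break point.\<close>
    define c d where "c = max a (t - e)" and "d = min b (t + e)"
    have "{c<..<d} \<inter> S = {}"
    proof -
      have False if "x \<in> S" "c < x" "x < d" for x
      proof -
        have "x \<noteq> t" using that(1) t by auto
        then have "e \<le> \<bar>t - x\<bar>" using e(2)[OF that(1)] by (simp add: dist_real_def)
        then show False using that(2,3) by (auto simp: c_def d_def abs_if split: if_splits)
      qed
      then show ?thesis by auto
    qed
    then have "C1_curve_on A \<gamma> {c..d}" using t e(1) by (intro S(2)) (auto simp: c_def d_def)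
    moreover have "t \<in> {c<..<d}" using t e(1) by (auto simp: c_def d_def)
    ultimately show ?thesis by blast
  qed
  then show thesis using that[OF S(1)] C1_curve_regular by meson
qed

lemma speed_affine:
  assumes "isCont \<gamma> (m * t + k)"
    and "\<And>c. c \<in> A \<Longrightarrow> \<gamma> (m * t + k) \<in> fst c \<Longrightarrow> \<exists>D. ((snd c \<circ> \<gamma>) has_vector_derivative D) (at (m * t + k))"
  shows "speed A g (\<gamma> \<circ> (\<lambda>t. m * t + k)) t = \<bar>m\<bar> * speed A g \<gamma> (m * t + k)"
proof -
  let ?\<phi> = "\<lambda>t. m * t + k"
  obtain c where c: "c \<in> A" "\<gamma> (?\<phi> t) \<in> fst c" using cover by blast
  obtain D where D: "((snd c \<circ> \<gamma>) has_vector_derivative D) (at (?\<phi> t))" using assms(2)[OF c] by blast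
  have "(?\<phi> has_vector_derivative m) (at t)"
    by (auto intro!: derivative_eq_intros simp: has_vector_derivative_def)
  from vector_diff_chain_at[OF this D]
  have "((snd c \<circ> (\<gamma> \<circ> ?\<phi>)) has_vector_derivative m *\<^sub>R D) (at t)" by (simp only: o_assoc)
  moreover have "isCont (\<gamma> \<circ> ?\<phi>) t"
    by (rule continuous_at_compose) (use assms(1) in \<open>auto intro!: continuous_intros\<close>)
  ultimately have "speed A g (\<gamma> \<circ> ?\<phi>) t = sqrt ((m *\<^sub>R D) \<bullet> (g c (\<gamma> (?\<phi> t)) *v (m *\<^sub>R D)))"
    using speed_eq[OF c(1), of "\<gamma> \<circ> ?\<phi>" t] c(2) by simp
  also have "\<dots> = \<bar>m\<bar> * sqrt (D \<bullet> (g c (\<gamma> (?\<phi> t)) *v D))"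
    by (simp add: matrix_vector_mult_scaleR mult.assoc[symmetric] real_sqrt_mult)
  also have "\<dots> = \<bar>m\<bar> * speed A g \<gamma> (?\<phi> t)"
    using speed_eq[OF c assms(1) D] by simp
  finally show ?thesis .
qed

text \<open>The slope may be negative, so that normalisation, shift and reversal are instances of
  one statement. The factor \<open>\<bar>m\<bar>\<close> of the speed cancels the one from the
  substitution in the integral.\<close>

lemma pw_affine:
  assumes pw: "pw a b \<gamma>" and m: "m \<noteq> 0" and im: "(\<lambda>t. m * t + k) ` {a'..b'} = {a..b}"
  shows "pw a' b' (\<gamma> \<circ> (\<lambda>t. m * t + k))"
    "integral {a'..b'} (speed A g (\<gamma> \<circ> (\<lambda>t. m * t + k))) = integral {a..b} (speed A g \<gamma>)"
proof -
  let ?\<phi> = "\<lambda>t. m * t + k"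
  have inj: "inj ?\<phi>" using m by (auto simp: inj_on_def)
  have vim: "{a'..b'} = (\<lambda>x. (1 / m) *\<^sub>R x + - ((1 / m) *\<^sub>R k)) ` {a..b}"
  proof -
    have "(1 / m) *\<^sub>R (?\<phi> t) + - ((1 / m) *\<^sub>R k) = t" for t using m by (simp add: field_simps)
    then show ?thesis unfolding im[symmetric] image_image by simp
  qed
  obtain S where S: "finite S" "\<And>c d. a \<le> c \<Longrightarrow> c < d \<Longrightarrow> d \<le> b \<Longrightarrow> {c<..<d} \<inter> S = {} \<Longrightarrow> C1_curve_on A \<gamma> {c..d}"
    using pw unfolding pw_def by blast
  show "pw a' b' (\<gamma> \<circ> ?\<phi>)"
    unfolding pw_def
  proof (intro conjI exI allI impI)
    show "continuous_on {a'..b'} (\<gamma> \<circ> ?\<phi>)"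
      using pw unfolding pw_def by (intro continuous_on_compose continuous_intros) (simp add: im)
    show "finite (?\<phi> -` S)" by (rule finite_vimageI[OF S(1) inj])
    fix c d assume cd: "a' \<le> c \<and> c < d \<and> d \<le> b' \<and> {c<..<d} \<inter> ?\<phi> -` S = {}"
    \<comment> \<open>\<open>min\<close> and \<open>max\<close> because a negative slope swaps the
      end points.\<close>
    define x y where "x = min (?\<phi> c) (?\<phi> d)" and "y = max (?\<phi> c) (?\<phi> d)"
    have "c \<in> {a'..b'}" "d \<in> {a'..b'}" using cd by auto
    then have in_ab: "?\<phi> c \<in> {a..b}" "?\<phi> d \<in> {a..b}" unfolding im[symmetric] by auto
    have "?\<phi> c \<noteq> ?\<phi> d" using m cd by auto
    then have "x < y" unfolding x_def y_def by linarith
    have between: "?\<phi> t \<in> {x..y}" if "t \<in> {c..d}" for t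
      using that m by (cases "m > 0") (auto simp: x_def y_def min_def max_def mult_left_mono mult_left_mono_neg)
    have "C1_curve_on A \<gamma> {x..y}"
    proof (rule S(2))
      show "{x<..<y} \<inter> S = {}"
      proof -
        have False if z: "z \<in> S" "x < z" "z < y" for z
        proof -
          define t where "t = (z - k) / m"
          have zt: "?\<phi> t = z" using m by (simp add: t_def)
          have "c < t \<and> t < d"
            using z(2,3) m cd unfolding zt[symmetric] x_def y_def
            by (cases "m > 0") (auto simp: min_def max_def split: if_splits)
          then show False using cd z zt by auto
        qed
        then show ?thesis by auto
      qed
    qed (use in_ab \<open>x < y\<close> in \<open>auto simp: x_def y_def\<close>)
    then show "C1_curve_on A (\<gamma> \<circ> ?\<phi>) {c..d}"
      by (rule C1_curve_affine) (use between in auto)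
  qed
  obtain R where R: "finite R" "\<And>t. t \<in> {a<..<b} - R \<Longrightarrow> isCont \<gamma> t"
    "\<And>t c. t \<in> {a<..<b} - R \<Longrightarrow> c \<in> A \<Longrightarrow> \<gamma> t \<in> fst c \<Longrightarrow> \<exists>D. ((snd c \<circ> \<gamma>) has_vector_derivative D) (at t)"
    using pw_regular[OF pw] by blast
  have "((\<lambda>t. speed A g \<gamma> (m *\<^sub>R t + k)) has_integral (1 / \<bar>m\<bar> ^ DIM(real)) *\<^sub>R integral {a..b} (speed A g \<gamma>)) {a'..b'}"
    unfolding vim
    using has_integral_affinity[of "speed A g \<gamma>" _ a b m k] speed_integrable[OF pw] m by (simp add: has_integral_integral)
  then have "((\<lambda>t. \<bar>m\<bar> * speed A g \<gamma> (?\<phi> t)) has_integral \<bar>m\<bar> * ((1 / \<bar>m\<bar>) * integral {a..b} (speed A g \<gamma>))) {a'..b'}"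
    by (intro has_integral_mult_right) simp
  then have "((\<lambda>t. \<bar>m\<bar> * speed A g \<gamma> (?\<phi> t)) has_integral integral {a..b} (speed A g \<gamma>)) {a'..b'}"
    using m by simp
  then have "((speed A g (\<gamma> \<circ> ?\<phi>)) has_integral integral {a..b} (speed A g \<gamma>)) {a'..b'}"
  proof (rule has_integral_spike_finite[rotated 2])
    show "finite (?\<phi> -` (R \<union> {a, b}))" by (rule finite_vimageI[OF _ inj]) (use R(1) in simp)
    fix t assume t: "t \<in> {a'..b'} - ?\<phi> -` (R \<union> {a, b})"
    then have "?\<phi> t \<in> {a..b}" unfolding im[symmetric] by auto
    then have "?\<phi> t \<in> {a<..<b} - R" using t by auto
    then show "speed A g (\<gamma> \<circ> ?\<phi>) t = \<bar>m\<bar> * speed A g \<gamma> (?\<phi> t)"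
      using R by (intro speed_affine) auto
  qed
  then show "integral {a'..b'} (speed A g (\<gamma> \<circ> ?\<phi>)) = integral {a..b} (speed A g \<gamma>)"
    by (rule integral_unique)
qed

text \<open>Inside the interval the curves agree near \<open>t\<close>, hence have the same
  derivative; at the end points they may separate, but two points do not affect the
  integral.\<close>

lemma length_cong:
  assumes "\<And>t. t \<in> {a..b} \<Longrightarrow> \<gamma> t = \<delta> t"
  shows "integral {a..b} (speed A g \<gamma>) = integral {a..b} (speed A g \<delta>)"
proof (rule integral_spike[of "{a, b}"])
  fix t assume t: "t \<in> {a..b} - {a, b}"
  have ev: "\<forall>\<^sub>F s in nhds t. \<gamma> s = \<delta> s"
    using t assms by (intro eventually_nhds_in_open[of "{a<..<b}" t, THEN eventually_mono]) auto
  have "vector_derivative (snd c \<circ> \<gamma>) (at t) = vector_derivative (snd c \<circ> \<delta>) (at t)" for c :: "('m, 'n) chart"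
    by (rule vector_derivative_cong_eq) (use ev in \<open>auto elim: eventually_mono\<close>)
  moreover have "\<gamma> t = \<delta> t" using t assms by auto
  ultimately show "speed A g \<delta> t = speed A g \<gamma> t" by (simp add: speed_def)
qed auto

text \<open>Holds for every \<open>\<gamma>\<close>: a speed that is not integrable has integral 0
  by convention.\<close>

lemma length_nonneg: "0 \<le> integral {a..b} (speed A g \<gamma>)"
  by (cases "speed A g \<gamma> integrable_on {a..b}")
     (auto intro: integral_nonneg speed_nonneg simp: not_integrable_integral)

section \<open>Curves on the unit interval, and curves inside a chart\<close>

definition curve :: "'m \<Rightarrow> 'm \<Rightarrow> (real \<Rightarrow> 'm) \<Rightarrow> bool" where
  "curve p q \<gamma> \<longleftrightarrow> pw 0 1 \<gamma> \<and> \<gamma> 0 = p \<and> \<gamma> 1 = q"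

lemma curve_normalize:
  assumes "pw a b \<gamma>" "a < b"
  shows "\<exists>\<delta>. curve (\<gamma> a) (\<gamma> b) \<delta> \<and> curve_length A g \<delta> = integral {a..b} (speed A g \<gamma>)"
proof -
  have "(\<lambda>t. (b - a) * t + a) ` {0..1} = {a..b}"
    using assms(2) by (simp add: image_affinity_atLeastAtMost)
  from pw_affine[OF assms(1) _ this] assms(2) show ?thesis
    by (intro exI[of _ "\<gamma> \<circ> (\<lambda>t. (b - a) * t + a)"]) (simp add: curve_def curve_length_def)
qed

lemma curve_reverse:
  assumes "curve p q \<gamma>"
  shows "\<exists>\<delta>. curve q p \<delta> \<and> curve_length A g \<delta> = curve_length A g \<gamma>"
proof -
  have "(\<lambda>t. (- 1) * t + 1) ` {0..1} = {0..1 :: real}"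
    using image_affinity_atLeastAtMost[of "-1" 1 "0::real" 1] by simp
  from pw_affine[OF _ _ this, of \<gamma>] assms show ?thesis
    by (intro exI[of _ "\<gamma> \<circ> (\<lambda>t. (- 1) * t + 1)"]) (simp add: curve_def curve_length_def)
qed

text \<open>The second curve is shifted to \<open>{1..2}\<close>, so both halves keep their speed,
  and the joined curve is scaled to the unit interval only at the end.\<close>

lemma curve_join:
  assumes "curve p q \<gamma>" "curve q r \<delta>"
  shows "\<exists>\<epsilon>. curve p r \<epsilon> \<and> curve_length A g \<epsilon> = curve_length A g \<gamma> + curve_length A g \<delta>"
proof -
  have im: "(\<lambda>t. 1 * t + (- 1)) ` {1..2} = {0..1 :: real}"
    using image_affinity_atLeastAtMost[of 1 "-1" "1::real" 2] by simp
  have \<delta>: "pw 1 2 (\<delta> \<circ> (\<lambda>t. 1 * t + (- 1)))"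
    "integral {1..2} (speed A g (\<delta> \<circ> (\<lambda>t. 1 * t + (- 1)))) = curve_length A g \<delta>"
    using pw_affine[OF _ _ im, of \<delta>] assms(2) by (auto simp: curve_def curve_length_def)
  define \<eta> where "\<eta> t = (if t \<le> 1 then \<gamma> t else \<delta> (1 * t + (- 1)))" for t
  have 1: "\<eta> t = \<gamma> t" if "t \<in> {0..1}" for t using that by (simp add: \<eta>_def)
  have 2: "\<eta> t = (\<delta> \<circ> (\<lambda>t. 1 * t + (- 1))) t" if "t \<in> {1..2}" for t
    using that assms by (cases "t = 1") (auto simp: \<eta>_def curve_def)
  have pw1: "pw 0 1 \<eta>" using assms(1) 1 by (auto simp: curve_def intro: pw_cong)
  have pw2: "pw 1 2 \<eta>" by (rule pw_cong[OF \<delta>(1)]) (use 2 in auto)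
  have pw: "pw 0 2 \<eta>" by (rule pw_join[OF pw1 pw2]) auto
  have "integral {0..2} (speed A g \<eta>) = integral {0..1} (speed A g \<eta>) + integral {1..2} (speed A g \<eta>)"
    by (rule Henstock_Kurzweil_Integration.integral_combine[symmetric]) (auto intro: speed_integrable[OF pw])
  also have "\<dots> = curve_length A g \<gamma> + curve_length A g \<delta>"
  proof -
    have "integral {0..1} (speed A g \<eta>) = curve_length A g \<gamma>"
      unfolding curve_length_def by (rule length_cong[OF 1])
    moreover have "integral {1..2} (speed A g \<eta>) = curve_length A g \<delta>"
      unfolding \<delta>(2)[symmetric] by (rule length_cong[OF 2])
    ultimately show ?thesis by simp
  qed
  finally show ?thesis
    using curve_normalize[OF pw] assms by (simp add: \<eta>_def curve_def)
qed

text \<open>Straight segments of a chart. The work is in \<open>C1_curve_on\<close>, which asks for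
  continuous velocities in every chart of the atlas; these come from the Jacobian of the transition
  map. The speed formula concerns interior parameters because \<open>speed\<close> uses two-sided
  derivatives.\<close>

lemma chart_segment:
  assumes c: "c \<in> A" and B: "convex B" "B \<subseteq> snd c ` fst c" and y: "y0 \<in> B" "y1 \<in> B"
  defines "\<gamma> \<equiv> \<lambda>t. chart_inv c (y0 + t *\<^sub>R (y1 - y0))"
  shows "curve (chart_inv c y0) (chart_inv c y1) \<gamma>"
    and "\<And>t. t \<in> {0<..<1} \<Longrightarrow> y0 + t *\<^sub>R (y1 - y0) \<in> B \<and>
        speed A g \<gamma> t = sqrt ((y1 - y0) \<bullet> (g c (\<gamma> t) *v (y1 - y0)))"
proof -
  let ?l = "\<lambda>t. y0 + t *\<^sub>R (y1 - y0)"
  have lB: "?l t \<in> B" if "t \<in> {0..1}" for t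
    using convexD_alt[OF B(1) y, of t] that by (simp add: algebra_simps)
  have l_deriv: "(?l has_vector_derivative (y1 - y0)) (at t within T)" for t T
    by (auto intro!: derivative_eq_intros simp: has_vector_derivative_def)
  have cont: "continuous_on {0..1} \<gamma>"
  proof -
    have "continuous_on {0..1} (chart_inv c \<circ> ?l)"
      by (intro continuous_on_compose continuous_intros continuous_on_subset[OF chart_cont(2)[OF c]])
         (use lB B in auto)
    then show ?thesis by (simp add: \<gamma>_def o_def)
  qed
  have \<gamma>: "\<gamma> t \<in> fst c" "snd c (\<gamma> t) = ?l t" if "t \<in> {0..1}" for t
    using chart_inv_in[OF c] chart_right[OF c] lB[OF that] B by (auto simp: \<gamma>_def)
  have chart_deriv: "((snd c \<circ> \<gamma>) has_vector_derivative (y1 - y0)) (at t within {0..1})" if "t \<in> {0..1}" for t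
    by (rule has_vector_derivative_transform[OF that _ l_deriv]) (simp add: \<gamma>)
  have "C1_curve_on A \<gamma> {0..1}"
    unfolding C1_curve_on_def
  proof (intro conjI ballI cont)
    fix d assume d: "d \<in> A"
    let ?J = "\<lambda>t. jacobian (transition c d) (at (snd c (\<gamma> t)))"
    show "\<exists>D. continuous_on {t \<in> {0..1}. \<gamma> t \<in> fst d} D \<and>
      (\<forall>t\<in>{0..1}. \<gamma> t \<in> fst d \<longrightarrow> ((snd d \<circ> \<gamma>) has_vector_derivative D t) (at t within {0..1}))"
    proof (intro exI conjI ballI impI)
      fix t :: real assume t: "t \<in> {0..1}" "\<gamma> t \<in> fst d"
      show "((snd d \<circ> \<gamma>) has_vector_derivative ?J t *v (y1 - y0)) (at t within {0..1})"
        by (rule chain_transition[OF c d t(1) \<gamma>(1)[OF t(1)] t(2) _ chart_deriv[OF t(1)]])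
           (use cont t in \<open>auto simp: continuous_on_eq_continuous_within\<close>)
    next
      let ?T = "{t \<in> {0..1}. \<gamma> t \<in> fst d}"
      have ov: "?l t \<in> overlap c d" if "t \<in> ?T" for t
        using that \<gamma>[of t] unfolding overlap_def by (metis (no_types, lifting) IntI image_eqI mem_Collect_eq)
      have "continuous_on ?T (\<lambda>t. partial i (\<lambda>z. transition c d z $ j) (?l t))" for i j
      proof -
        have "continuous_on (overlap c d) (partial i (\<lambda>z. transition c d z $ j))"
          using Ck_on_partial[OF transition_smooth[OF c d, of "Suc 0" j], of i] by simp
        then have "continuous_on (?l ` ?T) (partial i (\<lambda>z. transition c d z $ j))"
          by (rule continuous_on_subset) (use ov in blast)
        moreover have "continuous_on ?T ?l" by (intro continuous_intros)
        ultimately show ?thesis using continuous_on_compose[of ?T ?l] by (simp add: o_def)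
      qed
      then have "continuous_on ?T (\<lambda>t. \<chi> j. \<Sum>i\<in>UNIV. (y1 - y0) $ i * partial i (\<lambda>z. transition c d z $ j) (?l t))"
        by (intro continuous_on_vec_lambda continuous_on_sum continuous_on_mult continuous_on_const)
      then show "continuous_on ?T (\<lambda>t. ?J t *v (y1 - y0))"
      proof (rule continuous_on_eq)
        fix t assume t: "t \<in> ?T"
        then have "snd c (\<gamma> t) = ?l t" by (intro \<gamma>(2)) auto
        then show "(\<chi> j. \<Sum>i\<in>UNIV. (y1 - y0) $ i * partial i (\<lambda>z. transition c d z $ j) (?l t)) = ?J t *v (y1 - y0)"
          using jacobian_transition[OF c d ov[OF t], of "y1 - y0"] by simp
      qed
    qed
  qed
  from C1_imp_pw[OF this] show "curve (chart_inv c y0) (chart_inv c y1) \<gamma>"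
    by (simp add: curve_def \<gamma>_def)
  show "?l t \<in> B \<and> speed A g \<gamma> t = sqrt ((y1 - y0) \<bullet> (g c (\<gamma> t) *v (y1 - y0)))" if t: "t \<in> {0<..<1}" for t
  proof
    have t': "t \<in> {0..1}" using t by auto
    show "?l t \<in> B" by (rule lB[OF t'])
    have at: "at t within {0..1} = at t" using t by (intro at_within_interior) auto
    have "isCont \<gamma> t" using cont t' unfolding continuous_on_eq_continuous_within at[symmetric] by blast
    then show "speed A g \<gamma> t = sqrt ((y1 - y0) \<bullet> (g c (\<gamma> t) *v (y1 - y0)))"
      using speed_eq[where \<gamma> = \<gamma> and t = t, OF c \<gamma>(1)[OF t']] chart_deriv[OF t'] unfolding at by blast
  qed
qed

lemma curve_refl: "curve p p (\<lambda>t. p)"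
proof -
  obtain c where c: "c \<in> A" "p \<in> fst c" using cover by blast
  have "curve (chart_inv c (snd c p)) (chart_inv c (snd c p)) (\<lambda>t. chart_inv c (snd c p + t *\<^sub>R (snd c p - snd c p)))"
    by (rule chart_segment(1)[OF c(1), of "{snd c p}"]) (use c in auto)
  then show ?thesis by (simp add: chart_left[OF c])
qed

text \<open>The quadratic form attains positive extrema on the compact set \<open>K\<close> times
  the unit sphere, and homogeneity extends the bounds to all vectors.\<close>

lemma metric_comparison:
  assumes c: "c \<in> A" and K: "compact K" "K \<subseteq> snd c ` fst c"
  obtains l C where "l > 0" "C > 0" "\<And>y v. y \<in> K \<Longrightarrow> l * norm v \<le> sqrt (v \<bullet> (g c (chart_inv c y) *v v))"
    "\<And>y v. y \<in> K \<Longrightarrow> sqrt (v \<bullet> (g c (chart_inv c y) *v v)) \<le> C * norm v"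
proof (cases "K = {}")
  case True
  then show ?thesis using that[of 1 1] by simp
next
  case False
  define F where "F = (\<lambda>z. snd z \<bullet> (g c (chart_inv c (fst z)) *v snd z))"
  define X where "X = K \<times> sphere (0 :: real^'n) 1"
  have imK: "chart_inv c ` K \<subseteq> fst c" using chart_inv_in[OF c] K(2) by blast
  have "continuous_on K (\<lambda>y. g c (chart_inv c y) $ i $ j)" for i j
    using continuous_on_compose[OF continuous_on_subset[OF chart_cont(2)[OF c] K(2)]
      continuous_on_subset[OF g_cont[OF c, of i j] imK]] by (simp add: o_def)
  then have "continuous_on K (\<lambda>y. \<chi> i j. g c (chart_inv c y) $ i $ j)"
    by (intro continuous_on_vec_lambda)
  then have "continuous_on K (\<lambda>y. g c (chart_inv c y))" by simp
  then have "continuous_on (fst ` X) (\<lambda>y. g c (chart_inv c y))"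
    by (rule continuous_on_subset) (auto simp: X_def)
  from continuous_on_compose[OF continuous_on_fst[OF continuous_on_id] this]
  have gX: "continuous_on X (\<lambda>z. g c (chart_inv c (fst z)))" by (simp add: o_def)
  have contF: "continuous_on X F"
    unfolding F_def quadratic_form_sum by (intro continuous_intros gX)
  have compX: "compact X" unfolding X_def by (intro compact_Times K) auto
  have "axis undefined 1 \<in> sphere (0 :: real^'n) 1" by simp
  then have neX: "X \<noteq> {}" using False unfolding X_def by blast
  obtain z0 where z0: "z0 \<in> X" "\<And>z. z \<in> X \<Longrightarrow> F z0 \<le> F z"
    using continuous_attains_inf[OF compX neX contF] by blast
  obtain z1 where z1: "z1 \<in> X" "\<And>z. z \<in> X \<Longrightarrow> F z \<le> F z1"
    using continuous_attains_sup[OF compX neX contF] by blast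
  have pos: "F z > 0" if "z \<in> X" for z
    using that chart_inv_in[OF c, of "fst z"] K(2) unfolding F_def X_def
    by (intro g_pos[OF c]) (auto simp: subset_eq)
  have scale: "sqrt (v \<bullet> (g c (chart_inv c y) *v v)) = sqrt (F (y, v /\<^sub>R norm v)) * norm v" if "v \<noteq> 0" for y v
  proof -
    have "v \<bullet> (g c (chart_inv c y) *v v) = F (y, v /\<^sub>R norm v) * (norm v)\<^sup>2"
      using that by (simp add: F_def matrix_vector_mult_scaleR power2_eq_square field_simps)
    then show ?thesis by (simp add: real_sqrt_mult)
  qed
  have inX: "(y, v /\<^sub>R norm v) \<in> X" if "y \<in> K" "v \<noteq> 0" for y v
    using that by (simp add: X_def)
  show ?thesis
  proof (rule that[of "sqrt (F z0)" "sqrt (F z1)"])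
    show "sqrt (F z0) > 0" "sqrt (F z1) > 0" using pos z0(1) z1(1) by auto
    fix y and v :: "real^'n" assume y: "y \<in> K"
    show "sqrt (F z0) * norm v \<le> sqrt (v \<bullet> (g c (chart_inv c y) *v v))"
      by (cases "v = 0") (use scale inX[OF y] z0(2) in \<open>auto intro!: mult_right_mono real_sqrt_le_mono\<close>)
    show "sqrt (v \<bullet> (g c (chart_inv c y) *v v)) \<le> sqrt (F z1) * norm v"
      by (cases "v = 0") (use scale inX[OF y] z1(2) in \<open>auto intro!: mult_right_mono real_sqrt_le_mono\<close>)
  qed
qed

lemma chart_cball:
  assumes c: "c \<in> A" "p \<in> fst c" and W: "open W" "p \<in> W"
  obtains r where "r > 0" "cball (snd c p) r \<subseteq> snd c ` fst c" "\<And>y. y \<in> cball (snd c p) r \<Longrightarrow> chart_inv c y \<in> W"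
proof -
  have "open (snd c ` fst c \<inter> chart_inv c -` W)"
    using continuous_open_preimage[OF chart_cont(2)[OF c(1)] chart_open(2)[OF c(1)] W(1)] .
  moreover have "snd c p \<in> snd c ` fst c \<inter> chart_inv c -` W"
    using c W by (simp add: chart_left[OF c])
  ultimately obtain r where "r > 0" "cball (snd c p) r \<subseteq> snd c ` fst c \<inter> chart_inv c -` W"
    using open_contains_cball by blast
  then show thesis using that[of r] by blast
qed

lemma local_curves:
  assumes c: "c \<in> A" and r: "r > 0" "cball (snd c p) r \<subseteq> snd c ` fst c" and p: "p \<in> fst c"
  obtains C where "C > 0" "\<And>y. y \<in> cball (snd c p) r \<Longrightarrow>
    \<exists>\<gamma>. curve p (chart_inv c y) \<gamma> \<and> curve_length A g \<gamma> \<le> C * dist (snd c p) y"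
proof -
  obtain l C where C: "C > 0" "\<And>y v. y \<in> cball (snd c p) r \<Longrightarrow> sqrt (v \<bullet> (g c (chart_inv c y) *v v)) \<le> C * norm v"
    using metric_comparison[OF c compact_cball r(2)] by metis
  have "\<exists>\<gamma>. curve p (chart_inv c y) \<gamma> \<and> curve_length A g \<gamma> \<le> C * dist (snd c p) y" if y: "y \<in> cball (snd c p) r" for y
  proof -
    let ?\<gamma> = "\<lambda>t. chart_inv c (snd c p + t *\<^sub>R (y - snd c p))"
    have p0: "snd c p \<in> cball (snd c p) r" using r by simp
    note seg = chart_segment[OF c convex_cball r(2) p0 y]
    have "curve p (chart_inv c y) ?\<gamma>" using seg(1) by (simp add: chart_left[OF c p])
    moreover have "curve_length A g ?\<gamma> \<le> C * dist (snd c p) y"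
    proof -
      have pw: "pw 0 1 ?\<gamma>" using seg(1) by (simp add: curve_def)
      \<comment> \<open>The end values are replaced by 0, as the speed formula is available only
        inside the interval.\<close>
      have "curve_length A g ?\<gamma> = integral {0..1} (\<lambda>t. if t \<in> {0, 1} then 0 else speed A g ?\<gamma> t)"
        unfolding curve_length_def by (rule integral_spike[of "{0, 1}"]) auto
      also have "\<dots> \<le> integral {0..1::real} (\<lambda>t. C * norm (y - snd c p))"
      proof (rule integral_le)
        show "(\<lambda>t. if t \<in> {0, 1} then 0 else speed A g ?\<gamma> t) integrable_on {0..1}"
          by (rule integrable_spike_finite[OF _ _ speed_integrable[OF pw], of "{0, 1}"]) auto
        fix t :: real assume t: "t \<in> {0..1}"
        show "(if t \<in> {0, 1} then 0 else speed A g ?\<gamma> t) \<le> C * norm (y - snd c p)"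
        proof (cases "t \<in> {0, 1}")
          case True
          then show ?thesis using C(1) by simp
        next
          case False
          then have "t \<in> {0<..<1}" using t by auto
          from seg(2)[OF this] False show ?thesis using C(2) by simp
        qed
      qed (rule integrable_const_ivl)
      also have "\<dots> = C * dist (snd c p) y" by (simp add: dist_norm norm_minus_commute)
      finally show ?thesis .
    qed
    ultimately show ?thesis by blast
  qed
  with C(1) that show thesis by blast
qed

text \<open>Being joined by a curve is an equivalence relation whose classes are open, by straight
  segments in charts; a connected space has only one class.\<close>

lemma curve_exists: "\<exists>\<gamma>. curve p q \<gamma>"
proof -
  define R where "R = {x. \<exists>\<gamma>. curve p x \<gamma>}"
  have nbhd: "\<exists>T. open T \<and> x \<in> T \<and> (\<forall>z\<in>T. \<exists>\<gamma>. curve x z \<gamma>)" for x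
  proof -
    obtain c where c: "c \<in> A" "x \<in> fst c" using cover by blast
    obtain r where r: "r > 0" "cball (snd c x) r \<subseteq> snd c ` fst c"
      using chart_cball[OF c open_UNIV] by auto
    obtain C where C: "\<And>y. y \<in> cball (snd c x) r \<Longrightarrow>
        \<exists>\<gamma>. curve x (chart_inv c y) \<gamma> \<and> curve_length A g \<gamma> \<le> C * dist (snd c x) y"
      using local_curves[OF c(1) r c(2)] by metis
    have "\<exists>\<gamma>. curve x z \<gamma>" if "z \<in> {z \<in> fst c. snd c z \<in> ball (snd c x) r}" for z
      using C[of "snd c z"] that chart_left[OF c(1), of z] by auto
    then show ?thesis
      using chart_vimage_open[OF c(1) open_ball, of "snd c x" r] c(2) r(1)
      by (intro exI[of _ "{z \<in> fst c. snd c z \<in> ball (snd c x) r}"]) auto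
  qed
  have trans: "z \<in> R" if "x \<in> R" "\<exists>\<gamma>. curve x z \<gamma>" for x z
    using that unfolding R_def by (auto dest: curve_join)
  have sym: "\<exists>\<gamma>. curve z x \<gamma>" if "\<exists>\<gamma>. curve x z \<gamma>" for x z
    using that by (auto dest: curve_reverse)
  have "open R"
  proof (subst open_subopen, intro ballI)
    fix x assume x: "x \<in> R"
    obtain T where "open T" "x \<in> T" "\<And>z. z \<in> T \<Longrightarrow> \<exists>\<gamma>. curve x z \<gamma>" using nbhd[of x] by (elim exE conjE) simp
    with trans[OF x] show "\<exists>T. open T \<and> x \<in> T \<and> T \<subseteq> R" by (intro exI[of _ T]) auto
  qed
  moreover have "open (- R)"
  proof (subst open_subopen, intro ballI)
    fix x assume x: "x \<in> - R"
    obtain T where T: "open T" "x \<in> T" "\<And>z. z \<in> T \<Longrightarrow> \<exists>\<gamma>. curve x z \<gamma>" using nbhd[of x] by (elim exE conjE) simp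
    have "z \<notin> R" if "z \<in> T" for z
      using trans[OF _ sym[OF T(3)[OF that]]] x by auto
    with T(1,2) show "\<exists>T. open T \<and> x \<in> T \<and> T \<subseteq> - R" by (intro exI[of _ T]) auto
  qed
  moreover have "p \<in> R" using curve_refl unfolding R_def by blast
  ultimately have "R = UNIV"
    using connected unfolding connected_clopen[of UNIV] by (auto simp: closed_def openin_open closedin_closed)
  then show ?thesis unfolding R_def by auto
qed

section \<open>The distance as a metric inducing the manifold topology\<close>

abbreviation (input) d where "d \<equiv> riemannian_dist A g"

lemma dist_Inf: "d p q = Inf {curve_length A g \<gamma> |\<gamma>. curve p q \<gamma>}"
  unfolding riemannian_dist_def curve_def piecewise_C1_path_pw pathstart_def pathfinish_def by simp

lemma dist_le_length: "curve p q \<gamma> \<Longrightarrow> d p q \<le> curve_length A g \<gamma>"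
  unfolding dist_Inf by (rule cInf_lower) (auto simp: bdd_below_def curve_length_def intro: length_nonneg)

text \<open>By \<open>curve_exists\<close> the infimum runs over a nonempty set, so it has its usual
  meaning.\<close>

lemma dist_lessE:
  assumes "d p q < e"
  obtains \<gamma> where "curve p q \<gamma>" "curve_length A g \<gamma> < e"
proof -
  have "{curve_length A g \<gamma> |\<gamma>. curve p q \<gamma>} \<noteq> {}" using curve_exists by blast
  from cInf_lessD[OF this assms[unfolded dist_Inf]] show thesis using that by blast
qed

lemma dist_greatest: "(\<And>\<gamma>. curve p q \<gamma> \<Longrightarrow> e \<le> curve_length A g \<gamma>) \<Longrightarrow> e \<le> d p q"
  by (rule ccontr) (meson dist_lessE leD not_le_imp_less)

lemma dist_nonneg: "0 \<le> d p q"
  by (rule dist_greatest) (simp add: curve_length_def length_nonneg)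

lemma dist_sym: "d p q = d q p"
proof -
  have "d p q \<le> d q p" for p q
    by (rule dist_greatest) (metis curve_reverse dist_le_length)
  then show ?thesis by (simp add: antisym)
qed

lemma dist_tri: "d p r \<le> d p q + d q r"
proof (rule field_le_epsilon)
  fix e :: real assume "e > 0"
  then obtain \<gamma> \<delta> where "curve p q \<gamma>" "curve_length A g \<gamma> < d p q + e / 2" "curve q r \<delta>" "curve_length A g \<delta> < d q r + e / 2"
    using dist_lessE[of p q "d p q + e / 2"] dist_lessE[of q r "d q r + e / 2"] by (metis half_gt_zero less_add_same_cancel1)
  moreover from this(1,3) obtain \<eta> where "curve p r \<eta>" "curve_length A g \<eta> = curve_length A g \<gamma> + curve_length A g \<delta>"
    using curve_join by blast
  ultimately show "d p r \<le> d p q + d q r + e" using dist_le_length[of p r \<eta>] by simp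
qed

lemma dist_le_integral: "pw a b \<gamma> \<Longrightarrow> a \<le> b \<Longrightarrow> d (\<gamma> a) (\<gamma> b) \<le> integral {a..b} (speed A g \<gamma>)"
proof (cases "a = b")
  case True
  have "curve_length A g (\<lambda>t. \<gamma> a) = 0"
  proof -
    obtain c where c: "c \<in> A" "\<gamma> a \<in> fst c" using cover by blast
    have "speed A g (\<lambda>t. \<gamma> a) = (\<lambda>t. 0)"
      using speed_eq[OF c(1), of "\<lambda>t. \<gamma> a" _ 0] c by (simp add: o_def fun_eq_iff)
    then show ?thesis by (simp add: curve_length_def)
  qed
  then show ?thesis using True dist_le_length[OF curve_refl, of "\<gamma> a"] by simp
next
  case False
  assume "pw a b \<gamma>" "a \<le> b"
  with False curve_normalize[of a b \<gamma>] show ?thesis using dist_le_length by (metis order_le_less)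
qed

lemma dist_refl: "d p p = 0"
proof -
  have "pw 0 0 (\<lambda>t. p)" using curve_refl[of p] pw_subset[of 0 1 _ 0 0] by (auto simp: curve_def)
  from dist_le_integral[OF this] show ?thesis using dist_nonneg[of p p] by simp
qed

text \<open>A curve leaving a coordinate ball must first cross it: estimate the length up to the exit time.\<close>

lemma dist_exit:
  assumes c: "c \<in> A" "p \<in> fst c" and r: "r > 0" "cball (snd c p) r \<subseteq> snd c ` fst c"
    and l: "l > 0" "\<And>y v. y \<in> cball (snd c p) r \<Longrightarrow> l * norm v \<le> sqrt (v \<bullet> (g c (chart_inv c y) *v v))"
    and q: "q \<notin> {x \<in> fst c. snd c x \<in> ball (snd c p) r}"
  shows "l * r \<le> d p q"
proof (rule dist_greatest)
  fix \<gamma> assume \<gamma>: "curve p q \<gamma>"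
  define W where "W = {x \<in> fst c. snd c x \<in> ball (snd c p) r}"
  have openW: "open W" unfolding W_def by (rule chart_vimage_open[OF c(1) open_ball])
  have pw: "pw 0 1 \<gamma>" and ends: "\<gamma> 0 = p" "\<gamma> 1 = q" using \<gamma> by (auto simp: curve_def)
  have cont: "continuous_on {0..1} \<gamma>" using pw by (simp add: pw_def)
  define T where "T = {0..1} \<inter> \<gamma> -` (- W)"
  have "closed T"
    unfolding T_def by (rule continuous_closed_preimage[OF cont]) (use openW in auto)
  moreover have T1: "1 \<in> T" using q ends by (auto simp: T_def W_def)
  moreover have bdd: "bdd_below T" by (auto simp: T_def bdd_below_def)
  ultimately have T0: "Inf T \<in> T" using closed_contains_Inf[of T] by auto
  define t0 where "t0 = Inf T"
  have t0: "t0 \<in> {0..1}" "\<gamma> t0 \<notin> W" using T0 by (auto simp: t0_def T_def)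
  have before: "\<gamma> t \<in> W" if "0 \<le> t" "t < t0" for t
  proof (rule ccontr)
    assume "\<gamma> t \<notin> W"
    then have "t \<in> T" using that t0 by (auto simp: T_def)
    from cInf_lower[OF this bdd] that show False by (simp add: t0_def)
  qed
  have "p \<in> W" using c r by (auto simp: W_def)
  then have t0pos: "t0 > 0" using t0 ends by (cases "t0 = 0") auto
  \<comment> \<open>The image of the closed coordinate ball is compact, hence closed in the
    Hausdorff space, so the curve is still in the chart at the exit time \<open>t0\<close>
    itself.\<close>
  define K where "K = chart_inv c ` cball (snd c p) r"
  have K: "closed K"
    unfolding K_def by (intro compact_imp_closed chart_image_compact c(1) compact_cball r(2))
  have WK: "W \<subseteq> K"
  proof
    fix x assume "x \<in> W"
    then have "x = chart_inv c (snd c x)" "snd c x \<in> cball (snd c p) r"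
      using chart_left[OF c(1)] by (auto simp: W_def)
    then show "x \<in> K" unfolding K_def by blast
  qed
  have inK: "\<gamma> t \<in> K" if "t \<in> {0..t0}" for t
  proof -
    have "closed ({0..t0} \<inter> \<gamma> -` K)"
      by (rule continuous_closed_preimage[OF continuous_on_subset[OF cont] _ K]) (use t0 in auto)
    moreover have "{0..<t0} \<subseteq> {0..t0} \<inter> \<gamma> -` K" using before subsetD[OF WK] by force
    ultimately have "closure {0..<t0} \<subseteq> {0..t0} \<inter> \<gamma> -` K" by (rule closure_minimal[rotated])
    then show ?thesis using that t0pos by (auto simp: closure_atLeastLessThan)
  qed
  have chart: "\<gamma> t \<in> fst c" "snd c (\<gamma> t) \<in> cball (snd c p) r" "chart_inv c (snd c (\<gamma> t)) = \<gamma> t"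
    if tt: "t \<in> {0..t0}" for t
  proof -
    obtain y where y: "y \<in> cball (snd c p) r" "\<gamma> t = chart_inv c y" using inK[OF tt] by (auto simp: K_def)
    then have "y \<in> snd c ` fst c" using r(2) by auto
    then show "\<gamma> t \<in> fst c" "snd c (\<gamma> t) \<in> cball (snd c p) r" "chart_inv c (snd c (\<gamma> t)) = \<gamma> t"
      using y chart_inv_in[OF c(1)] chart_right[OF c(1)] by auto
  qed
  have pw0: "pw 0 t0 \<gamma>" by (rule pw_subset[OF pw]) (use t0 in auto)
  define f where "f = snd c \<circ> \<gamma>"
  have contf: "continuous_on {0..t0} f"
    unfolding f_def
    by (intro continuous_on_compose continuous_on_subset[OF cont] continuous_on_subset[OF chart_cont(1)[OF c(1)]])
       (use t0 chart in auto)
  obtain S where S: "finite S" "\<And>t. t \<in> {0<..<t0} - S \<Longrightarrow> isCont \<gamma> t"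
    "\<And>t c. t \<in> {0<..<t0} - S \<Longrightarrow> c \<in> A \<Longrightarrow> \<gamma> t \<in> fst c \<Longrightarrow> \<exists>D. ((snd c \<circ> \<gamma>) has_vector_derivative D) (at t)"
    using pw_regular[OF pw0] by blast
  \<comment> \<open>Zero at the exceptional times, so that the bound by the speed holds at every
    \<open>t\<close>.\<close>
  define f' where "f' t = (if t \<in> {0<..<t0} - S then vector_derivative f (at t) else 0)" for t
  have f': "(f has_vector_derivative f' t) (at t)" if "t \<in> {0<..<t0} - S" for t
    using S(3)[OF that c(1) chart(1)] that
    by (auto simp: f'_def f_def vector_derivative_works[symmetric] intro: differentiableI_vector)
  have int: "(f' has_integral f t0 - f 0) {0..t0}"
    by (rule fundamental_theorem_of_calculus_interior_strong[OF S(1) _ f' contf]) (use t0pos in auto)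
  have bound: "norm (f' t) \<le> speed A g \<gamma> t / l" for t
  proof (cases "t \<in> {0<..<t0} - S")
    case True
    then have tt: "t \<in> {0..t0}" by auto
    have "speed A g \<gamma> t = sqrt (f' t \<bullet> (g c (\<gamma> t) *v f' t))"
      by (rule speed_eq[OF c(1) chart(1)[OF tt] S(2)[OF True] f'[OF True, unfolded f_def]])
    then have "l * norm (f' t) \<le> speed A g \<gamma> t"
      using l(2)[OF chart(2)[OF tt], of "f' t"] chart(3)[OF tt] by simp
    then show ?thesis using l(1) by (simp add: field_simps)
  next
    case False
    then have "f' t = 0" unfolding f'_def by (rule if_not_P)
    then show ?thesis using speed_nonneg[of \<gamma> t] l(1) by simp
  qed
  have si: "speed A g \<gamma> integrable_on {0..t0}" by (rule speed_integrable[OF pw0])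
  have "norm (f t0 - f 0) \<le> integral {0..t0} (speed A g \<gamma>) / l"
  proof -
    have "norm (integral {0..t0} f') \<le> integral {0..t0} (\<lambda>t. speed A g \<gamma> t / l)"
    proof (rule integral_norm_bound_integral)
      show "f' integrable_on {0..t0}" using int by (rule has_integral_integrable)
      show "(\<lambda>t. speed A g \<gamma> t / l) integrable_on {0..t0}" using si by (rule integrable_on_divide)
    qed (rule bound)
    then show ?thesis using integral_unique[OF int] by simp
  qed
  moreover have "r \<le> norm (f t0 - f 0)"
  proof -
    have "\<not> dist (snd c p) (snd c (\<gamma> t0)) < r"
      using t0(2) chart(1)[of t0] t0pos by (simp add: W_def)
    then show ?thesis using ends by (simp add: f_def dist_norm norm_minus_commute)
  qed
  ultimately have "l * r \<le> integral {0..t0} (speed A g \<gamma>)"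
    using l(1) by (simp add: field_simps) (meson mult_left_mono less_imp_le order_trans)
  also have "\<dots> \<le> integral {0..1} (speed A g \<gamma>)"
    by (rule integral_subset_le) (use t0 si speed_integrable[OF pw] speed_nonneg in auto)
  finally show "l * r \<le> curve_length A g \<gamma>" by (simp add: curve_length_def)
qed

text \<open>To leave a coordinate ball of radius \<open>r\<close> inside \<open>W\<close>, a curve
  needs length at least \<open>l * r\<close>. Together with Hausdorff separation this makes the
  distance of distinct points positive, and it is one of the two inclusions between the
  topologies.\<close>

lemma dist_nhd_lower:
  assumes "open W" "p \<in> W"
  shows "\<exists>\<rho>>0. \<forall>q. d p q < \<rho> \<longrightarrow> q \<in> W"
proof -
  obtain c where c: "c \<in> A" "p \<in> fst c" using cover by blast
  obtain r where r: "r > 0" "cball (snd c p) r \<subseteq> snd c ` fst c" "\<And>y. y \<in> cball (snd c p) r \<Longrightarrow> chart_inv c y \<in> W"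
    using chart_cball[OF c assms] by blast
  obtain l where l: "l > 0" "\<And>y v. y \<in> cball (snd c p) r \<Longrightarrow> l * norm v \<le> sqrt (v \<bullet> (g c (chart_inv c y) *v v))"
    using metric_comparison[OF c(1) compact_cball r(2)] by metis
  have "q \<in> W" if "d p q < l * r" for q
  proof (rule ccontr)
    assume q: "q \<notin> W"
    have "q \<notin> {x \<in> fst c. snd c x \<in> ball (snd c p) r}"
    proof
      assume "q \<in> {x \<in> fst c. snd c x \<in> ball (snd c p) r}"
      then have "chart_inv c (snd c q) \<in> W" "chart_inv c (snd c q) = q"
        using r(3)[of "snd c q"] chart_left[OF c(1)] by auto
      with q show False by simp
    qed
    from dist_exit[OF c r(1,2) l this] that show False by simp
  qed
  then show ?thesis using l r by (intro exI[of _ "l * r"]) auto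
qed

text \<open>The other inclusion: in a chart the distance is at most \<open>C\<close> times the
  Euclidean one, by \<open>local_curves\<close>, so a coordinate ball of radius at most
  \<open>\<rho> / C\<close> serves.\<close>

lemma dist_nhd_upper:
  assumes "\<rho> > 0"
  shows "\<exists>T. open T \<and> p \<in> T \<and> (\<forall>q\<in>T. d p q < \<rho>)"
proof -
  obtain c where c: "c \<in> A" "p \<in> fst c" using cover by blast
  obtain r where r: "r > 0" "cball (snd c p) r \<subseteq> snd c ` fst c"
    using chart_cball[OF c open_UNIV] by auto
  obtain C where C: "C > 0" "\<And>y. y \<in> cball (snd c p) r \<Longrightarrow>
      \<exists>\<gamma>. curve p (chart_inv c y) \<gamma> \<and> curve_length A g \<gamma> \<le> C * dist (snd c p) y"
    using local_curves[OF c(1) r c(2)] by metis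
  define s where "s = min r (\<rho> / C)"
  have s: "s > 0" "s \<le> r" "C * s \<le> \<rho>" using r C assms by (auto simp: s_def field_simps min_def)
  have "d p q < \<rho>" if "q \<in> {x \<in> fst c. snd c x \<in> ball (snd c p) s}" for q
  proof -
    have q: "q \<in> fst c" "dist (snd c p) (snd c q) < s" using that by auto
    then obtain \<gamma> where "curve p q \<gamma>" "curve_length A g \<gamma> \<le> C * dist (snd c p) (snd c q)"
      using C(2)[of "snd c q"] s chart_left[OF c(1) q(1)] by auto
    moreover have "C * dist (snd c p) (snd c q) < C * s" using q(2) C(1) by simp
    ultimately show ?thesis using dist_le_length[of p q \<gamma>] s by simp
  qed
  then show ?thesis
    using chart_vimage_open[OF c(1) open_ball, of "snd c p" s] c s
    by (intro exI[of _ "{x \<in> fst c. snd c x \<in> ball (snd c p) s}"]) auto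
qed

sublocale M: Metric_space UNIV "riemannian_dist A g"
proof
  fix x y z
  show "0 \<le> d x y" by (rule dist_nonneg)
  show "d x y = d y x" by (rule dist_sym)
  show "d x z \<le> d x y + d y z" by (rule dist_tri)
  show "d x y = 0 \<longleftrightarrow> x = y"
  proof
    assume xy: "d x y = 0"
    show "x = y"
    proof (rule ccontr)
      assume "x \<noteq> y"
      then have "open (- {y})" "x \<in> - {y}" by auto
      from dist_nhd_lower[OF this] obtain \<rho> where "\<rho> > 0" "\<forall>q. d x q < \<rho> \<longrightarrow> q \<in> - {y}" by blast
      from this(1) this(2)[THEN spec, of y] xy show False by simp
    qed
  qed (simp add: dist_refl)
qed

lemma mtopology_eq: "M.mtopology = euclidean"
proof (rule topology_eq[THEN iffD2], intro allI)
  fix U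
  show "openin M.mtopology U = openin euclidean U"
  proof
    assume U: "openin M.mtopology U"
    have "open U"
    proof (subst open_subopen, intro ballI)
      fix x assume "x \<in> U"
      then obtain \<rho> where \<rho>: "\<rho> > 0" "M.mball x \<rho> \<subseteq> U" using U by (auto simp: M.openin_mtopology)
      from dist_nhd_upper[OF \<rho>(1), of x] obtain T where "open T" "x \<in> T" "\<And>q. q \<in> T \<Longrightarrow> d x q < \<rho>"
        by (elim exE conjE) simp
      with \<rho>(2) show "\<exists>T. open T \<and> x \<in> T \<and> T \<subseteq> U" by (intro exI[of _ T]) auto
    qed
    then show "openin euclidean U" by simp
  next
    assume "openin euclidean U"
    then have U: "open U" by simp
    show "openin M.mtopology U"
      unfolding M.openin_mtopology
    proof (intro conjI allI impI)
      fix x assume "x \<in> U"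
      from dist_nhd_lower[OF U this] obtain \<rho> where "\<rho> > 0" "\<And>q. d x q < \<rho> \<Longrightarrow> q \<in> U"
        by (elim exE conjE) simp
      then show "\<exists>r>0. M.mball x r \<subseteq> U" by (intro exI[of _ \<rho>]) auto
    qed simp
  qed
qed

lemma locally_compact_mcball: "\<exists>r>0. compactin M.mtopology (M.mcball p r)"
proof -
  obtain c where c: "c \<in> A" "p \<in> fst c" using cover by blast
  obtain r where r: "r > 0" "cball (snd c p) r \<subseteq> snd c ` fst c"
    using chart_cball[OF c open_UNIV] by auto
  define K where "K = chart_inv c ` cball (snd c p) r"
  have K: "compact K" unfolding K_def by (intro chart_image_compact c(1) compact_cball r(2))
  have "{x \<in> fst c. snd c x \<in> ball (snd c p) r} \<subseteq> K"
  proof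
    fix x assume "x \<in> {x \<in> fst c. snd c x \<in> ball (snd c p) r}"
    then have "x = chart_inv c (snd c x)" "snd c x \<in> cball (snd c p) r" using chart_left[OF c(1)] by auto
    then show "x \<in> K" unfolding K_def by blast
  qed
  moreover have "p \<in> {x \<in> fst c. snd c x \<in> ball (snd c p) r}" using c r by auto
  ultimately obtain \<rho> where \<rho>: "\<rho> > 0" "\<And>q. d p q < \<rho> \<Longrightarrow> q \<in> K"
    using dist_nhd_lower[OF chart_vimage_open[OF c(1) open_ball, of "snd c p" r], of p] by blast
  \<comment> \<open>Half the radius, because \<open>\<rho>\<close> controls only points at distance
    strictly less than \<open>\<rho>\<close>.\<close>
  have "M.mcball p (\<rho> / 2) \<subseteq> K" using \<rho> by auto
  moreover have "closed (M.mcball p (\<rho> / 2))"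
    using M.closedin_mcball[of p "\<rho> / 2"] unfolding mtopology_eq by simp
  ultimately have "compact (M.mcball p (\<rho> / 2))"
    using compact_Int_closed[OF K] by (metis inf.absorb_iff2)
  then show ?thesis using \<rho>(1) unfolding mtopology_eq by (intro exI[of _ "\<rho> / 2"]) simp
qed

text \<open>Follow a curve of length below \<open>r + s\<close> and stop, by the intermediate value
  theorem for arc length, when the length used up is below \<open>r\<close> and the length still to
  go is below \<open>s\<close>.\<close>

lemma length_space:
  assumes "r > 0" "s > 0" "d x y < r + s"
  shows "\<exists>z. d x z < r \<and> d z y < s"
proof -
  obtain \<gamma> where \<gamma>: "curve x y \<gamma>" "curve_length A g \<gamma> < r + s" using dist_lessE[OF assms(3)] by blast
  have pw: "pw 0 1 \<gamma>" and ends: "\<gamma> 0 = x" "\<gamma> 1 = y" using \<gamma>(1) by (auto simp: curve_def)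
  define F where "F t = integral {0..t} (speed A g \<gamma>)" for t
  have int: "speed A g \<gamma> integrable_on {0..1}" by (rule speed_integrable[OF pw])
  have contF: "continuous_on {0..1} F" unfolding F_def by (rule indefinite_integral_continuous_1[OF int])
  define L where "L = F 1"
  have L: "L < r + s" using \<gamma>(2) by (simp add: L_def F_def curve_length_def)
  have L0: "0 \<le> L" by (simp add: L_def F_def length_nonneg)
  \<comment> \<open>The stopping value \<open>v\<close> must lie in \<open>[0, L]\<close>, below
    \<open>r\<close> and above \<open>L - s\<close>. As \<open>m\<close> is the larger of the two
    lower bounds, the midpoint of \<open>m\<close> and \<open>r\<close>, capped at \<open>L\<close>,
    has these properties.\<close>
  define m where "m = max 0 (L - s)"
  have m: "0 \<le> m" "L - s \<le> m" "m < r" using L assms(1) by (auto simp: m_def)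
  define v where "v = min L ((m + r) / 2)"
  have v: "0 \<le> v" "v \<le> L" "v < r" "L - v < s" 
  proof -
    have "v = L \<or> v = (m + r) / 2" unfolding v_def min_def by meson
    moreover have "v \<le> L" "v \<le> (m + r) / 2" unfolding v_def by (rule min.cobounded1, rule min.cobounded2)
    ultimately show "0 \<le> v" "v \<le> L" "v < r" "L - v < s" using m L0 L assms(2) by (auto simp: field_simps)
  qed
  have "F 0 = 0" by (simp add: F_def)
  then obtain t where t: "0 \<le> t" "t \<le> 1" "F t = v"
    using IVT'[of F 0 v 1] v contF by (auto simp: L_def)
  have "d x (\<gamma> t) \<le> F t"
    using dist_le_integral[OF pw_subset[OF pw], of 0 t] t ends by (simp add: F_def)
  moreover have "d (\<gamma> t) y \<le> L - F t"
  proof -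
    have "F t + integral {t..1} (speed A g \<gamma>) = L"
      unfolding F_def L_def by (rule Henstock_Kurzweil_Integration.integral_combine[OF t(1,2) int])
    then show ?thesis using dist_le_integral[OF pw_subset[OF pw], of t 1] t ends by simp
  qed
  ultimately show ?thesis using v t(3) by (intro exI[of _ "\<gamma> t"]) auto
qed

lemma complete_imp_proper:
  assumes "complete_metric A g"
  shows "compact {q. d p q \<le> r}"
proof -
  have "compactin M.mtopology (M.mcball p r)"
  proof (rule M.Hopf_Rinow)
    show "M.mcomplete" using assms by (simp add: complete_metric_def)
    show "\<exists>z\<in>UNIV. d x z < r \<and> d z y < s" if "r > 0" "s > 0" "d x y < r + s" for x y r s
      using length_space[OF that] by simp
  qed (use locally_compact_mcball in auto)
  moreover have "M.mcball p r = {q. d p q \<le> r}" by auto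
  ultimately show ?thesis unfolding mtopology_eq by simp
qed

end

section \<open>Conformal metrics with zero scalar curvature\<close>

context coordinate_metric
begin

lemma hessian_minus:
  assumes f: "Ck_on 2 f U" and y: "y \<in> U"
  shows "hessian G (\<lambda>z. k - f z) i j y = - hessian G f i j y"
proof -
  have p: "partial j (\<lambda>z. k - f z) x = (- 1) * partial j f x" if "x \<in> U" for x j
    using partial_diff[of "\<lambda>_. k" x f j] C2_diff[OF f that] by simp
  have "partial i (partial j (\<lambda>z. k - f z)) y = partial i (\<lambda>x. (- 1) * partial j f x) y"
    by (rule partial_cong[OF open_U y p])
  also have "\<dots> = (- 1) * partial i (partial j f) y"
    by (rule partial_cmult[OF C1_diff[OF C2_partial[OF f] y]])
  finally show ?thesis by (simp add: hessian_def p[OF y] sum_negf)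
qed

lemma laplacian_minus:
  assumes "Ck_on 2 f U" "y \<in> U"
  shows "metric_trace G (hessian G (\<lambda>z. k - f z)) y = - metric_trace G (hessian G f) y"
  by (simp add: metric_trace_def hessian_minus[OF assms] sum_negf)

text \<open>The form in which the maximum principle applies: the first-order coefficient is minus
  the Christoffel symbol traced over its lower indices.\<close>

lemma laplacian_second_order:
  "metric_trace G (hessian G f) y =
     second_order (\<lambda>i j y. matrix_inv (G y) $ i $ j)
       (\<lambda>k y. - (\<Sum>i\<in>UNIV. \<Sum>j\<in>UNIV. matrix_inv (G y) $ i $ j * christoffel G k i j y)) f y"
proof -
  have "(\<Sum>i\<in>UNIV. \<Sum>j\<in>UNIV. matrix_inv (G y) $ i $ j * (\<Sum>k\<in>UNIV. christoffel G k i j y * partial k f y))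
      = (\<Sum>i\<in>UNIV. \<Sum>j\<in>UNIV. \<Sum>k\<in>UNIV. matrix_inv (G y) $ i $ j * christoffel G k i j y * partial k f y)"
    by (simp add: sum_distrib_left mult.assoc)
  also have "\<dots> = (\<Sum>i\<in>UNIV. \<Sum>k\<in>UNIV. \<Sum>j\<in>UNIV. matrix_inv (G y) $ i $ j * christoffel G k i j y * partial k f y)"
    by (rule sum.cong[OF refl sum.swap])
  also have "\<dots> = (\<Sum>k\<in>UNIV. \<Sum>i\<in>UNIV. \<Sum>j\<in>UNIV. matrix_inv (G y) $ i $ j * christoffel G k i j y * partial k f y)"
    by (rule sum.swap)
  also have "\<dots> = (\<Sum>k\<in>UNIV. (\<Sum>i\<in>UNIV. \<Sum>j\<in>UNIV. matrix_inv (G y) $ i $ j * christoffel G k i j y) * partial k f y)"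
    by (simp add: sum_distrib_right)
  finally show ?thesis
    by (simp add: metric_trace_def hessian_def second_order_def right_diff_distrib sum_subtractf sum_negf)
qed

lemma scalar_continuous: "continuous_on U (metric_trace G (ricci G))"
proof -
  have h: "continuous_on U (\<lambda>y. matrix_inv (G y) $ i $ j)" for i j
    using Ck_on_continuous[OF inv_C2] .
  have C: "continuous_on U (christoffel G k i j)" for k i j
    using Ck_on_continuous[OF christoffel_C1] .
  have dC: "continuous_on U (partial m (christoffel G k i j))" for k i j m
    using Ck_on_partial[of 0] christoffel_C1[of k i j] by simp
  show ?thesis
    unfolding metric_trace_def[abs_def] ricci_def riemann_def by (intro continuous_intros h C dC)
qed

text \<open>With \<open>w\<close> the inverse matrix applied to \<open>v\<close>, the value is the
  metric form at \<open>w\<close>.\<close>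

lemma inverse_positive:
  assumes pos: "\<And>v. v \<noteq> 0 \<Longrightarrow> 0 < v \<bullet> (G y *v v)" and y: "y \<in> U" and v: "v \<noteq> 0"
  shows "0 < quad (\<lambda>i j. matrix_inv (G y) $ i $ j) (($) v)"
proof -
  define w where "w = matrix_inv (G y) *v v"
  have Gw: "G y *v w = v"
    by (simp add: w_def matrix_vector_mul_assoc matrix_inv_inverse[OF G_det[OF y]])
  then have "w \<noteq> 0" using v by auto
  from pos[OF this] have "0 < w \<bullet> v" by (simp add: Gw)
  also have "w \<bullet> v = quad (\<lambda>i j. matrix_inv (G y) $ i $ j) (($) v)"
    by (simp add: w_def inner_vec_def matrix_vector_mult_def quad_def sum_distrib_left sum_distrib_right mult_ac)
  finally show ?thesis .
qed

end

lemma positive_definite_det: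
  fixes M :: "real^'n^'n"
  assumes "\<And>v. v \<noteq> 0 \<Longrightarrow> 0 < v \<bullet> (M *v v)" shows "det M \<noteq> 0"
proof -
  have "\<forall>x. M *v x = 0 \<longrightarrow> x = 0" using assms by force
  then show ?thesis using matrix_left_invertible_ker invertible_left_inverse invertible_det_nz by metis
qed

lemma coordinate_metric_chart:
  assumes A: "smooth_atlas A" and g: "riemannian_metric A \<infinity> g" and c: "c \<in> A"
  shows "coordinate_metric (snd c ` fst c) (coord_metric g c)"
    and "y \<in> snd c ` fst c \<Longrightarrow> v \<noteq> 0 \<Longrightarrow> 0 < v \<bullet> (coord_metric g c y *v v)"
proof -
  have hom: "open (snd c ` fst c)" "homeomorphism (fst c) (snd c ` fst c) (snd c) (chart_inv c)"
    using A c unfolding smooth_atlas_def by auto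
  have inv: "chart_inv c y \<in> fst c" if "y \<in> snd c ` fst c" for y
    using hom(2) that by (auto simp: homeomorphism_def)
  have sp: "\<forall>p\<in>fst c. transpose (g c p) = g c p \<and> (\<forall>v. v \<noteq> 0 \<longrightarrow> 0 < v \<bullet> (g c p *v v))"
    using g c unfolding riemannian_metric_def by blast
  show pos: "0 < v \<bullet> (coord_metric g c y *v v)" if "y \<in> snd c ` fst c" "v \<noteq> 0" for y v
    using sp inv[OF that(1)] that(2) unfolding coord_metric_def by blast
  show "coordinate_metric (snd c ` fst c) (coord_metric g c)"
  proof
    show "Ck_on 2 (\<lambda>y. coord_metric g c y $ i $ j) (snd c ` fst c)" for i j
      using g c unfolding riemannian_metric_def coord_metric_def C_on_infinity by blast
    show "transpose (coord_metric g c y) = coord_metric g c y" if "y \<in> snd c ` fst c" for y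
      using sp inv[OF that] unfolding coord_metric_def by blast
    show "det (coord_metric g c y) \<noteq> 0" if "y \<in> snd c ` fst c" for y
      by (rule positive_definite_det[OF pos[OF that]])
  qed (rule hom(1))
qed

lemma riemannian_metric_conformal:
  assumes A: "smooth_atlas A" and g: "riemannian_metric A k g" and w: "C_manifold A k w" "\<And>x. 0 < w x"
  shows "riemannian_metric A k (conformal_metric w g)"
  unfolding riemannian_metric_def
proof (intro conjI ballI allI impI)
  fix c p assume c: "c \<in> A" "p \<in> fst c"
  have g': "transpose (g c p) = g c p" "\<And>v. v \<noteq> 0 \<Longrightarrow> 0 < v \<bullet> (g c p *v v)"
    using g c unfolding riemannian_metric_def by blast+
  show "transpose (conformal_metric w g c p) = conformal_metric w g c p"
    using g'(1) by (simp add: conformal_metric_def transpose_scalar)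
  show "0 < v \<bullet> (conformal_metric w g c p *v v)" if "v \<noteq> 0" for v
    using g'(2)[OF that] w(2)[of p] by (simp add: conformal_metric_def scaleR_matrix_vector_assoc[symmetric] powr_gt_zero)
next
  fix c and i j :: 'b assume c: "c \<in> A"
  have U: "open (snd c ` fst c)" using A c unfolding smooth_atlas_def by auto
  have "C_on k (w \<circ> chart_inv c) (snd c ` fst c)" using w(1) c by (simp add: C_manifold_def)
  moreover have "C_on k (\<lambda>y. g c (chart_inv c y) $ i $ j) (snd c ` fst c)"
    using g c unfolding riemannian_metric_def by blast
  ultimately show "C_on k (\<lambda>y. conformal_metric w g c (chart_inv c y) $ i $ j) (snd c ` fst c)"
    using w(2) unfolding C_on_def conformal_metric_def
    by (auto intro!: Ck_on_mult Ck_on_powr U simp: o_def)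
next
  fix c d p assume cd: "c \<in> A" "d \<in> A" "p \<in> fst c \<inter> fst d"
  define J where "J = jacobian (snd d \<circ> chart_inv c) (at (snd c p))"
  have "g c p = transpose J ** g d p ** J"
    using g cd unfolding riemannian_metric_def J_def Let_def by blast
  then show "conformal_metric w g c p = (let J = jacobian (snd d \<circ> chart_inv c) (at (snd c p))
       in transpose J ** conformal_metric w g d p ** J)"
    unfolding J_def[symmetric] Let_def conformal_metric_def
    by (simp add: matrix_scalar_ac scalar_matrix_assoc[symmetric])
qed

section \<open>Completeness under a conformal factor bounded below\<close>

context riemannian_manifold
begin

lemma C_manifold_continuous:
  assumes "C_manifold A k u" shows "continuous_on UNIV u"
  unfolding continuous_on_eq_continuous_at[OF open_UNIV]
proof
  fix x
  obtain c where c: "c \<in> A" "x \<in> fst c" using cover by blast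
  have "continuous_on (snd c ` fst c) (u \<circ> chart_inv c)"
    using assms c(1) by (auto simp: C_manifold_def C_on_def dest!: bspec[of _ _ c] spec[of _ 0] simp: zero_enat_def[symmetric])
  from continuous_on_compose[OF chart_cont(1)[OF c(1)] this]
  have "continuous_on (fst c) u"
    by (rule continuous_on_eq) (simp add: chart_left[OF c(1)])
  then show "isCont u x" using chart_open(1)[OF c(1)] c(2) by (simp add: continuous_on_eq_continuous_at)
qed

text \<open>A Cauchy sequence for the new distance is one for the old distance, and its limit
  survives because both distances induce the manifold topology.\<close>

lemma conformal_complete:
  assumes complete: "complete_metric A g" and g1: "riemannian_metric A 0 (conformal_metric w g)"
    and w: "\<epsilon> > 0" "\<And>x. \<epsilon> \<le> w x" and n: "CARD('n) \<ge> 3"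
  shows "complete_metric A (conformal_metric w g)"
proof -
  interpret R: riemannian_manifold A "conformal_metric w g"
    by unfold_locales (rule atlas, rule g1, rule connected)
  \<comment> \<open>The speed scales by the square root of the conformal factor; the exponent is
    positive for dimension at least 3, so the lower bound \<open>\<epsilon>\<close> on
    \<open>w\<close> passes to the factor.\<close>
  define l where "l = sqrt (\<epsilon> powr (4 / (real CARD('n) - 2)))"
  have l: "l > 0" using w(1) by (simp add: l_def)
  have speed: "l * speed A g \<gamma> t \<le> speed A (conformal_metric w g) \<gamma> t" for \<gamma> t
  proof -
    have "speed A (conformal_metric w g) \<gamma> t = sqrt (w (\<gamma> t) powr (4 / (real CARD('n) - 2))) * speed A g \<gamma> t"
      by (simp add: speed_def conformal_metric_def Let_def scaleR_matrix_vector_assoc[symmetric] real_sqrt_mult)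
    moreover have "l \<le> sqrt (w (\<gamma> t) powr (4 / (real CARD('n) - 2)))"
      unfolding l_def using w(1) w(2)[of "\<gamma> t"] n by (intro real_sqrt_le_mono powr_mono2) auto
    ultimately show ?thesis using speed_nonneg by (simp add: mult_right_mono)
  qed
  have dist: "l * d p q \<le> riemannian_dist A (conformal_metric w g) p q" for p q
  proof (rule R.dist_greatest)
    \<comment> \<open>\<open>curve\<close> depends on the atlas alone, so the two metrics have the
      same curves.\<close>
    fix \<gamma> assume \<gamma>: "curve p q \<gamma>"
    then have pw: "pw 0 1 \<gamma>" by (simp add: curve_def)
    have "l * d p q \<le> l * curve_length A g \<gamma>"
      using dist_le_length[OF \<gamma>] l by simp
    also have "\<dots> = integral {0..1} (\<lambda>t. l * speed A g \<gamma> t)" by (simp add: curve_length_def)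
    also have "\<dots> \<le> curve_length A (conformal_metric w g) \<gamma>"
      unfolding curve_length_def
    proof (rule integral_le[OF _ R.speed_integrable[OF pw] speed])
      show "(\<lambda>t. l * speed A g \<gamma> t) integrable_on {0..1}"
        using integrable_cmul[OF speed_integrable[OF pw], of l] by simp
    qed
    finally show "l * d p q \<le> curve_length A (conformal_metric w g) \<gamma>" .
  qed
  show ?thesis
    unfolding complete_metric_def R.M.mcomplete_def
  proof (intro allI impI)
    fix \<sigma> assume \<sigma>: "R.M.MCauchy \<sigma>"
    have "M.MCauchy \<sigma>"
      unfolding M.MCauchy_def
    proof (intro conjI allI impI)
      fix e :: real assume "e > 0"
      then have "l * e > 0" using l by simp
      then obtain N where N: "\<And>n n'. N \<le> n \<Longrightarrow> N \<le> n' \<Longrightarrow> riemannian_dist A (conformal_metric w g) (\<sigma> n) (\<sigma> n') < l * e"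
        using \<sigma> unfolding R.M.MCauchy_def by meson
      have "d (\<sigma> n) (\<sigma> n') < e" if "N \<le> n" "N \<le> n'" for n n'
        using le_less_trans[OF dist N[OF that]] l by simp
      then show "\<exists>N. \<forall>n n'. N \<le> n \<longrightarrow> N \<le> n' \<longrightarrow> d (\<sigma> n) (\<sigma> n') < e" by blast
    qed simp
    then obtain x where "limitin M.mtopology \<sigma> x sequentially"
      using complete unfolding complete_metric_def M.mcomplete_def by blast
    then show "\<exists>x. limitin R.M.mtopology \<sigma> x sequentially"
      unfolding mtopology_eq R.mtopology_eq by blast
  qed
qed

end

text \<open>The strong maximum principle read in a chart around each zero, with \<open>k\<close>
  times the scalar curvature as zeroth-order coefficient; \<open>R\<close> and
  \<open>k \<ge> 0\<close> supply its sign.\<close>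

lemma zero_set_open:
  fixes u :: "'m::{t2_space,second_countable_topology} \<Rightarrow> real"
  assumes A: "smooth_atlas (A :: ('m, 'n::finite) chart set)" and g: "riemannian_metric A \<infinity> g"
    and R: "\<forall>c\<in>A. \<forall>x\<in>fst c. 0 \<le> scalar_curvature g c x" and k: "k \<ge> 0"
    and u: "C_manifold A 2 u" "\<And>x. 0 \<le> u x"
    and super: "\<And>c x. c \<in> A \<Longrightarrow> x \<in> fst c \<Longrightarrow> laplace_beltrami g c u x \<le> k * scalar_curvature g c x * u x"
  shows "open {x. u x = 0}"
proof (subst open_subopen, intro ballI)
  fix x assume x: "x \<in> {x. u x = 0}"
  obtain c where c: "c \<in> A" "x \<in> fst c" using A unfolding smooth_atlas_def by blast
  define U G where "U = snd c ` fst c" and "G = coord_metric g c"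
  have c_props: "open (fst c)" "homeomorphism (fst c) U (snd c) (chart_inv c)"
    using A c unfolding smooth_atlas_def U_def by auto
  have inv: "chart_inv c y \<in> fst c" "snd c (chart_inv c y) = y" if "y \<in> U" for y
    using c_props(2) that by (auto simp: homeomorphism_def)
  have left: "chart_inv c (snd c z) = z" if "z \<in> fst c" for z
    using c_props(2) that by (auto simp: homeomorphism_def)
  interpret coordinate_metric U G
    unfolding U_def G_def by (rule coordinate_metric_chart(1)[OF A g c(1)])
  define b where "b = (\<lambda>k y. - (\<Sum>i\<in>UNIV. \<Sum>j\<in>UNIV. matrix_inv (G y) $ i $ j * christoffel G k i j y))"
  interpret elliptic_operator U "\<lambda>i j y. matrix_inv (G y) $ i $ j" b "\<lambda>y. k * metric_trace G (ricci G) y"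
  proof
    show h: "continuous_on U (\<lambda>y. matrix_inv (G y) $ i $ j)" for i j
      using Ck_on_continuous[OF inv_C2] .
    show "continuous_on U (b k)" for k
      unfolding b_def
      by (intro continuous_on_minus continuous_on_sum continuous_on_mult h Ck_on_continuous[OF christoffel_C1])
    show "continuous_on U (\<lambda>y. k * metric_trace G (ricci G) y)"
      by (intro continuous_intros scalar_continuous)
    show "0 < quad (\<lambda>i j. matrix_inv (G z) $ i $ j) (($) v)" if "z \<in> U" "v \<noteq> 0" for z v
      using coordinate_metric_chart(2)[OF A g c(1), of z] that
      by (intro inverse_positive) (auto simp: U_def G_def)
    show "0 \<le> k * metric_trace G (ricci G) z" if "z \<in> U" for z
      using R c inv[OF that] k by (auto simp: scalar_curvature_def G_def intro!: mult_nonneg_nonneg dest!: bspec[of _ _ c] bspec[of _ _ "chart_inv c z"])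
  qed (auto simp: open_U inv_sym)
  have "\<exists>\<rho>>0. ball (snd c x) \<rho> \<subseteq> U \<and> (\<forall>z\<in>ball (snd c x) \<rho>. (u \<circ> chart_inv c) z = 0)"
  proof (rule strong_maximum_principle)
    show "Ck_on 2 (u \<circ> chart_inv c) U"
      using u(1) c(1) by (simp add: C_manifold_def C_on_numeral U_def)
    show "second_order (\<lambda>i j y. matrix_inv (G y) $ i $ j) b (u \<circ> chart_inv c) z
        \<le> k * metric_trace G (ricci G) z * (u \<circ> chart_inv c) z" if "z \<in> U" for z
      using super[OF c(1) inv(1)[OF that]] inv(2)[OF that]
      unfolding b_def laplacian_second_order[symmetric]
      by (simp add: laplace_beltrami_def scalar_curvature_def G_def)
  qed (use u(2) c x left in \<open>auto simp: U_def\<close>)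
  then obtain \<rho> where \<rho>: "\<rho> > 0" "ball (snd c x) \<rho> \<subseteq> U" "\<And>z. z \<in> ball (snd c x) \<rho> \<Longrightarrow> u (chart_inv c z) = 0"
    by (elim exE conjE) simp
  let ?T = "fst c \<inter> snd c -` ball (snd c x) \<rho>"
  have "open ?T"
    using c_props by (intro continuous_open_preimage) (auto simp: homeomorphism_def)
  moreover have "x \<in> ?T" using c \<rho>(1) by simp
  moreover have "?T \<subseteq> {x. u x = 0}"
  proof
    fix z assume z: "z \<in> ?T"
    then have "u (chart_inv c (snd c z)) = 0" by (intro \<rho>(3)) auto
    then show "z \<in> {x. u x = 0}" using z left by simp
  qed
  ultimately show "\<exists>T. open T \<and> x \<in> T \<and> T \<subseteq> {x. u x = 0}" by blast
qed


theorem theorem3: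
  fixes A :: "('m::{t2_space,second_countable_topology}, 'n::finite) chart set"
    and g0 :: "('m, 'n) metric_field"
    and p :: 'm
  assumes dim: "CARD('n) \<ge> 3"
    and manifold: "smooth_atlas A"
    and connected: "connected (UNIV :: 'm set)"
    and noncompact: "\<not> compact (UNIV :: 'm set)"
    and metric: "riemannian_metric A \<infinity> g0"
    and complete: "complete_metric A g0"
    and nonneg: "\<forall>c\<in>A. \<forall>x\<in>fst c. scalar_curvature g0 c x \<ge> 0"
    and property_M: "property_M A g0 p"
  shows "\<exists>w :: 'm \<Rightarrow> real. C_manifold A 2 w \<and> (\<forall>x. 0 < w x) \<and>
           riemannian_metric A 2 (conformal_metric w g0) \<and>
           complete_metric A (conformal_metric w g0) \<and>
           (\<forall>c\<in>A. \<forall>x\<in>fst c. scalar_curvature (conformal_metric w g0) c x = 0)"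
proof -
  note smooth = metric
  interpret riemannian_manifold A g0
    by unfold_locales (use manifold riemannian_metric_mono[OF smooth] connected in auto)
  define n where "n = real CARD('n)"
  have n: "n \<ge> 3" using dim by (simp add: n_def)
  \<comment> \<open>Reciprocal of the constant in the conformal Laplacian, so that the equation can
    be solved for the Laplacian of \<open>v\<close>.\<close>
  define k where "k = (n - 2) / (4 * (n - 1))"
  have "a / b * (b / a) = 1" if "a \<noteq> 0" "b \<noteq> 0" for a b :: real using that by simp
  from this[of "4 * (n - 1)" "n - 2"] have k: "k > 0" "4 * (n - 1) / (n - 2) * k = 1"
    using n by (simp_all add: k_def del: times_divide_times_eq)
  obtain v where v: "C_manifold A \<infinity> v" "\<And>x. 0 < v x"
    "\<And>c x. c \<in> A \<Longrightarrow> x \<in> fst c \<Longrightarrow> conformal_laplacian g0 c v x = scalar_curvature g0 c x"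
    "(v \<longlongrightarrow> 0) (manifold_at_infinity A g0 p)"
    using property_M unfolding property_M_def by blast
  have v2: "C_manifold A 2 v"
    using v(1) by (auto simp: C_manifold_def intro: C_on_mono)
  have contv: "continuous_on UNIV v" by (rule C_manifold_continuous[OF v2])
  have lap_v: "laplace_beltrami g0 c v x = k * scalar_curvature g0 c x * (v x - 1)"
    if "c \<in> A" "x \<in> fst c" for c x
  proof -
    have eq: "4 * (n - 1) / (n - 2) * laplace_beltrami g0 c v x = scalar_curvature g0 c x * (v x - 1)"
      using v(3)[OF that] by (simp add: conformal_laplacian_def n_def[symmetric] algebra_simps)
    have "laplace_beltrami g0 c v x = (4 * (n - 1) / (n - 2) * k) * laplace_beltrami g0 c v x"
      unfolding k(2) by simp
    also have "\<dots> = k * (4 * (n - 1) / (n - 2) * laplace_beltrami g0 c v x)"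
      by (simp only: mult_ac)
    finally show ?thesis unfolding eq by (simp only: mult.assoc)
  qed
  have C2: "C_manifold A 2 (\<lambda>x. K - v x)" for K
    using v2 chart_open(2) by (auto simp: C_manifold_def C_on_numeral o_def intro!: Ck_on_diff)
  \<comment> \<open>A constant has no Laplacian, so \<open>K\<close> does not appear on the right.
    It will be the maximum \<open>m\<close> of \<open>v\<close> in the comparison function, and 1 in
    \<open>w\<close>.\<close>
  have lap_minus: "laplace_beltrami g0 c (\<lambda>x. K - v x) x = k * scalar_curvature g0 c x * (1 - v x)"
    if c: "c \<in> A" "x \<in> fst c" for c x K
  proof -
    interpret coordinate_metric "snd c ` fst c" "coord_metric g0 c"
      by (rule coordinate_metric_chart(1)[OF manifold smooth c(1)])
    have "laplace_beltrami g0 c (\<lambda>x. K - v x) x = - laplace_beltrami g0 c v x"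
      unfolding laplace_beltrami_def o_def
      by (rule laplacian_minus) (use v2 c in \<open>auto simp: C_manifold_def C_on_numeral o_def\<close>)
    then show ?thesis using lap_v[OF c] by (simp add: algebra_simps)
  qed
  \<comment> \<open>Any bound strictly between 0 and 1 would do: outside a large ball
    \<open>v\<close> stays away from the critical value 1.\<close>
  obtain r where r: "\<And>x. \<not> d p x \<le> r \<Longrightarrow> v x < 1 / 2"
  proof -
    have "\<forall>\<^sub>F x in manifold_at_infinity A g0 p. dist (v x) 0 < 1 / 2"
      using v(4) by (rule tendstoD) simp
    then obtain r where r: "\<And>x. d x p \<ge> r \<Longrightarrow> dist (v x) 0 < 1 / 2"
      unfolding manifold_at_infinity_def eventually_filtercomap eventually_at_top_linorder by blast
    have "v x < 1 / 2" if "\<not> d p x \<le> r" for x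
      using r[of x] that dist_sym[of p x] by (simp add: dist_real_def)
    with that show thesis by blast
  qed
  define K where "K = {x. d p x \<le> r}"
  have K: "compact K" unfolding K_def by (rule complete_imp_proper[OF complete])
  \<comment> \<open>Noncompactness provides a point \<open>q\<close> outside \<open>K\<close>, where
    \<open>v\<close> is below 1/2; it will rule out that \<open>v\<close> is constant with value at
    least 1.\<close>
  have "K \<noteq> UNIV" using K noncompact by auto
  then obtain q where q: "v q < 1 / 2" using r by (auto simp: K_def)
  have v_less: "v x < 1" for x
  proof (rule ccontr)
    assume x: "\<not> v x < 1"
    then have "x \<in> K" using r[of x] by (auto simp: K_def)
    then obtain x1 where x1: "x1 \<in> K" "\<And>y. y \<in> K \<Longrightarrow> v y \<le> v x1"
      using continuous_attains_sup[OF K _ continuous_on_subset[OF contv]] by blast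
    define m where "m = v x1"
    have m: "m \<ge> 1" using x1(2)[OF \<open>x \<in> K\<close>] x by (simp add: m_def)
    \<comment> \<open>A maximum over \<open>K\<close> that is at least 1 is global, because
      \<open>v\<close> is below 1/2 off \<open>K\<close>.\<close>
    have le: "v y \<le> m" for y
      using x1(2)[of y] r[of y] m by (cases "y \<in> K") (auto simp: m_def K_def)
    define Z where "Z = {y. m - v y = 0}"
    have "open Z"
      unfolding Z_def
    proof (rule zero_set_open[OF manifold smooth nonneg _ C2])
      fix c y assume c: "c \<in> A" "y \<in> fst c"
      \<comment> \<open>The equation has \<open>1 - v\<close> on the right; since \<open>m\<close>
        is at least 1 and the curvature nonnegative, \<open>m - v\<close> bounds it from
        above.\<close>
      show "laplace_beltrami g0 c (\<lambda>x. m - v x) y \<le> k * scalar_curvature g0 c y * (m - v y)"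
        unfolding lap_minus[OF c] using m k nonneg c by (intro mult_left_mono mult_nonneg_nonneg) auto
    qed (use k le in auto)
    moreover have "closed Z"
      unfolding Z_def by (intro closed_Collect_eq continuous_intros contv)
    moreover have "x1 \<in> Z" by (simp add: Z_def m_def)
    ultimately have "Z = UNIV"
      using connected unfolding connected_clopen[of UNIV] by (auto simp: openin_open closedin_closed)
    then have "m - v q = 0" unfolding Z_def by blast
    with m q show False by simp
  qed
  define w where "w x = 1 - v x" for x
  have w_pos: "0 < w x" for x using v_less[of x] by (simp add: w_def)
  have w2: "C_manifold A 2 w" using C2[of 1] by (simp add: w_def[abs_def])
  have g1: "riemannian_metric A 2 (conformal_metric w g0)"
    by (rule riemannian_metric_conformal[OF manifold riemannian_metric_mono[OF smooth] w2 w_pos]) simp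
  \<comment> \<open>Compactness gives a positive minimum on \<open>K\<close>, and off
    \<open>K\<close> the value exceeds 1/2; \<open>K\<close> is empty if \<open>r\<close> is
    negative.\<close>
  obtain \<epsilon> where \<epsilon>: "\<epsilon> > 0" "\<And>x. \<epsilon> \<le> w x"
  proof (cases "K = {}")
    case True
    then have "1 / 2 \<le> w x" for x using r[of x] by (auto simp: w_def K_def)
    then show thesis using that[of "1 / 2"] by simp
  next
    case False
    then obtain x1 where x1: "\<And>y. y \<in> K \<Longrightarrow> v y \<le> v x1"
      using continuous_attains_sup[OF K _ continuous_on_subset[OF contv]] by blast
    have "min (w x1) (1 / 2) \<le> w x" for x
      using x1[of x] r[of x] by (cases "x \<in> K") (auto simp: w_def K_def min_def)
    then show thesis using that[of "min (w x1) (1 / 2)"] w_pos[of x1] by simp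
  qed
  have "complete_metric A (conformal_metric w g0)"
    by (rule conformal_complete[OF complete riemannian_metric_mono[OF g1] \<epsilon> dim]) simp
  moreover have "scalar_curvature (conformal_metric w g0) c x = 0" if c: "c \<in> A" "x \<in> fst c" for c x
  proof -
    interpret coordinate_metric "snd c ` fst c" "coord_metric g0 c"
      by (rule coordinate_metric_chart(1)[OF manifold smooth c(1)])
    have "Ck_on 2 (w \<circ> chart_inv c) (snd c ` fst c)"
      using w2 c by (simp add: C_manifold_def C_on_numeral)
    moreover have "snd c x \<in> snd c ` fst c" using c by simp
    moreover have "coord_metric (conformal_metric w g0) c =
        (\<lambda>y. ((w \<circ> chart_inv c) y powr (4 / (n - 2))) *\<^sub>R coord_metric g0 c y)"
      by (simp add: fun_eq_iff coord_metric_def conformal_metric_def n_def)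
    ultimately have "scalar_curvature (conformal_metric w g0) c x = w x powr (- 4 / (n - 2)) *
        (scalar_curvature g0 c x - 4 * (n - 1) / (n - 2) * laplace_beltrami g0 c w x / w x)"
      using scalar_curvature_conformal[of "w \<circ> chart_inv c" "snd c x"] w_pos dim chart_left[OF c]
      by (simp add: scalar_curvature_def laplace_beltrami_def n_def)
    also have "laplace_beltrami g0 c w x = k * scalar_curvature g0 c x * w x"
      using lap_minus[OF c, of 1] by (simp add: w_def[abs_def])
    also have "4 * (n - 1) / (n - 2) * (k * scalar_curvature g0 c x * w x) / w x = scalar_curvature g0 c x"
    proof -
      have "a * (k * s * W) / W = (a * k) * s" if "W > 0" for a s W :: real using that by simp
      from this[OF w_pos[of x], of "4 * (n - 1) / (n - 2)"] show ?thesis unfolding k(2) by simp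
    qed
    finally show ?thesis by simp
  qed
  ultimately show ?thesis using w2 w_pos g1 by blast
qed

end
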